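(* Let $q$ be a prime power, let $N,D$ be integers with $D\ge3$, $N\ge2D$, let $\Gamma=J_q(N,D)$, let $C$ be a Delsarte clique of $\Gamma$ and $x\in C$. Let $A$ be the adjacency matrix of $\Gamma$, $A^*$ the dual adjacency matrix with respect to $x$, and $\widetilde A^*$ the dual adjacency matrix with respect to $C$. Let $\mathbf W=\mathrm{span}\{\hat C^\pm_i\}_{i=0}^{D-1}$, regarded as an $\mathcal H_{\mathrm V}$-module, and let $$\mathcal A=\mathcal X+\mathcal X^{-1}\ \ (\mathcal X=\mathcal T'\mathcal T),\qquad \mathcal A^*=qk(q^{-1/2}\mathcal U\mathcal T'+\mathcal T\mathcal U'),\qquad \widetilde{\mathcal A}^*=qk(q^{1/2}\mathcal U\mathcal T'+\mathcal T\mathcal U')$$ in $\mathcal H_{\mathrm V}$. Then on $\mathbf W$, $$A=\tau b\,\mathcal A+a,\qquad A^*=b^*\mathcal A^*+a^*,\qquad \widetilde A^*=\widetilde b^*\,\widetilde{\mathcal A}^*+\widetilde a^*,$$ where $\tau=-q^{(-N-1)/2}$ and $$a=\frac{q-q^{N-D+1}-q^{D+1}-1}{(q-1)^2},\quad b=\frac{q^{N+1}}{(q-1)^2},\quad a^*=\frac{(q^N-q)(2-q^D-q^{N-D})}{(q-1)(q^D-1)(q^{N-D}-1)},\quad b^*=\frac{(q^N-q)(q^N-1)}{(q-1)(q^D-1)(q^{N-D}-1)},$$ $$\widetilde a^*=a^*+\frac{q-1}{q^{N-D+1}-1}b^*,\qquad \widetilde b^*=\frac{q^{N-D}-1}{q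^{N-D+1}-1}b^*.$$
   Context: Graph notation. $[n]:=\frac{q^n-1}{q-1}$. $\Gamma=J_q(N,D)$ has as vertex set $X$ all $D$-dimensional subspaces of an $N$-dimensional vector space over $\mathbb F_q$, adjacency meaning intersection of dimension $D-1$; $\partial$ is path-length distance. The eigenvalues of $A$ are $\theta_i=q^{i+1}[D-i][N-D-i]-[i]$, $0\le i\le D$; $E_i$ is the orthogonal projection of $\mathbb C^X$ onto the $\theta_i$-eigenspace. A Delsarte clique is a clique of size $[N-D+1]$ (attaining the Hoffman bound). For $0\le i\le D-1$: $C_i=\{y\in X:\min_{z\in C}\partial(y,z)=i\}$, $C^-_i=\{y\in C_i:\partial(x,y)=i\}$, $C^+_i=\{y\in C_i:\partial(x,y)=i+1\}$ (all nonempty, partitioning $X$). $\hat Y\in\mathbb C^X$ is the characteristic vector of $Y\subseteq X$. For a vertex $y$, $A^*(y)$ is the diagonal matrix with $(z,z)$-entry $|X|(E_1)_{yz}$; $A^*=A^*(x)$ and $\widetilde A^*=|C|^{-1}\sum_{y\in C}A^*(y)$. (Known: the $(z,z)$-entry of $A^*$ is $\theta^*_{\partial(x,z)}$ with $\theta^*_i=\frac{(q^N-q)(2-q^D-q^{N-D})}{(q-1)(q^D-1)(q^{N-D}-1)}+\frac{(q^N-q)(q^N-1)}{(q-1)(q^D-1)(q^{N-D}-1)}q^{-i}$.) $\mathbf W$ is invariant under $A,A^*,\widetilde A^*$. Algebra. $k=\sqrt{-1}q^{(D-N-1)/2}$, $k'=\sqrt{-1}q^{-D/2}$, $u=q^{D-N/2}$;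 $q^{1/2}>0$. $\mathcal H_{\mathrm V}=\mathcal H_{\mathrm V}(k,k',u;q)$ is the associative unital $\mathbb C$-algebra with generators $\mathcal T,\mathcal T',\mathcal U,\mathcal U'$ and relations $(\mathcal T-k)(\mathcal T+k^{-1})=0$, $\mathcal U'(\mathcal U'+1)=0$, $(\mathcal T'-k')(\mathcal T'+k'^{-1})=0$, $\mathcal U(\mathcal U+u^{-1})=0$, $q^{1/2}\mathcal T'\mathcal T\mathcal U'=\mathcal U+u^{-1}$, $q^{1/2}\mathcal U\mathcal T'\mathcal T=\mathcal U'+1$. ($\mathcal T,\mathcal T'$ are invertible.) Module structure. With respect to the ordered basis $\hat C^-_0,\hat C^+_0,\hat C^-_1,\hat C^+_1,\dots,\hat C^-_{D-1},\hat C^+_{D-1}$ of $\mathbf W$ (columns = images of basis vectors), $\mathcal T,\mathcal U',\mathcal T',\mathcal U$ act as $\mathrm{blockdiag}[t(0),\dots,t(D-1)]$, $\mathrm{blockdiag}[u'(0),\dots,u'(D-1)]$, $\mathrm{blockdiag}[t'(0),\dots,t'(D)]$, $\mathrm{blockdiag}[u(0),\dots,u(D)]$ respectively, where for $0\le i\le D-1$ $$t(i)=k\begin{bmatrix}1-q^{i+1}+q^{N-D+1}& q^{N-D+1}(q^{D-N+i}-1)\\ 1-q^{i+1}&q^{i+1}\end{bmatrix},\qquad u'(i)=\begin{bmatrix}-1&0\\ q^{-i-1}-1&0\end{bmatrix},$$ for $1\le i\le D-1$ $$t'(i)=k'\begin{bmatrix}1-q^i+q^D&q^i-q^D\\1-q^i&q^i\end{bmatrix},\qquad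 u(i)=u^{-1}\begin{bmatrix}-1&1-q^{D-i}\\0&0\end{bmatrix},$$ and $t'(0)=t'(D)=[k']$, $u(0)=[0]$, $u(D)=[-u^{-1}]$ are $1\times1$. *)

theory Defs
  imports
    "HOL-Analysis.Analysis"
    "HOL-Algebra.QuotRing"
    "HOL-Library.Poly_Mapping"
begin

section \<open>The Grassmann graph\<close>

text \<open>
  The field with \<open>q\<close> elements is a finite field type \<open>'f\<close> with \<open>CARD('f) = q\<close>, and the
  \<open>N\<close>-dimensional vector space is \<open>'f ^ 'n\<close> with \<open>CARD('n) = N\<close>.
\<close>

definition qnum :: "real \<Rightarrow> nat \<Rightarrow> real" where
  "qnum q n = (q ^ n - 1) / (q - 1)"

definition grass_verts :: "nat \<Rightarrow> ('f::{field,finite} ^ 'n) set set" where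
  "grass_verts D = {y. vec.subspace y \<and> vec.dim y = D}"

definition grass_adj :: "nat \<Rightarrow> ('f::{field,finite} ^ 'n) set \<Rightarrow> ('f ^ 'n) set \<Rightarrow> bool" where
  "grass_adj D y z \<longleftrightarrow>
     y \<in> grass_verts D \<and> z \<in> grass_verts D \<and> vec.dim (y \<inter> z) = D - 1"

definition grass_dist :: "nat \<Rightarrow> ('f::{field,finite} ^ 'n) set \<Rightarrow> ('f ^ 'n) set \<Rightarrow> nat" where
  "grass_dist D y z = (LEAST n. (y, z) \<in> {(v, w). grass_adj D v w} ^^ n)"

definition delsarte_clique :: "nat \<Rightarrow> ('f::{field,finite} ^ 'n) set set \<Rightarrow> bool" where
  "delsarte_clique D C \<longleftrightarrow>
     C \<subseteq> grass_verts D \<and>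
     (\<forall>y\<in>C. \<forall>z\<in>C. y \<noteq> z \<longrightarrow> grass_adj D y z) \<and>
     real (card C) = qnum (real CARD('f)) (CARD('n) - D + 1)"

definition clique_part ::
    "nat \<Rightarrow> ('f::{field,finite} ^ 'n) set set \<Rightarrow> nat \<Rightarrow> ('f ^ 'n) set set" where
  "clique_part D C i = {y \<in> grass_verts D. Min (grass_dist D y ` C) = i}"

definition clique_minus ::
    "nat \<Rightarrow> ('f::{field,finite} ^ 'n) set set \<Rightarrow> ('f ^ 'n) set \<Rightarrow> nat \<Rightarrow> ('f ^ 'n) set set" where
  "clique_minus D C x i = {y \<in> clique_part D C i. grass_dist D x y = i}"

definition clique_plus ::
    "nat \<Rightarrow> ('f::{field,finite} ^ 'n) set set \<Rightarrow> ('f ^ 'n) set \<Rightarrow> nat \<Rightarrow> ('f ^ 'n) set set" where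
  "clique_plus D C x i = {y \<in> clique_part D C i. grass_dist D x y = i + 1}"


section \<open>Adjacency and dual adjacency matrices\<close>

text \<open>
  Writing \<open>X\<close> for \<^term>\<open>grass_verts D\<close>, the space of complex vectors indexed by \<open>X\<close> is represented
  by the vectors indexed by all subsets of \<open>'f ^ 'n\<close> that vanish off \<open>X\<close>. Matrices
  indexed by \<open>X\<close> are likewise extended by zero.
\<close>

definition char_vec :: "'v set \<Rightarrow> complex ^ 'v::finite" where
  "char_vec Y = (\<chi> y. if y \<in> Y then 1 else 0)"

definition adj_matrix ::
    "nat \<Rightarrow> complex ^ ('f::{field,finite} ^ 'n) set ^ ('f ^ 'n) set" where
  "adj_matrix D = (\<chi> y z. if grass_adj D y z then 1 else 0)"

definition grass_theta :: "real \<Rightarrow> nat \<Rightarrow> nat \<Rightarrow> nat \<Rightarrow> real" where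
  "grass_theta q N D i = q ^ (i + 1) * qnum q (D - i) * qnum q (N - D - i) - qnum q i"

definition grass_eigenspace ::
    "nat \<Rightarrow> nat \<Rightarrow> (complex ^ ('f::{field,finite} ^ 'n) set) set" where
  "grass_eigenspace D i =
     {v. (\<forall>y. y \<notin> grass_verts D \<longrightarrow> v $ y = 0) \<and>
         adj_matrix D *v v
           = complex_of_real (grass_theta (real CARD('f)) CARD('n) D i) *s v}"

definition hermitian_inner :: "complex ^ 'v::finite \<Rightarrow> complex ^ 'v \<Rightarrow> complex" where
  "hermitian_inner v w = (\<Sum>y\<in>UNIV. v $ y * cnj (w $ y))"

definition orth_proj :: "(complex ^ 'v::finite) set \<Rightarrow> complex ^ 'v ^ 'v" where
  "orth_proj S =
     (THE P. \<forall>v. P *v v \<in> S \<and> (\<forall>w\<in>S. hermitian_inner (v - P *v v) w = 0))"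

text \<open>
  Vectors supported off \<open>X\<close> are orthogonal to every eigenspace, so \<open>grass_E D i\<close> is
  the projection within the space indexed by \<open>X\<close>, extended by zero.
\<close>

definition grass_E ::
    "nat \<Rightarrow> nat \<Rightarrow> complex ^ ('f::{field,finite} ^ 'n) set ^ ('f ^ 'n) set" where
  "grass_E D i = orth_proj (grass_eigenspace D i)"

definition dual_adj_matrix ::
    "nat \<Rightarrow> ('f::{field,finite} ^ 'n) set \<Rightarrow> complex ^ ('f ^ 'n) set ^ ('f ^ 'n) set" where
  "dual_adj_matrix D y =
     (\<chi> z z'. if z = z'
        then of_nat (card (grass_verts D :: ('f ^ 'n) set set)) * grass_E D 1 $ y $ z else 0)"

definition dual_adj_matrix_clique ::
    "nat \<Rightarrow> ('f::{field,finite} ^ 'n) set set \<Rightarrow> complex ^ ('f ^ 'n) set ^ ('f ^ 'n) set" where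
  "dual_adj_matrix_clique D C = (1 / real (card C)) *\<^sub>R (\<Sum>y\<in>C. dual_adj_matrix D y)"


section \<open>The algebra given by generators and relations\<close>

text \<open>
  The free unital associative complex algebra on four generators is the monoid algebra of the
  free monoid; \<open>Poly_Mapping\<close> multiplication is convolution for the additively written
  monoid of words.
\<close>

datatype hv_gen = Gen_T | Gen_T' | Gen_U | Gen_U'

datatype hv_word = Word "hv_gen list"

instantiation hv_word :: monoid_add
begin

definition zero_hv_word :: hv_word where
  "0 = Word []"

fun plus_hv_word :: "hv_word \<Rightarrow> hv_word \<Rightarrow> hv_word" where
  "Word r + Word s = Word (r @ s)"

instance
proof
  fix a b c :: hv_word
  show "a + b + c = a + (b + c)"
    by (cases a; cases b; cases c) simp
  show "0 + a = a" "a + 0 = a"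
    by (cases a; simp add: zero_hv_word_def)+
qed

end

type_synonym hv_free = "hv_word \<Rightarrow>\<^sub>0 complex"

definition hv_gen :: "hv_gen \<Rightarrow> hv_free" where
  "hv_gen g = Poly_Mapping.single (Word [g]) 1"

definition hv_const :: "complex \<Rightarrow> hv_free" where
  "hv_const c = Poly_Mapping.single 0 c"

abbreviation gT :: hv_free where "gT \<equiv> hv_gen Gen_T"
abbreviation gT' :: hv_free where "gT' \<equiv> hv_gen Gen_T'"
abbreviation gU :: hv_free where "gU \<equiv> hv_gen Gen_U"
abbreviation gU' :: hv_free where "gU' \<equiv> hv_gen Gen_U'"

definition hv_free_ring :: "hv_free ring" where
  "hv_free_ring = \<lparr>carrier = UNIV, mult = (*), one = 1, zero = 0, add = (+)\<rparr>"

definition hv_relators :: "complex \<Rightarrow> complex \<Rightarrow> complex \<Rightarrow> real \<Rightarrow> hv_free set" where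
  "hv_relators k k' u q =
     {(gT - hv_const k) * (gT + hv_const (inverse k)),
      gU' * (gU' + 1),
      (gT' - hv_const k') * (gT' + hv_const (inverse k')),
      gU * (gU + hv_const (inverse u)),
      hv_const (complex_of_real (sqrt q)) * gT' * gT * gU' - (gU + hv_const (inverse u)),
      hv_const (complex_of_real (sqrt q)) * gU * gT' * gT - (gU' + 1)}"

definition hv_ideal :: "complex \<Rightarrow> complex \<Rightarrow> complex \<Rightarrow> real \<Rightarrow> hv_free set" where
  "hv_ideal k k' u q = Idl\<^bsub>hv_free_ring\<^esub> (hv_relators k k' u q)"

definition hv_algebra :: "complex \<Rightarrow> complex \<Rightarrow> complex \<Rightarrow> real \<Rightarrow> hv_free set ring" where
  "hv_algebra k k' u q = hv_free_ring Quot hv_ideal k k' u q"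

definition hv_class :: "complex \<Rightarrow> complex \<Rightarrow> complex \<Rightarrow> real \<Rightarrow> hv_free \<Rightarrow> hv_free set" where
  "hv_class k k' u q p = hv_ideal k k' u q +>\<^bsub>hv_free_ring\<^esub> p"

definition hv_X :: "complex \<Rightarrow> complex \<Rightarrow> complex \<Rightarrow> real \<Rightarrow> hv_free set" where
  "hv_X k k' u q = hv_class k k' u q (gT' * gT)"

definition hv_A :: "complex \<Rightarrow> complex \<Rightarrow> complex \<Rightarrow> real \<Rightarrow> hv_free set" where
  "hv_A k k' u q =
     hv_X k k' u q \<oplus>\<^bsub>hv_algebra k k' u q\<^esub> inv\<^bsub>hv_algebra k k' u q\<^esub> hv_X k k' u q"

definition hv_A_star :: "complex \<Rightarrow> complex \<Rightarrow> complex \<Rightarrow> real \<Rightarrow> hv_free set" where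
  "hv_A_star k k' u q =
     hv_class k k' u q
       (hv_const (of_real q * k)
          * (hv_const (of_real (q powr (-1/2))) * gU * gT' + gT * gU'))"

definition hv_A_star_tilde :: "complex \<Rightarrow> complex \<Rightarrow> complex \<Rightarrow> real \<Rightarrow> hv_free set" where
  "hv_A_star_tilde k k' u q =
     hv_class k k' u q
       (hv_const (of_real q * k)
          * (hv_const (of_real (q powr (1/2))) * gU * gT' + gT * gU'))"

text \<open>
  A left module over the complex algebra on the subspace \<open>W\<close>; only the restriction of
  \<open>\<rho> h\<close> to \<open>W\<close> matters. The unit law is the last clause with \<open>c = 1\<close>.
\<close>

definition hv_module ::
    "complex \<Rightarrow> complex \<Rightarrow> complex \<Rightarrow> real \<Rightarrow> (complex ^ 'v::finite) set
      \<Rightarrow> (hv_free set \<Rightarrow> complex ^ 'v \<Rightarrow> complex ^ 'v) \<Rightarrow> bool" where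
  "hv_module k k' u q W \<rho> \<longleftrightarrow>
     (let H = hv_algebra k k' u q in
       vec.subspace W \<and>
       (\<forall>h\<in>carrier H. \<forall>v\<in>W. \<rho> h v \<in> W) \<and>
       (\<forall>h\<in>carrier H. \<forall>v\<in>W. \<forall>w\<in>W. \<rho> h (v + w) = \<rho> h v + \<rho> h w) \<and>
       (\<forall>h\<in>carrier H. \<forall>c. \<forall>v\<in>W. \<rho> h (c *s v) = c *s \<rho> h v) \<and>
       (\<forall>g\<in>carrier H. \<forall>h\<in>carrier H. \<forall>v\<in>W. \<rho> (g \<oplus>\<^bsub>H\<^esub> h) v = \<rho> g v + \<rho> h v) \<and>
       (\<forall>g\<in>carrier H. \<forall>h\<in>carrier H. \<forall>v\<in>W. \<rho> (g \<otimes>\<^bsub>H\<^esub> h) v = \<rho> g (\<rho> h v)) \<and>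
       (\<forall>c. \<forall>v\<in>W. \<rho> (hv_class k k' u q (hv_const c)) v = c *s v))"


section \<open>The action of the generators\<close>

definition mat22 :: "complex \<Rightarrow> complex \<Rightarrow> complex \<Rightarrow> complex \<Rightarrow> complex ^ 2 ^ 2" where
  "mat22 a b c d = vector [vector [a, b], vector [c, d]]"

text \<open>The columns of \<open>M\<close> are the images of the ordered pair \<open>v, w\<close>.\<close>

definition acts_as_block ::
    "(complex ^ 'v::finite \<Rightarrow> complex ^ 'v) \<Rightarrow> complex ^ 'v \<Rightarrow> complex ^ 'v
      \<Rightarrow> complex ^ 2 ^ 2 \<Rightarrow> bool" where
  "acts_as_block f v w M \<longleftrightarrow>
     f v = M $ 1 $ 1 *s v + M $ 2 $ 1 *s w \<and>
     f w = M $ 1 $ 2 *s v + M $ 2 $ 2 *s w"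

definition block_t :: "complex \<Rightarrow> complex \<Rightarrow> nat \<Rightarrow> nat \<Rightarrow> nat \<Rightarrow> complex ^ 2 ^ 2" where
  "block_t k q N D i =
     mat22 (k * (1 - q ^ (i + 1) + q ^ (N - D + 1)))
           (k * (q ^ (N - D + 1) * (q powi (int D - int N + int i) - 1)))
           (k * (1 - q ^ (i + 1)))
           (k * q ^ (i + 1))"

definition block_u' :: "complex \<Rightarrow> nat \<Rightarrow> complex ^ 2 ^ 2" where
  "block_u' q i = mat22 (- 1) 0 (q powi (- int i - 1) - 1) 0"

definition block_t' :: "complex \<Rightarrow> complex \<Rightarrow> nat \<Rightarrow> nat \<Rightarrow> complex ^ 2 ^ 2" where
  "block_t' k' q D i =
     mat22 (k' * (1 - q ^ i + q ^ D)) (k' * (q ^ i - q ^ D))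
           (k' * (1 - q ^ i)) (k' * q ^ i)"

definition block_u :: "complex \<Rightarrow> complex \<Rightarrow> nat \<Rightarrow> nat \<Rightarrow> complex ^ 2 ^ 2" where
  "block_u u q D i =
     mat22 (inverse u * (- 1)) (inverse u * (1 - q ^ (D - i))) 0 0"

text \<open>
  The four generators act on \<open>em 0, ep 0, em 1, ep 1, \<dots>, em (D - 1), ep (D - 1)\<close> by
  block diagonal matrices. The blocks of \<open>T\<close> and \<open>U'\<close> belong to the pairs
  \<open>em i, ep i\<close>; those of \<open>T'\<close> and \<open>U\<close> are shifted by one position, belonging to
  \<open>ep (i - 1), em i\<close> for \<open>1 \<le> i \<le> D - 1\<close>, with blocks of size one at both ends.
\<close>

definition standard_action ::
    "complex \<Rightarrow> complex \<Rightarrow> complex \<Rightarrow> real \<Rightarrow> nat \<Rightarrow> nat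
      \<Rightarrow> (nat \<Rightarrow> complex ^ 'v::finite) \<Rightarrow> (nat \<Rightarrow> complex ^ 'v)
      \<Rightarrow> (hv_free set \<Rightarrow> complex ^ 'v \<Rightarrow> complex ^ 'v) \<Rightarrow> bool" where
  "standard_action k k' u q N D em ep \<rho> \<longleftrightarrow>
     (let T = \<rho> (hv_class k k' u q gT); T' = \<rho> (hv_class k k' u q gT');
          U = \<rho> (hv_class k k' u q gU); U' = \<rho> (hv_class k k' u q gU');
          Q = complex_of_real q
      in
       (\<forall>i<D. acts_as_block T (em i) (ep i) (block_t k Q N D i)) \<and>
       (\<forall>i<D. acts_as_block U' (em i) (ep i) (block_u' Q i)) \<and>
       T' (em 0) = k' *s em 0 \<and>
       (\<forall>i\<in>{1..D - 1}. acts_as_block T' (ep (i - 1)) (em i) (block_t' k' Q D i)) \<and>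
       T' (ep (D - 1)) = k' *s ep (D - 1) \<and>
       U (em 0) = 0 \<and>
       (\<forall>i\<in>{1..D - 1}. acts_as_block U (ep (i - 1)) (em i) (block_u u Q D i)) \<and>
       U (ep (D - 1)) = (- inverse u) *s ep (D - 1))"

end

theory Submission
  imports Defs
begin

text \<open>
  Going from a vertex down to its hyperplanes and up again is the operator \<open>A + [D] I\<close>. A Delsarte
  clique is the set of all vertices through a \<open>(D - 1)\<close>-space \<open>w\<close> or, when \<open>N = 2 D\<close>, the set of all
  vertices inside a \<open>(D + 1)\<close>-space \<open>w\<close>; its cells consist of the vertices \<open>y\<close> with prescribed
  dimensions of \<open>y \<inter> w\<close> and \<open>y \<inter> x\<close>, and counting extensions and hyperplanes relative to the
  flag of \<open>w\<close> and \<open>x\<close> gives the action of \<open>A\<close>.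

  The distance sums of an eigenvector around a vertex obey a three-term recurrence, so \<open>E\<^sub>1\<close> is the
  radial kernel whose entries are affine in \<open>q\<^sup>-\<^sup>i\<close>, that is, affine in the number of vectors
  common to two vertices; its normalisation comes from the second moment of that number.
  In coordinates on the two rows of cells, the claimed identities are then identities between
  rational functions of \<open>q\<^sup>i\<close>.
\<close>

section \<open>Counting subspaces over a finite field\<close>

text \<open>The two kinds of clique give flags in opposite order, \<open>w\<close> inside
  \<open>x\<close> or \<open>x\<close> inside \<open>w\<close>, and their cells are counted
  differently. The counts agree because the second kind occurs only for \<open>N = 2 D\<close>,
  where a hyperplane of a vertex has \<open>[D + 1]\<close> covers.

  \<open>E_1\<close> is identified without a spectral decomposition. The recurrence determines all
  distance sums of an eigenfunction around \<open>y\<close> from its value at \<open>y\<close>, so a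
  radial kernel acts on each eigenspace as a scalar. The columns of the kernel with entries
  \<open>\<theta>*_i\<close> are themselves eigenfunctions for \<open>\<theta>_1\<close>, so the
  scalar is found by applying the kernel to its own column; this is where the second moment enters.

  On the algebra side, \<open>\<rho>\<close> is prescribed on the four generators only, so the
  inverse of \<open>X\<close> must first be written as a polynomial in them, by means of the
  quadratic relations. Coefficient sequences on the two rows of cells are then compared term by
  term; at the ends of the rows the out-of-range terms carry coefficients that vanish.\<close>

lemma card_field_ge2: "2 \<le> CARD('f::{field,finite})"
proof -
  have "card {0, 1::'f} \<le> CARD('f)" by (intro card_mono) auto
  then show ?thesis by simp
qed

text \<open>Each basis vector contributes one factor: after adjoining \<open>b\<close> outside a
  span, every element of the larger span is a unique \<open>c *s b + v\<close>.\<close>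

lemma card_subspace:
  fixes S :: "('f::{field,finite} ^ 'n) set"
  assumes "vec.subspace S"
  shows "card S = CARD('f) ^ vec.dim S"
proof -
  have *: "card (vec.span B) = CARD('f) ^ card B" if "finite B" "vec.independent B" for B :: "('f ^ 'n) set"
    using that
  proof (induction B)
    case empty
    then show ?case by simp
  next
    case (insert b B)
    have nb: "b \<notin> vec.span B" and ind: "vec.independent B"
      using insert by (auto simp: vec.independent_insert split: if_splits)
    let ?f = "\<lambda>(c::'f, v::'f ^ 'n). c *s b + v"
    have "bij_betw ?f (UNIV \<times> vec.span B) (vec.span (insert b B))"
      unfolding bij_betw_def
    proof
      show "inj_on ?f (UNIV \<times> vec.span B)"
      proof (rule inj_onI, clarify)
        fix c c' :: 'f and v v' :: "'f ^ 'n"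
        assume v: "v \<in> vec.span B" "v' \<in> vec.span B" and e: "c *s b + v = c' *s b + v'"
        have e': "(c - c') *s b = v' - v"
          using e by (simp add: vec.scale_left_diff_distrib algebra_simps)
        have "c = c'"
        proof (rule ccontr)
          assume "c \<noteq> c'"
          then have "b = inverse (c - c') *s ((c - c') *s b)"
            by (subst vec.scale_scale) simp
          also have "\<dots> \<in> vec.span B"
            unfolding e' using v by (intro vec.span_scale vec.span_diff)
          finally show False using nb by simp
        qed
        with e show "c = c' \<and> v = v'" by simp
      qed
      show "?f ` (UNIV \<times> vec.span B) = vec.span (insert b B)"
      proof (intro equalityI subsetI)
        fix x assume "x \<in> vec.span (insert b B)"
        then obtain c where "x - c *s b \<in> vec.span B" by (auto simp: vec.span_insert)
        then have "?f (c, x - c *s b) \<in> ?f ` (UNIV \<times> vec.span B)" by blast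
        then show "x \<in> ?f ` (UNIV \<times> vec.span B)" by simp
      next
        fix x assume "x \<in> ?f ` (UNIV \<times> vec.span B)"
        then obtain c v where "v \<in> vec.span B" "x = c *s b + v" by auto
        then have "x - c *s b \<in> vec.span B" by simp
        then show "x \<in> vec.span (insert b B)" by (auto simp: vec.span_insert)
      qed
    qed
    then have "card (vec.span (insert b B)) = card ((UNIV :: 'f set) \<times> vec.span B)"
      by (simp add: bij_betw_same_card)
    then show ?case using insert ind by (simp add: card_cartesian_product)
  qed
  obtain B where "B \<subseteq> S" "vec.independent B" "S \<subseteq> vec.span B" "card B = vec.dim S"
    using vec.basis_exists by blast
  moreover from this have "vec.span B = S" using assms by (metis vec.span_subspace)
  ultimately show ?thesis using *[of B] by (simp add: finite_subset[of B UNIV])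
qed

lemma dim_insert_subspace:
  fixes S :: "('f::{field,finite} ^ 'n) set"
  assumes "vec.subspace S" "v \<notin> S"
  shows "vec.dim (vec.span (insert v S)) = vec.dim S + 1"
  using assms by (simp add: vec.dim_insert vec.span_eq_iff[THEN iffD2])

text \<open>The one-dimensional extensions of \<open>h\<close> in \<open>S\<close> partition \<open>S - h\<close> into parts of equal size.\<close>

lemma card_covers_subspace:
  fixes h S :: "('f::{field,finite} ^ 'n) set"
  assumes h: "vec.subspace h" and S: "vec.subspace S" and hS: "h \<subseteq> S"
  shows "real (card {z. vec.subspace z \<and> h \<subseteq> z \<and> z \<subseteq> S \<and> vec.dim z = vec.dim h + 1})
     = qnum (real CARD('f)) (vec.dim S - vec.dim h)"
proof -
  let ?Z = "{z. vec.subspace z \<and> h \<subseteq> z \<and> z \<subseteq> S \<and> vec.dim z = vec.dim h + 1}"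
  let ?q = "real CARD('f)"
  have q: "?q > 1" using card_field_ge2[where 'f='f] by simp
  have z: "z = vec.span (insert v h)" if "z \<in> ?Z" "v \<in> z - h" for z v
  proof (rule vec.subspace_dim_equal[symmetric])
    show "vec.span (insert v h) \<subseteq> z" using that by (intro vec.span_minimal) auto
    show "vec.dim z \<le> vec.dim (vec.span (insert v h))"
      using that h dim_insert_subspace[of h v] by simp
  qed (use that in auto)
  have U: "S - h = (\<Union>z\<in>?Z. z - h)"
  proof (intro equalityI subsetI)
    fix v assume v: "v \<in> S - h"
    have "vec.span (insert v h) \<subseteq> S"
      using v hS by (intro vec.span_minimal S) auto
    then have "vec.span (insert v h) \<in> ?Z"
      using v h dim_insert_subspace[of h v] by (auto intro: vec.span_base)
    then show "v \<in> (\<Union>z\<in>?Z. z - h)" using v by (auto intro: vec.span_base)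
  qed auto
  have "card (S - h) = (\<Sum>z\<in>?Z. card (z - h))"
    unfolding U
  proof (intro card_UN_disjoint ballI impI)
    fix z z' assume zz: "z \<in> ?Z" "z' \<in> ?Z" "z \<noteq> z'"
    show "(z - h) \<inter> (z' - h) = {}"
    proof (rule ccontr)
      assume "(z - h) \<inter> (z' - h) \<noteq> {}"
      then obtain v where "v \<in> z - h" "v \<in> z' - h" by auto
      then show False using z[OF zz(1)] z[OF zz(2)] zz(3) by metis
    qed
  qed simp_all
  also have "\<dots> = (\<Sum>z\<in>?Z. CARD('f) ^ (vec.dim h + 1) - CARD('f) ^ vec.dim h)"
    using h by (intro sum.cong refl) (auto simp: card_Diff_subset card_subspace)
  finally have e: "card (S - h) = card ?Z * (CARD('f) ^ (vec.dim h + 1) - CARD('f) ^ vec.dim h)"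
    by simp
  have d: "vec.dim h \<le> vec.dim S" using hS by (rule vec.dim_subset)
  have "real (card (S - h)) = ?q ^ vec.dim S - ?q ^ vec.dim h"
    using h S hS d by (simp add: card_Diff_subset card_subspace of_nat_diff power_increasing)
  moreover have "real (card (S - h)) = real (card ?Z) * (?q ^ (vec.dim h + 1) - ?q ^ vec.dim h)"
    unfolding e by (simp add: of_nat_diff power_increasing)
  ultimately have "real (card ?Z) * (?q ^ (vec.dim h + 1) - ?q ^ vec.dim h) = ?q ^ vec.dim S - ?q ^ vec.dim h"
    by simp
  moreover have "?q ^ vec.dim S = ?q ^ vec.dim h * ?q ^ (vec.dim S - vec.dim h)"
    using d by (simp flip: power_add)
  ultimately have "?q ^ vec.dim h * (real (card ?Z) * (?q - 1)) = ?q ^ vec.dim h * (?q ^ (vec.dim S - vec.dim h) - 1)"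
    by (simp add: algebra_simps)
  then have "real (card ?Z) * (?q - 1) = ?q ^ (vec.dim S - vec.dim h) - 1"
    using q by simp
  then show ?thesis using q by (simp add: qnum_def field_simps)
qed

lemma span_insert_subset_iff:
  fixes h :: "('f::{field,finite} ^ 'n) set"
  assumes "vec.subspace h"
  shows "vec.span (insert v s) \<subseteq> h \<longleftrightarrow> v \<in> h \<and> s \<subseteq> h"
  using vec.span_minimal[OF _ assms, of "insert v s"] vec.span_superset[of "insert v s"] by blast

lemma sum_indicator_card:
  assumes "finite A"
  shows "(\<Sum>v\<in>A. if P v then 1 else (0::'a::comm_semiring_1)) = of_nat (card {v \<in> A. P v})"
  using assms by (simp add: sum.If_cases Int_def)

text \<open>Double count the pairs \<open>(h, v)\<close> with \<open>v\<close> in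
  \<open>h - s\<close>. The hyperplanes through \<open>v\<close> are those through
  \<open>vec.span (insert v s)\<close>, which has smaller codimension in \<open>y\<close>, so
  induction applies without passing to the dual space.\<close>

lemma card_hyperplanes_containing:
  fixes s y :: "('f::{field,finite} ^ 'n) set"
  assumes s: "vec.subspace s" and y: "vec.subspace y" and sy: "s \<subseteq> y"
  shows "real (card {h. vec.subspace h \<and> s \<subseteq> h \<and> h \<subseteq> y \<and> vec.dim y = vec.dim h + 1})
     = qnum (real CARD('f)) (vec.dim y - vec.dim s)"
  using s sy
proof (induction "vec.dim y - vec.dim s" arbitrary: s)
  case 0
  have "\<not> (vec.dim y = vec.dim h + 1)" if "vec.subspace h" "s \<subseteq> h" "h \<subseteq> y" for h
    using 0 vec.dim_subset[OF that(2)] by auto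
  then show ?case using 0(1) by (auto simp: qnum_def)
next
  case (Suc e)
  let ?q = "real CARD('f)"
  define H where "H s = {h. vec.subspace h \<and> s \<subseteq> h \<and> h \<subseteq> y \<and> vec.dim y = vec.dim h + 1}" for s
  have q: "?q > 1" using card_field_ge2[where 'f='f] by simp
  have "real (card (H s)) = qnum ?q (vec.dim y - vec.dim s)"
  \<comment> \<open>The double count yields the number of hyperplanes only after cancelling
    \<open>q^e - 1\<close>, which vanishes in codimension one.\<close>
  proof (cases "e = 0")
    case True
    have d: "vec.dim y = vec.dim s + 1" using True Suc(2) by simp
    have "H s = {s}"
    proof (intro equalityI subsetI)
      fix h assume "h \<in> H s"
      then have "s = h"
        using Suc.prems d by (intro vec.subspace_dim_equal) (simp_all add: H_def)
      then show "h \<in> {s}" by simp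
    qed (use Suc.prems d in \<open>simp add: H_def\<close>)
    moreover have "vec.dim y - vec.dim s = 1" using d by simp
    ultimately show ?thesis using q by (simp only:) (simp add: qnum_def)
  next
    case False
    have IH: "real (card (H (vec.span (insert v s)))) = qnum ?q e" if "v \<in> y - s" for v
    proof -
      have d: "vec.dim (vec.span (insert v s)) = vec.dim s + 1"
        using that Suc.prems dim_insert_subspace by auto
      have "e = vec.dim y - vec.dim (vec.span (insert v s))" using d Suc(2) by simp
      moreover have "vec.span (insert v s) \<subseteq> y" using that Suc.prems y by (intro vec.span_minimal) auto
      ultimately show ?thesis using Suc(1)[of "vec.span (insert v s)"] by (simp add: H_def)
    qed
    have eq: "H (vec.span (insert v s)) = {h \<in> H s. v \<in> h}" if "v \<in> y - s" for v
      by (rule Set.set_eqI, simp only: mem_Collect_eq H_def) (metis span_insert_subset_iff)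
    have "(\<Sum>h\<in>H s. real (card (h - s))) = (\<Sum>h\<in>H s. \<Sum>v\<in>y - s. if v \<in> h then 1 else 0)"
    proof (intro sum.cong refl)
      fix h assume "h \<in> H s"
      then have "{v \<in> y - s. v \<in> h} = h - s" by (auto simp: H_def)
      then show "real (card (h - s)) = (\<Sum>v\<in>y - s. if v \<in> h then 1 else 0)"
        using sum_indicator_card[of "y - s" "\<lambda>v. v \<in> h", where 'a=real] by (simp only: finite)
    qed
    also have "\<dots> = (\<Sum>v\<in>y - s. \<Sum>h\<in>H s. if v \<in> h then 1 else 0)" by (rule sum.swap)
    also have "\<dots> = (\<Sum>v\<in>y - s. real (card {h \<in> H s. v \<in> h}))"
      by (intro sum.cong refl sum_indicator_card) simp
    also have "\<dots> = (\<Sum>v\<in>y - s. qnum ?q e)"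
    proof (intro sum.cong refl)
      fix v assume "v \<in> y - s"
      then show "real (card {h \<in> H s. v \<in> h}) = qnum ?q e"
        using IH[of v] eq[of v] by simp
    qed
    finally have 1: "(\<Sum>h\<in>H s. real (card (h - s))) = real (card (y - s)) * qnum ?q e" by simp
    have c: "real (card (h - s)) = ?q ^ vec.dim h - ?q ^ vec.dim s" if "vec.subspace h" "s \<subseteq> h" for h
      using that Suc.prems vec.dim_subset[OF that(2)]
      by (simp add: card_Diff_subset card_subspace of_nat_diff power_increasing)
    have dh: "vec.dim h = vec.dim s + e" if "h \<in> H s" for h
      using that Suc(2) by (auto simp: H_def)
    have "(\<Sum>h\<in>H s. real (card (h - s))) = (\<Sum>h\<in>H s. ?q ^ (vec.dim s + e) - ?q ^ vec.dim s)"
    proof (rule sum.cong[OF refl])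
      fix h assume h: "h \<in> H s"
      then have "vec.subspace h" "s \<subseteq> h" by (auto simp: H_def)
      then show "real (card (h - s)) = ?q ^ (vec.dim s + e) - ?q ^ vec.dim s"
        unfolding dh[OF h, symmetric] by (rule c)
    qed
    moreover have "vec.dim y = vec.dim s + Suc e" using Suc(2) by simp
    ultimately have "real (card (H s)) * (?q ^ (vec.dim s + e) - ?q ^ vec.dim s)
        = (?q ^ (vec.dim s + Suc e) - ?q ^ vec.dim s) * qnum ?q e"
      using 1 c[OF y Suc.prems(2)] by simp
    then have "?q ^ vec.dim s * (real (card (H s)) * (?q ^ e - 1))
        = ?q ^ vec.dim s * ((?q ^ Suc e - 1) * qnum ?q e)"
      by (simp add: power_add algebra_simps)
    then have "real (card (H s)) * (?q ^ e - 1) = (?q ^ Suc e - 1) * qnum ?q e"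
      using q by simp
    then have "real (card (H s)) * (?q ^ e - 1) = (?q ^ Suc e - 1) / (?q - 1) * (?q ^ e - 1)"
      by (simp add: qnum_def)
    moreover have "?q ^ e - 1 \<noteq> 0" using one_less_power[OF q, of e] False by simp
    ultimately have "real (card (H s)) = qnum ?q (Suc e)"
      unfolding qnum_def by (metis mult_right_cancel)
    then show ?thesis using Suc(2) by simp
  qed
  then show ?case by (simp only: H_def)
qed

section \<open>Covers and hyperplanes relative to a flag\<close>

definition covers :: "('f::{field,finite} ^ 'n) set \<Rightarrow> ('f ^ 'n) set set" where
  "covers h = {z. vec.subspace z \<and> h \<subseteq> z \<and> vec.dim z = vec.dim h + 1}"

definition hyperplanes :: "('f::{field,finite} ^ 'n) set \<Rightarrow> ('f ^ 'n) set set" where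
  "hyperplanes y = {h. vec.subspace h \<and> h \<subseteq> y \<and> vec.dim y = vec.dim h + 1}"

definition subspace_sum :: "('f::{field,finite} ^ 'n) set \<Rightarrow> ('f ^ 'n) set \<Rightarrow> ('f ^ 'n) set" where
  "subspace_sum S T = {x + y |x y. x \<in> S \<and> y \<in> T}"

lemma subspace_subspace_sum:
  "vec.subspace S \<Longrightarrow> vec.subspace T \<Longrightarrow> vec.subspace (subspace_sum S T)"
  unfolding subspace_sum_def by (rule vec.subspace_sums)

lemma dim_subspace_sum:
  assumes "vec.subspace S" "vec.subspace T"
  shows "vec.dim (subspace_sum S T) + vec.dim (S \<inter> T) = vec.dim S + vec.dim T"
  unfolding subspace_sum_def using assms by (rule vec.dim_sums_Int)

lemma subspace_sum_upper1: "vec.subspace T \<Longrightarrow> S \<subseteq> subspace_sum S T"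
  unfolding subspace_sum_def using vec.subspace_0 by force

lemma subspace_sum_upper2: "vec.subspace S \<Longrightarrow> T \<subseteq> subspace_sum S T"
  unfolding subspace_sum_def using vec.subspace_0 by force

lemma subspace_sum_least:
  "vec.subspace z \<Longrightarrow> S \<subseteq> z \<Longrightarrow> T \<subseteq> z \<Longrightarrow> subspace_sum S T \<subseteq> z"
  unfolding subspace_sum_def by (auto intro: vec.subspace_add)

lemma dim_Int_le_hyperplane:
  fixes h y F :: "('f::{field,finite} ^ 'n) set"
  assumes "vec.subspace h" "vec.subspace y" "vec.subspace F" "h \<subseteq> y" "vec.dim y = vec.dim h + 1"
  shows "vec.dim (y \<inter> F) \<le> vec.dim (h \<inter> F) + 1"
proof -
  have "vec.dim (subspace_sum (y \<inter> F) h) + vec.dim (y \<inter> F \<inter> h) = vec.dim (y \<inter> F) + vec.dim h"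
    using assms by (intro dim_subspace_sum vec.subspace_inter)
  moreover have "vec.dim (subspace_sum (y \<inter> F) h) \<le> vec.dim y"
    using assms by (intro vec.dim_subset subspace_sum_least) auto
  moreover have "y \<inter> F \<inter> h = h \<inter> F" using assms by auto
  ultimately show ?thesis using assms by simp
qed

lemma dim_Int_hyperplane:
  fixes h y F :: "('f::{field,finite} ^ 'n) set"
  assumes "vec.subspace h" "vec.subspace y" "vec.subspace F" "h \<subseteq> y" "vec.dim y = vec.dim h + 1"
  shows "vec.dim (y \<inter> F) = vec.dim (h \<inter> F) + (if y \<inter> F \<subseteq> h then 0 else 1)"
proof (cases "y \<inter> F \<subseteq> h")
  case True
  then have "y \<inter> F = h \<inter> F" using assms by auto
  then show ?thesis using True by simp
next
  case False
  have "h \<inter> F \<noteq> y \<inter> F" using False by auto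
  moreover have "h \<inter> F \<subseteq> y \<inter> F" using assms by auto
  ultimately have "\<not> vec.dim (y \<inter> F) \<le> vec.dim (h \<inter> F)"
    using vec.subspace_dim_equal[of "h \<inter> F" "y \<inter> F"] assms by (auto intro: vec.subspace_inter)
  then show ?thesis using False dim_Int_le_hyperplane[OF assms] by simp
qed

text \<open>A vector of \<open>z\<close> outside \<open>h\<close> that lies in \<open>h + F\<close>
  can be shifted by \<open>h\<close> into \<open>F\<close>. So whether a cover gains a dimension in
  \<open>F\<close> is a containment, and the covers that do are counted inside
  \<open>h + F\<close>.\<close>

lemma cover_Int_subset_iff:
  assumes h: "vec.subspace h" and F: "vec.subspace F" and z: "z \<in> covers h"
  shows "z \<inter> F \<subseteq> h \<longleftrightarrow> \<not> z \<subseteq> subspace_sum h F"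
proof
  assume zF: "z \<inter> F \<subseteq> h"
  show "\<not> z \<subseteq> subspace_sum h F"
  proof
    assume "z \<subseteq> subspace_sum h F"
    moreover have "\<not> z \<subseteq> h" using z vec.dim_subset[of z h] by (auto simp: covers_def)
    ultimately obtain v where v: "v \<in> z" "v \<notin> h" "v \<in> subspace_sum h F" by blast
    then obtain a f where af: "v = a + f" "a \<in> h" "f \<in> F" by (auto simp: subspace_sum_def)
    have "v - a \<in> z" using v af z by (intro vec.subspace_diff) (auto simp: covers_def)
    then have "f \<in> h" using af zF by auto
    then show False using v af h vec.subspace_add by blast
  qed
next
  assume n: "\<not> z \<subseteq> subspace_sum h F"
  show "z \<inter> F \<subseteq> h"
  proof (rule ccontr)
    assume "\<not> z \<inter> F \<subseteq> h"
    then obtain v where v: "v \<in> z" "v \<in> F" "v \<notin> h" by auto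
    have "vec.span (insert v h) = z"
      using v z h dim_insert_subspace[of h v]
      by (intro vec.subspace_dim_equal) (auto simp: covers_def span_insert_subset_iff)
    moreover have "vec.span (insert v h) \<subseteq> subspace_sum h F"
      using v h F subspace_sum_upper1[of F h] subspace_sum_upper2[of h F]
      by (auto simp: span_insert_subset_iff subspace_subspace_sum)
    ultimately show False using n by simp
  qed
qed

text \<open>The value is \<open>c\<close>, plus the increment \<open>b - c\<close> on
  \<open>Z2\<close>, plus the increment \<open>a - b\<close> on \<open>Z1\<close>.\<close>

lemma sum_nested:
  fixes a b c :: complex
  assumes "finite Z" "Z1 \<subseteq> Z2" "Z2 \<subseteq> Z"
  shows "(\<Sum>z\<in>Z. if z \<in> Z1 then a else if z \<in> Z2 then b else c)
    = of_nat (card Z1) * a + (of_nat (card Z2) - of_nat (card Z1)) * b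
      + (of_nat (card Z) - of_nat (card Z2)) * c"
proof -
  have fin: "finite Z1" "finite Z2" using assms by (auto intro: finite_subset)
  have "(\<Sum>z\<in>Z. if z \<in> Z1 then a else if z \<in> Z2 then b else c)
      = (\<Sum>z\<in>Z. of_bool (z \<in> Z1) * (a - b) + of_bool (z \<in> Z2) * (b - c) + c)"
    using assms by (intro sum.cong) auto
  also have "\<dots> = of_nat (card Z1) * (a - b) + of_nat (card Z2) * (b - c) + of_nat (card Z) * c"
    using assms fin by (simp add: sum.distrib flip: sum_distrib_right) (simp add: Int_absorb1)
  finally show ?thesis by (simp add: algebra_simps)
qed

abbreviation fqnum :: "'f::finite itself \<Rightarrow> nat \<Rightarrow> complex" where
  "fqnum _ n \<equiv> complex_of_real (qnum (real CARD('f)) n)"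

lemma of_nat_eq_of_real: "real n = r \<Longrightarrow> of_nat n = complex_of_real r"
  by auto

lemma card_covers_in_sum:
  fixes h F :: "('f::{field,finite} ^ 'n) set"
  assumes "vec.subspace h" "vec.subspace F"
  shows "of_nat (card {z \<in> covers h. z \<subseteq> subspace_sum h F})
    = fqnum TYPE('f) (vec.dim F - vec.dim (h \<inter> F))"
proof -
  have "{z \<in> covers h. z \<subseteq> subspace_sum h F}
      = {z. vec.subspace z \<and> h \<subseteq> z \<and> z \<subseteq> subspace_sum h F \<and> vec.dim z = vec.dim h + 1}"
    by (auto simp: covers_def)
  moreover have "vec.dim (subspace_sum h F) - vec.dim h = vec.dim F - vec.dim (h \<inter> F)"
    using dim_subspace_sum[OF assms] by simp
  ultimately have "real (card {z \<in> covers h. z \<subseteq> subspace_sum h F})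
      = qnum (real CARD('f)) (vec.dim F - vec.dim (h \<inter> F))"
    using card_covers_subspace[OF assms(1) subspace_subspace_sum[OF assms] subspace_sum_upper1[OF assms(2)]]
    by simp
  then show ?thesis by (rule of_nat_eq_of_real)
qed

lemma card_covers:
  fixes h :: "('f::{field,finite} ^ 'n) set"
  assumes "vec.subspace h"
  shows "of_nat (card (covers h)) = fqnum TYPE('f) (CARD('n) - vec.dim h)"
proof -
  have "covers h = {z. vec.subspace z \<and> h \<subseteq> z \<and> z \<subseteq> UNIV \<and> vec.dim z = vec.dim h + 1}"
    by (auto simp: covers_def)
  then have "real (card (covers h)) = qnum (real CARD('f)) (CARD('n) - vec.dim h)"
    using card_covers_subspace[OF assms vec.subspace_UNIV] unfolding vec_dim_card by simp
  then show ?thesis by (rule of_nat_eq_of_real)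
qed

lemma card_hyperplanes_above:
  fixes s y :: "('f::{field,finite} ^ 'n) set"
  assumes "vec.subspace s" "vec.subspace y" "s \<subseteq> y"
  shows "of_nat (card {h \<in> hyperplanes y. s \<subseteq> h}) = fqnum TYPE('f) (vec.dim y - vec.dim s)"
proof -
  have "{h \<in> hyperplanes y. s \<subseteq> h}
      = {h. vec.subspace h \<and> s \<subseteq> h \<and> h \<subseteq> y \<and> vec.dim y = vec.dim h + 1}"
    by (auto simp: hyperplanes_def)
  then have "real (card {h \<in> hyperplanes y. s \<subseteq> h}) = qnum (real CARD('f)) (vec.dim y - vec.dim s)"
    using card_hyperplanes_containing[OF assms] by simp
  then show ?thesis by (rule of_nat_eq_of_real)
qed

lemma card_hyperplanes:
  fixes y :: "('f::{field,finite} ^ 'n) set"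
  assumes "vec.subspace y"
  shows "of_nat (card (hyperplanes y)) = fqnum TYPE('f) (vec.dim y)"
proof -
  have "{h \<in> hyperplanes y. {0} \<subseteq> h} = hyperplanes y"
    by (auto simp: hyperplanes_def vec.subspace_0)
  then show ?thesis
    using card_hyperplanes_above[of "{0}" y] assms vec.subspace_0[of y]
    by (simp add: vec.subspace_single_0)
qed

text \<open>The covers in \<open>h + F1\<close> lie among those in \<open>h + F2\<close>; membership
  in these nested families decides which of the two intersections grow, so only three values of
  \<open>\<phi>\<close> occur.\<close>

lemma sum_covers_flag:
  fixes h F1 F2 :: "('f::{field,finite} ^ 'n) set" and \<phi> :: "nat \<Rightarrow> nat \<Rightarrow> complex"
  assumes h: "vec.subspace h" and F: "vec.subspace F1" "vec.subspace F2" "F1 \<subseteq> F2"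
    and ab: "vec.dim (h \<inter> F1) = a" "vec.dim (h \<inter> F2) = b"
  shows "(\<Sum>z\<in>covers h. \<phi> (vec.dim (z \<inter> F1)) (vec.dim (z \<inter> F2)))
    = fqnum TYPE('f) (vec.dim F1 - a) * \<phi> (a + 1) (b + 1)
      + (fqnum TYPE('f) (vec.dim F2 - b) - fqnum TYPE('f) (vec.dim F1 - a)) * \<phi> a (b + 1)
      + (fqnum TYPE('f) (CARD('n) - vec.dim h) - fqnum TYPE('f) (vec.dim F2 - b)) * \<phi> a b"
proof -
  let ?Z = "\<lambda>F. {z \<in> covers h. z \<subseteq> subspace_sum h F}"
  have d: "vec.dim (z \<inter> F) = vec.dim (h \<inter> F) + (if z \<in> ?Z F then 1 else 0)"
    if "z \<in> covers h" "vec.subspace F" for z F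
    using dim_Int_hyperplane[OF h _ that(2), of z] cover_Int_subset_iff[OF h that(2,1)] that
    by (auto simp: covers_def)
  have "subspace_sum h F1 \<subseteq> subspace_sum h F2" using F unfolding subspace_sum_def by blast
  then have sub: "?Z F1 \<subseteq> ?Z F2" by auto
  have "(\<Sum>z\<in>covers h. \<phi> (vec.dim (z \<inter> F1)) (vec.dim (z \<inter> F2)))
     = (\<Sum>z\<in>covers h. if z \<in> ?Z F1 then \<phi> (a + 1) (b + 1) else if z \<in> ?Z F2 then \<phi> a (b + 1) else \<phi> a b)"
    using sub ab d[OF _ F(1)] d[OF _ F(2)] by (intro sum.cong refl) auto
  also have "\<dots> = of_nat (card (?Z F1)) * \<phi> (a + 1) (b + 1)
      + (of_nat (card (?Z F2)) - of_nat (card (?Z F1))) * \<phi> a (b + 1)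
      + (of_nat (card (covers h)) - of_nat (card (?Z F2))) * \<phi> a b"
    using sub by (intro sum_nested) auto
  finally show ?thesis
    unfolding card_covers_in_sum[OF h F(1)] card_covers_in_sum[OF h F(2)] card_covers[OF h] ab .
qed

text \<open>On the way down, \<open>y \<inter> F\<close> loses a dimension exactly when the
  hyperplane does not contain it. The truncated \<open>a - 1\<close> and \<open>b - 1\<close> are
  harmless: for \<open>a = 0\<close> the last coefficient vanishes, and \<open>b = 0\<close> forces
  \<open>a = 0\<close>, so that the middle one vanishes too.\<close>

lemma sum_hyperplanes_flag:
  fixes y F1 F2 :: "('f::{field,finite} ^ 'n) set" and \<phi> :: "nat \<Rightarrow> nat \<Rightarrow> complex"
  assumes y: "vec.subspace y" and F: "vec.subspace F1" "vec.subspace F2" "F1 \<subseteq> F2"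
    and ab: "vec.dim (y \<inter> F1) = a" "vec.dim (y \<inter> F2) = b"
  shows "(\<Sum>h\<in>hyperplanes y. \<phi> (vec.dim (h \<inter> F1)) (vec.dim (h \<inter> F2)))
    = fqnum TYPE('f) (vec.dim y - b) * \<phi> a b
      + (fqnum TYPE('f) (vec.dim y - a) - fqnum TYPE('f) (vec.dim y - b)) * \<phi> a (b - 1)
      + (fqnum TYPE('f) (vec.dim y) - fqnum TYPE('f) (vec.dim y - a)) * \<phi> (a - 1) (b - 1)"
proof -
  let ?Z = "\<lambda>F. {h \<in> hyperplanes y. y \<inter> F \<subseteq> h}"
  have d: "vec.dim (h \<inter> F) = vec.dim (y \<inter> F) - (if h \<in> ?Z F then 0 else 1)"
    if "h \<in> hyperplanes y" "vec.subspace F" for h F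
    using dim_Int_hyperplane[OF _ y that(2), of h] that by (auto simp: hyperplanes_def)
  have sub: "?Z F2 \<subseteq> ?Z F1" using F by auto
  have "(\<Sum>h\<in>hyperplanes y. \<phi> (vec.dim (h \<inter> F1)) (vec.dim (h \<inter> F2)))
     = (\<Sum>h\<in>hyperplanes y. if h \<in> ?Z F2 then \<phi> a b else if h \<in> ?Z F1 then \<phi> a (b - 1) else \<phi> (a - 1) (b - 1))"
    using sub ab d[OF _ F(1)] d[OF _ F(2)] by (intro sum.cong refl) auto
  also have "\<dots> = of_nat (card (?Z F2)) * \<phi> a b
      + (of_nat (card (?Z F1)) - of_nat (card (?Z F2))) * \<phi> a (b - 1)
      + (of_nat (card (hyperplanes y)) - of_nat (card (?Z F1))) * \<phi> (a - 1) (b - 1)"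
    using sub by (intro sum_nested) auto
  also have "of_nat (card (?Z F1)) = fqnum TYPE('f) (vec.dim y - a)"
    using card_hyperplanes_above[of "y \<inter> F1" y] ab y F by (simp add: vec.subspace_inter)
  also have "of_nat (card (?Z F2)) = fqnum TYPE('f) (vec.dim y - b)"
    using card_hyperplanes_above[of "y \<inter> F2" y] ab y F by (simp add: vec.subspace_inter)
  finally show ?thesis unfolding card_hyperplanes[OF y] .
qed

section \<open>Neighbours through common hyperplanes, and the distance\<close>

lemma grass_adj_sym: "grass_adj D y z \<longleftrightarrow> grass_adj D z y"
  by (auto simp: grass_adj_def Int_commute)

text \<open>A common hyperplane has dimension \<open>D - 1\<close> and lies in
  \<open>y \<inter> z\<close>, whose dimension is below \<open>D\<close>; so it is that
  intersection.\<close>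

lemma common_hyperplanes:
  assumes "1 \<le> D" "y \<in> grass_verts D" "z \<in> grass_verts D" "y \<noteq> z"
  shows "{h \<in> hyperplanes y. z \<in> covers h} = (if grass_adj D y z then {y \<inter> z} else {})"
proof -
  have lt: "vec.dim (y \<inter> z) < D"
  proof (rule ccontr)
    assume "\<not> vec.dim (y \<inter> z) < D"
    then have "y \<inter> z = y" "y \<inter> z = z"
      using assms vec.subspace_dim_equal[of "y \<inter> z" y] vec.subspace_dim_equal[of "y \<inter> z" z]
      by (auto simp: grass_verts_def vec.subspace_inter)
    then show False using assms by auto
  qed
  have h: "h = y \<inter> z \<and> vec.dim (y \<inter> z) = D - 1" if "h \<in> hyperplanes y" "z \<in> covers h" for h
  proof -
    have sub: "h \<subseteq> y \<inter> z" and d: "vec.dim h + 1 = D" and s: "vec.subspace h"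
      using that assms by (auto simp: hyperplanes_def covers_def grass_verts_def)
    have "h = y \<inter> z"
      using sub d s lt assms
      by (intro vec.subspace_dim_equal) (auto simp: grass_verts_def vec.subspace_inter)
    then show ?thesis using d by auto
  qed
  show ?thesis
    using h assms by (auto simp: grass_adj_def hyperplanes_def covers_def grass_verts_def vec.subspace_inter)
qed

text \<open>A walk of length two through a common hyperplane either returns to \<open>y\<close> or leads to a
  neighbour of \<open>y\<close>.\<close>

lemma sum_neighbours:
  fixes y :: "('f::{field,finite} ^ 'n) set" and f :: "('f ^ 'n) set \<Rightarrow> complex"
  assumes D: "1 \<le> D" and y: "y \<in> grass_verts D"
  shows "(\<Sum>z | grass_adj D y z. f z)
    = (\<Sum>h\<in>hyperplanes y. \<Sum>z\<in>covers h. f z) - fqnum TYPE('f) D * f y"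
proof -
  have c: "covers h = {z \<in> grass_verts D. z \<in> covers h}" if "h \<in> hyperplanes y" for h
    using that y by (auto simp: covers_def hyperplanes_def grass_verts_def)
  have "(\<Sum>h\<in>hyperplanes y. \<Sum>z\<in>covers h. f z)
      = (\<Sum>h\<in>hyperplanes y. \<Sum>z | z \<in> grass_verts D \<and> z \<in> covers h. f z)"
    using c by (intro sum.cong) auto
  also have "\<dots> = (\<Sum>z\<in>grass_verts D. \<Sum>h | h \<in> hyperplanes y \<and> z \<in> covers h. f z)"
    by (rule sum.swap_restrict) auto
  also have "\<dots> = (\<Sum>z\<in>grass_verts D. of_nat (card {h \<in> hyperplanes y. z \<in> covers h}) * f z)"
    by simp
  also have "\<dots> = of_nat (card {h \<in> hyperplanes y. y \<in> covers h}) * f y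
      + (\<Sum>z\<in>grass_verts D - {y}. of_nat (card {h \<in> hyperplanes y. z \<in> covers h}) * f z)"
    using y by (simp add: sum.remove)
  also have "{h \<in> hyperplanes y. y \<in> covers h} = hyperplanes y"
    using y by (auto simp: hyperplanes_def covers_def grass_verts_def)
  also have "(\<Sum>z\<in>grass_verts D - {y}. of_nat (card {h \<in> hyperplanes y. z \<in> covers h}) * f z)
      = (\<Sum>z\<in>grass_verts D - {y}. if grass_adj D y z then f z else 0)"
  proof (rule sum.cong[OF refl])
    fix z assume "z \<in> grass_verts D - {y}"
    then show "of_nat (card {h \<in> hyperplanes y. z \<in> covers h}) * f z = (if grass_adj D y z then f z else 0)"
      by (subst common_hyperplanes[OF D y]) auto
  qed
  also have "\<dots> = (\<Sum>z | grass_adj D y z. f z)"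
    using D by (intro sum.mono_neutral_cong_right) (auto simp: grass_adj_def grass_verts_def)
  finally show ?thesis
    using card_hyperplanes[of y] y by (simp add: grass_verts_def)
qed

text \<open>Along an edge from \<open>w\<close> to \<open>z\<close>, the hyperplane
  \<open>w \<inter> z\<close> of \<open>w\<close> loses at most one dimension of the intersection
  with \<open>y\<close>.\<close>

lemma grass_walk_dim_Int:
  assumes "1 \<le> D" "y \<in> grass_verts D"
  shows "(y, z) \<in> {(v, w). grass_adj D v w} ^^ n \<Longrightarrow> D \<le> vec.dim (y \<inter> z) + n"
proof (induction n arbitrary: z)
  case 0
  then show ?case using assms by (auto simp: grass_verts_def)
next
  case (Suc n)
  then obtain w where w: "(y, w) \<in> {(v, w). grass_adj D v w} ^^ n" "grass_adj D w z" by auto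
  have "vec.dim (w \<inter> y) \<le> vec.dim (w \<inter> z \<inter> y) + 1"
    using w assms by (intro dim_Int_le_hyperplane)
      (auto simp: grass_adj_def grass_verts_def vec.subspace_inter)
  also have "vec.dim (w \<inter> z \<inter> y) \<le> vec.dim (y \<inter> z)" by (intro vec.dim_subset) auto
  finally show ?case using Suc.IH[OF w(1)] by (simp add: Int_commute)
qed

lemma qnum_pos: "1 < q \<Longrightarrow> 0 < n \<Longrightarrow> 0 < qnum q n"
  by (simp add: qnum_def)

lemma hyperplane_above_exists:
  fixes s y :: "('f::{field,finite} ^ 'n) set"
  assumes "vec.subspace s" "vec.subspace y" "s \<subseteq> y" "vec.dim s < vec.dim y"
  obtains h where "h \<in> hyperplanes y" "s \<subseteq> h"
proof -
  have q: "real CARD('f) > 1" using card_field_ge2[where 'f='f] by simp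
  have "qnum (real CARD('f)) (vec.dim y - vec.dim s) \<noteq> 0"
    using qnum_pos[OF q, of "vec.dim y - vec.dim s"] assms by simp
  then have "{h \<in> hyperplanes y. s \<subseteq> h} \<noteq> {}"
    using card_hyperplanes_above[OF assms(1-3)] by (auto simp del: Collect_empty_eq)
  then show ?thesis using that by auto
qed

text \<open>Exchange step: keep a hyperplane of \<open>y\<close> that contains
  \<open>y \<inter> z\<close> and adjoin a vector of \<open>z\<close> outside \<open>y\<close>. The
  result is a neighbour of \<open>y\<close> that meets \<open>z\<close> in a larger space.\<close>

lemma grass_walk_exists:
  fixes y z :: "('f::{field,finite} ^ 'n) set"
  assumes D: "1 \<le> D" and "y \<in> grass_verts D" and z: "z \<in> grass_verts D"
  shows "\<exists>n \<le> D - vec.dim (y \<inter> z). (y, z) \<in> {(v, w). grass_adj D v w} ^^ n"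
  using assms(2)
proof (induction "D - vec.dim (y \<inter> z)" arbitrary: y rule: less_induct)
  case less
  have sy: "vec.subspace y" "vec.dim y = D" "vec.subspace z" "vec.dim z = D"
    using less.prems z by (auto simp: grass_verts_def)
  have si: "vec.subspace (y \<inter> z)" using sy by (intro vec.subspace_inter)
  show ?case
  proof (cases "y = z")
    case True
    then show ?thesis by (intro exI[of _ 0]) auto
  next
    case False
    have "\<not> z \<subseteq> y" using vec.subspace_dim_equal[of z y] False sy by auto
    then obtain v where v: "v \<in> z" "v \<notin> y" by auto
    have "vec.dim (y \<inter> z) < D"
    proof (rule ccontr)
      assume "\<not> vec.dim (y \<inter> z) < D"
      then have "y \<inter> z = z" using sy si by (intro vec.subspace_dim_equal) auto
      then show False using v by auto
    qed
    then obtain h where h: "h \<in> hyperplanes y" "y \<inter> z \<subseteq> h"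
      using hyperplane_above_exists[OF si sy(1)] sy by auto
    define w where "w = vec.span (insert v h)"
    have hh: "vec.subspace h" "h \<subseteq> y" "vec.dim h + 1 = D" using h sy by (auto simp: hyperplanes_def)
    have wd: "w \<in> grass_verts D"
      using dim_insert_subspace[of h v] hh v by (auto simp: w_def grass_verts_def)
    have hw: "h \<subseteq> w" "v \<in> w" by (auto simp: w_def intro: vec.span_base)
    have "w \<in> covers h" using wd hw hh by (auto simp: covers_def grass_verts_def)
    moreover have "y \<noteq> w" using hw v by auto
    ultimately have adj: "grass_adj D y w"
      using common_hyperplanes[OF D less.prems wd] h by (auto split: if_splits)
    have "y \<inter> z \<subset> w \<inter> z" using v hw h by auto
    then have "vec.dim (y \<inter> z) < vec.dim (w \<inter> z)"
      using si sy wd vec.subspace_dim_equal[of "y \<inter> z" "w \<inter> z"]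
      by (force simp: grass_verts_def vec.subspace_inter)
    moreover have "vec.dim (w \<inter> z) \<le> D" using vec.dim_subset[of "w \<inter> z" z] sy by auto
    ultimately have lt: "D - vec.dim (w \<inter> z) < D - vec.dim (y \<inter> z)" by simp
    from less.hyps[OF lt wd] obtain n
      where n: "n \<le> D - vec.dim (w \<inter> z)" "(w, z) \<in> {(v, w). grass_adj D v w} ^^ n" by blast
    have "(y, z) \<in> {(v, w). grass_adj D v w} ^^ Suc n"
      using adj n(2) by (intro relpow_Suc_I2) auto
    then show ?thesis using n lt by (intro exI[of _ "Suc n"]) auto
  qed
qed

lemma grass_dist_eq:
  assumes "1 \<le> D" "y \<in> grass_verts D" "z \<in> grass_verts D"
  shows "grass_dist D y z = D - vec.dim (y \<inter> z)"
  unfolding grass_dist_def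
proof (rule Least_equality)
  obtain n where n: "n \<le> D - vec.dim (y \<inter> z)" "(y, z) \<in> {(v, w). grass_adj D v w} ^^ n"
    using grass_walk_exists[OF assms] by blast
  moreover have "n = D - vec.dim (y \<inter> z)" using grass_walk_dim_Int[OF assms(1,2) n(2)] n(1) by simp
  ultimately show "(y, z) \<in> {(v, w). grass_adj D v w} ^^ (D - vec.dim (y \<inter> z))" by simp
qed (use grass_walk_dim_Int[OF assms(1,2)] in fastforce)

section \<open>Delsarte cliques\<close>

lemma qnum_le_iff: "1 < q \<Longrightarrow> qnum q m \<le> qnum q n \<longleftrightarrow> m \<le> n"
  by (simp add: qnum_def divide_le_cancel)

lemma real_eq_of_nat: "of_nat n = complex_of_real r \<Longrightarrow> real n = r"
  by (metis of_real_eq_iff of_real_of_nat_eq)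

lemma dim_Int_less:
  assumes "vec.subspace y" "vec.subspace z" "\<not> y \<subseteq> z"
  shows "vec.dim (y \<inter> z) < vec.dim y"
proof (rule ccontr)
  assume "\<not> vec.dim (y \<inter> z) < vec.dim y"
  then have "y \<inter> z = y"
    using assms by (intro vec.subspace_dim_equal) (auto simp: vec.subspace_inter)
  then show False using assms by auto
qed

lemma covers_subset_grass_verts:
  "vec.subspace w \<Longrightarrow> vec.dim w + 1 = D \<Longrightarrow> covers w \<subseteq> grass_verts D"
  by (auto simp: covers_def grass_verts_def)

text \<open>Everything hinges on whether all members contain the intersection \<open>h\<close> of
  two of them. If not, every member lies in the sum of these two, which has \<open>[D + 1]\<close>
  hyperplanes; the size \<open>[N - D + 1]\<close> then forces \<open>N = 2 D\<close>. In either
  case the clique lies in a family of its own size.\<close>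

lemma delsarte_clique_cases:
  fixes C :: "('f::{field,finite} ^ 'n) set set"
  assumes D: "1 \<le> D" "2 * D \<le> CARD('n)" and C: "delsarte_clique D C"
  obtains (point) w where "vec.subspace w" "vec.dim w + 1 = D" "C = covers w"
  | (plane) w where "CARD('n) = 2 * D" "vec.subspace w" "vec.dim w = D + 1" "C = hyperplanes w"
proof -
  let ?q = "real CARD('f)" and ?N = "CARD('n)"
  have q: "?q > 1" using card_field_ge2[where 'f='f] by simp
  have cC: "real (card C) = qnum ?q (?N - D + 1)" and CX: "C \<subseteq> grass_verts D"
    and adj: "\<And>y z. y \<in> C \<Longrightarrow> z \<in> C \<Longrightarrow> y \<noteq> z \<Longrightarrow> grass_adj D y z"
    using C by (auto simp: delsarte_clique_def)
  have sub: "vec.subspace y" "vec.dim y = D" if "y \<in> C" for y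
    using CX that by (auto simp: grass_verts_def)
  have dim2: "vec.dim (y \<inter> z) = D - 1" if "y \<in> C" "z \<in> C" "y \<noteq> z" for y z
    using adj[OF that] by (simp add: grass_adj_def)
  have "qnum ?q (?N - D + 1) > qnum ?q 1"
    using qnum_le_iff[OF q, of "?N - D + 1" 1] D by (simp flip: not_le)
  moreover have "qnum ?q 1 = 1" using q by (simp add: qnum_def)
  ultimately have "card C \<ge> 2" using cC by linarith
  then obtain y1 y2 where y: "y1 \<in> C" "y2 \<in> C" "y1 \<noteq> y2"
    using card_le_Suc0_iff_eq[of C] by auto
  define h where "h = y1 \<inter> y2"
  have h: "vec.subspace h" "vec.dim h + 1 = D"
    using y sub dim2[OF y] D by (auto simp: h_def vec.subspace_inter)
  show thesis
  proof (cases "\<forall>z\<in>C. h \<subseteq> z")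
    case True
    have "C \<subseteq> covers h" using True sub h by (auto simp: covers_def)
    moreover have "real (card (covers h)) = real (card C)"
    proof -
      have "CARD('n) - vec.dim h = CARD('n) - D + 1" using h(2) D by simp
      then show ?thesis using card_covers[OF h(1)] unfolding cC by (intro real_eq_of_nat) simp
    qed
    ultimately have "C = covers h" by (intro card_subset_eq) auto
    then show ?thesis using point h by blast
  next
    case False
    then obtain y3 where y3: "y3 \<in> C" "\<not> h \<subseteq> y3" by auto
    define s where "s = subspace_sum y1 y2"
    have s: "vec.subspace s" "vec.dim s = D + 1"
      using dim_subspace_sum[of y1 y2] y sub dim2[OF y] D
      by (auto simp: s_def subspace_subspace_sum)
    have ys: "y1 \<subseteq> s" "y2 \<subseteq> s"
      using y sub by (auto simp: s_def subspace_sum_upper1[THEN subsetD] subspace_sum_upper2[THEN subsetD])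
    \<comment> \<open>If \<open>z\<close> leaves \<open>s\<close>, then \<open>z \<inter> s\<close>
      has dimension at most \<open>D - 1\<close>, so the \<open>(D - 1)\<close>-dimensional spaces
      \<open>z \<inter> u\<close> and \<open>z \<inter> v\<close> both fill it and coincide.\<close>
    have in_s: "z \<subseteq> s" if z: "z \<in> C" "u \<in> C" "v \<in> C" "u \<subseteq> s" "v \<subseteq> s" "z \<noteq> u" "z \<noteq> v" "z \<inter> u \<noteq> z \<inter> v"
      for z u v
    proof (rule ccontr)
      assume "\<not> z \<subseteq> s"
      then have lt: "vec.dim (z \<inter> s) < D" using dim_Int_less[of z s] sub z s by auto
      have "z \<inter> u = z \<inter> s"
        using z sub s lt dim2[OF z(1,2,6)]
        by (intro vec.subspace_dim_equal) (auto simp: vec.subspace_inter)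
      moreover have "z \<inter> v = z \<inter> s"
        using z sub s lt dim2[OF z(1,3,7)]
        by (intro vec.subspace_dim_equal) (auto simp: vec.subspace_inter)
      ultimately show False using z by auto
    qed
    have A: "z \<subseteq> s" if z: "z \<in> C" "\<not> h \<subseteq> z" for z
    proof (rule in_s[OF z(1) y(1,2) ys])
      show ne: "z \<noteq> y1" "z \<noteq> y2" using z by (auto simp: h_def)
      show "z \<inter> y1 \<noteq> z \<inter> y2"
      proof
        assume e: "z \<inter> y1 = z \<inter> y2"
        have "z \<inter> y1 = h"
          using e z y sub h dim2[OF z(1) y(1) ne(1)]
          by (intro vec.subspace_dim_equal) (auto simp: h_def vec.subspace_inter)
        then show False using z by auto
      qed
    qed
    \<comment> \<open>The pair \<open>y1\<close>, \<open>y2\<close> cannot serve here, since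
      \<open>z\<close> and both of them contain \<open>h\<close>. The pair \<open>y1\<close>,
      \<open>y3\<close> does, because \<open>y3\<close> does not contain \<open>h\<close>.\<close>
    have B: "z \<subseteq> s" if z: "z \<in> C" "h \<subseteq> z" for z
    proof (cases "z = y1")
      case False
      show ?thesis
      proof (rule in_s[OF z(1) y(1) y3(1) ys(1) A[OF y3] False])
        show "z \<noteq> y3" using z y3 by auto
        show "z \<inter> y1 \<noteq> z \<inter> y3" using z y3 by (auto simp: h_def)
      qed
    qed (use ys in auto)
    have "z \<subseteq> s" if "z \<in> C" for z using A[OF that] B[OF that] by blast
    then have CH: "C \<subseteq> hyperplanes s" using sub s by (simp add: hyperplanes_def subset_iff)
    have cH: "real (card (hyperplanes s)) = qnum ?q (D + 1)"
      using card_hyperplanes[OF s(1)] s(2) by (intro real_eq_of_nat) simp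
    have "real (card C) \<le> real (card (hyperplanes s))" using CH by (simp add: card_mono)
    then have "?N - D + 1 \<le> D + 1" unfolding cC cH qnum_le_iff[OF q] .
    then have N: "?N = 2 * D" using D by simp
    have "card (hyperplanes s) = card C" using cC cH N by simp
    then have "C = hyperplanes s" using CH by (intro card_subset_eq) auto
    then show ?thesis using plane N s by blast
  qed
qed

section \<open>Distance from a vertex to a clique\<close>

definition clique_index :: "nat \<Rightarrow> ('f::{field,finite} ^ 'n) set set \<Rightarrow> ('f ^ 'n) set \<Rightarrow> nat" where
  "clique_index D C y = Min (grass_dist D y ` C)"

lemma Min_image_eqI:
  assumes "finite C" "z \<in> C" "f z = m" "\<And>z. z \<in> C \<Longrightarrow> m \<le> f z"
  shows "Min (f ` C) = (m::nat)"
  using assms by (intro Min_eqI) auto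

lemma point_clique_dist:
  fixes w y z :: "('f::{field,finite} ^ 'n) set"
  assumes w: "vec.subspace w" "vec.dim w + 1 = D" and y: "y \<in> grass_verts D" and z: "z \<in> covers w"
  shows "grass_dist D y z = D - vec.dim (y \<inter> w) - (if z \<subseteq> subspace_sum w y then 1 else 0)"
proof -
  have "z \<in> grass_verts D" using covers_subset_grass_verts[OF w] z by auto
  moreover have "vec.dim (z \<inter> y) = vec.dim (w \<inter> y) + (if z \<subseteq> subspace_sum w y then 1 else 0)"
    using dim_Int_hyperplane[OF w(1) _ _ , of z y] cover_Int_subset_iff[OF w(1) _ z, of y] z y
    by (auto simp: covers_def grass_verts_def)
  ultimately show ?thesis using grass_dist_eq[of D y z] y w by (auto simp: Int_commute)
qed

text \<open>Covers of \<open>w\<close> inside \<open>w + y\<close> exist because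
  \<open>[D - dim (y \<inter> w)]\<close> is positive, and they are nearest to \<open>y\<close>. In
  terms of the index \<open>i\<close> their number is \<open>[i + 1]\<close>, the weight needed
  later for averaging over the clique.\<close>

lemma point_clique_index:
  fixes w y :: "('f::{field,finite} ^ 'n) set"
  assumes w: "vec.subspace w" "vec.dim w + 1 = D" and y: "y \<in> grass_verts D"
  shows "clique_index D (covers w) y = D - 1 - vec.dim (y \<inter> w)"
    and "{z \<in> covers w. grass_dist D y z = clique_index D (covers w) y} = {z \<in> covers w. z \<subseteq> subspace_sum w y}"
    and "of_nat (card {z \<in> covers w. grass_dist D y z = clique_index D (covers w) y})
      = fqnum TYPE('f) (clique_index D (covers w) y + 1)"
proof -
  have q: "real CARD('f) > 1" using card_field_ge2[where 'f='f] by simp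
  have sy: "vec.subspace y" "vec.dim y = D" using y by (auto simp: grass_verts_def)
  have le: "vec.dim (y \<inter> w) + 1 \<le> D" using vec.dim_subset[of "y \<inter> w" w] w by auto
  have c: "of_nat (card {z \<in> covers w. z \<subseteq> subspace_sum w y}) = fqnum TYPE('f) (D - vec.dim (y \<inter> w))"
    using card_covers_in_sum[OF w(1) sy(1)] sy by (simp add: Int_commute)
  have "qnum (real CARD('f)) (D - vec.dim (y \<inter> w)) > 0" using le by (intro qnum_pos[OF q]) simp
  then have "{z \<in> covers w. z \<subseteq> subspace_sum w y} \<noteq> {}"
    using c by (auto simp del: Collect_empty_eq)
  then obtain z where z: "z \<in> covers w" "z \<subseteq> subspace_sum w y" by auto
  show i: "clique_index D (covers w) y = D - 1 - vec.dim (y \<inter> w)"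
    unfolding clique_index_def
  proof (rule Min_image_eqI[OF _ z(1)])
    show "grass_dist D y z = D - 1 - vec.dim (y \<inter> w)"
      unfolding point_clique_dist[OF w y z(1)] using z by simp
    show "D - 1 - vec.dim (y \<inter> w) \<le> grass_dist D y z'" if "z' \<in> covers w" for z'
      unfolding point_clique_dist[OF w y that] by (simp add: diff_le_mono2)
  qed simp
  show e: "{z \<in> covers w. grass_dist D y z = clique_index D (covers w) y} = {z \<in> covers w. z \<subseteq> subspace_sum w y}"
  proof (rule Collect_cong, rule conj_cong[OF refl])
    fix z assume "z \<in> covers w"
    from point_clique_dist[OF w y this]
    show "grass_dist D y z = clique_index D (covers w) y \<longleftrightarrow> z \<subseteq> subspace_sum w y"
      unfolding i using le by (auto split: if_splits)
  qed
  have "clique_index D (covers w) y + 1 = D - vec.dim (y \<inter> w)" unfolding i using le by simp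
  then show "of_nat (card {z \<in> covers w. grass_dist D y z = clique_index D (covers w) y})
      = fqnum TYPE('f) (clique_index D (covers w) y + 1)"
    unfolding e c by simp
qed

lemma plane_clique_dist:
  fixes w y z :: "('f::{field,finite} ^ 'n) set"
  assumes D: "1 \<le> D" and w: "vec.subspace w" "vec.dim w = D + 1" and y: "y \<in> grass_verts D"
    and z: "z \<in> hyperplanes w"
  shows "grass_dist D y z + vec.dim (y \<inter> w) = D + (if y \<inter> w \<subseteq> z then 0 else 1)"
proof -
  have zD: "z \<in> grass_verts D" using z w by (auto simp: hyperplanes_def grass_verts_def)
  moreover have "vec.dim (w \<inter> y) = vec.dim (z \<inter> y) + (if w \<inter> y \<subseteq> z then 0 else 1)"
    using dim_Int_hyperplane[of z w y] w z y
    by (auto simp: hyperplanes_def grass_verts_def)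
  moreover have "vec.dim (z \<inter> y) \<le> D" using vec.dim_subset[of "z \<inter> y" z] zD by (auto simp: grass_verts_def)
  ultimately show ?thesis using grass_dist_eq[of D y z] y D by (simp add: Int_commute)
qed

text \<open>Containment is reversed: the nearest members are the hyperplanes of \<open>w\<close>
  through \<open>y \<inter> w\<close>. Their number is again \<open>[i + 1]\<close>, so the average
  over the clique has one formula for both kinds.\<close>

lemma plane_clique_index:
  fixes w y :: "('f::{field,finite} ^ 'n) set"
  assumes D: "1 \<le> D" and w: "vec.subspace w" "vec.dim w = D + 1" and y: "y \<in> grass_verts D"
  shows "clique_index D (hyperplanes w) y = D - vec.dim (y \<inter> w)"
    and "{z \<in> hyperplanes w. grass_dist D y z = clique_index D (hyperplanes w) y} = {z \<in> hyperplanes w. y \<inter> w \<subseteq> z}"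
    and "of_nat (card {z \<in> hyperplanes w. grass_dist D y z = clique_index D (hyperplanes w) y})
      = fqnum TYPE('f) (clique_index D (hyperplanes w) y + 1)"
proof -
  have sy: "vec.subspace y" "vec.dim y = D" using y by (auto simp: grass_verts_def)
  have le: "vec.dim (y \<inter> w) \<le> D" using vec.dim_subset[of "y \<inter> w" y] sy by auto
  have si: "vec.subspace (y \<inter> w)" using sy w by (simp add: vec.subspace_inter)
  obtain z where z: "z \<in> hyperplanes w" "y \<inter> w \<subseteq> z"
    using hyperplane_above_exists[OF si w(1)] le w by auto
  show i: "clique_index D (hyperplanes w) y = D - vec.dim (y \<inter> w)"
    unfolding clique_index_def
  proof (rule Min_image_eqI[OF _ z(1)])
    show "grass_dist D y z = D - vec.dim (y \<inter> w)"
      using plane_clique_dist[OF D w y z(1)] z by simp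
    show "D - vec.dim (y \<inter> w) \<le> grass_dist D y z'" if "z' \<in> hyperplanes w" for z'
      using plane_clique_dist[OF D w y that] by simp
  qed simp
  show e: "{z \<in> hyperplanes w. grass_dist D y z = clique_index D (hyperplanes w) y} = {z \<in> hyperplanes w. y \<inter> w \<subseteq> z}"
  proof (rule Collect_cong, rule conj_cong[OF refl])
    fix z assume "z \<in> hyperplanes w"
    from plane_clique_dist[OF D w y this]
    show "grass_dist D y z = clique_index D (hyperplanes w) y \<longleftrightarrow> y \<inter> w \<subseteq> z"
      unfolding i using le by (auto split: if_splits)
  qed
  have "clique_index D (hyperplanes w) y + 1 = D + 1 - vec.dim (y \<inter> w)" unfolding i using le by simp
  moreover have "of_nat (card {z \<in> hyperplanes w. y \<inter> w \<subseteq> z}) = fqnum TYPE('f) (D + 1 - vec.dim (y \<inter> w))"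
    using card_hyperplanes_above[OF si w(1)] w by simp
  ultimately show "of_nat (card {z \<in> hyperplanes w. grass_dist D y z = clique_index D (hyperplanes w) y})
      = fqnum TYPE('f) (clique_index D (hyperplanes w) y + 1)"
    unfolding e by simp
qed

section \<open>The adjacency matrix on the cells of a clique\<close>

lemma sum_neighbours_flag:
  fixes y F1 F2 :: "('f::{field,finite} ^ 'n) set" and \<phi> :: "nat \<Rightarrow> nat \<Rightarrow> complex"
  assumes D: "1 \<le> D" "D \<le> CARD('n)" and y: "y \<in> grass_verts D"
    and F: "vec.subspace F1" "vec.subspace F2" "F1 \<subseteq> F2"
    and ab: "vec.dim (y \<inter> F1) = a" "vec.dim (y \<inter> F2) = b"
  defines "\<psi> \<equiv> (\<lambda>a b. fqnum TYPE('f) (vec.dim F1 - a) * \<phi> (a + 1) (b + 1)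
      + (fqnum TYPE('f) (vec.dim F2 - b) - fqnum TYPE('f) (vec.dim F1 - a)) * \<phi> a (b + 1)
      + (fqnum TYPE('f) (CARD('n) - D + 1) - fqnum TYPE('f) (vec.dim F2 - b)) * \<phi> a b)"
  shows "(\<Sum>z | grass_adj D y z. \<phi> (vec.dim (z \<inter> F1)) (vec.dim (z \<inter> F2)))
    = fqnum TYPE('f) (D - b) * \<psi> a b
      + (fqnum TYPE('f) (D - a) - fqnum TYPE('f) (D - b)) * \<psi> a (b - 1)
      + (fqnum TYPE('f) D - fqnum TYPE('f) (D - a)) * \<psi> (a - 1) (b - 1)
      - fqnum TYPE('f) D * \<phi> a b"
proof -
  have sy: "vec.subspace y" "vec.dim y = D" using y by (auto simp: grass_verts_def)
  have "(\<Sum>h\<in>hyperplanes y. \<Sum>z\<in>covers h. \<phi> (vec.dim (z \<inter> F1)) (vec.dim (z \<inter> F2)))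
      = (\<Sum>h\<in>hyperplanes y. \<psi> (vec.dim (h \<inter> F1)) (vec.dim (h \<inter> F2)))"
  proof (rule sum.cong[OF refl])
    fix h assume "h \<in> hyperplanes y"
    then have h: "vec.subspace h" "vec.dim h + 1 = D" using sy by (auto simp: hyperplanes_def)
    then have "CARD('n) - vec.dim h = CARD('n) - D + 1" using D by simp
    then show "(\<Sum>z\<in>covers h. \<phi> (vec.dim (z \<inter> F1)) (vec.dim (z \<inter> F2)))
        = \<psi> (vec.dim (h \<inter> F1)) (vec.dim (h \<inter> F2))"
      using sum_covers_flag[OF h(1) F refl refl, of \<phi>] unfolding \<psi>_def by simp
  qed
  also have "\<dots> = fqnum TYPE('f) (D - b) * \<psi> a b
      + (fqnum TYPE('f) (D - a) - fqnum TYPE('f) (D - b)) * \<psi> a (b - 1)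
      + (fqnum TYPE('f) D - fqnum TYPE('f) (D - a)) * \<psi> (a - 1) (b - 1)"
    using sum_hyperplanes_flag[OF sy(1) F ab, of \<psi>] sy(2) by simp
  finally show ?thesis
    using sum_neighbours[OF D(1) y, of "\<lambda>z. \<phi> (vec.dim (z \<inter> F1)) (vec.dim (z \<inter> F2))"] ab by simp
qed

text \<open>The shape is read off from a point clique, with \<open>B m = [m]\<close>,
  \<open>n = N - D + 1\<close>, and \<open>f\<close>, \<open>g\<close> the values on the two rows of
  cells. The leading factors count the hyperplanes of a vertex by their position relative to the
  flag, the inner brackets distribute the covers of such a hyperplane over the cells, and
  \<open>B D * f j\<close> removes the returns. Terms with index \<open>j - 1\<close> vanish at
  \<open>j = 0\<close>, those with \<open>j + 1\<close> at \<open>j = D - 1\<close>.\<close>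

definition adj_minus ::
    "(nat \<Rightarrow> complex) \<Rightarrow> nat \<Rightarrow> nat \<Rightarrow> (nat \<Rightarrow> complex) \<Rightarrow> (nat \<Rightarrow> complex) \<Rightarrow> nat \<Rightarrow> complex" where
  "adj_minus B D n f g j =
     B j * (B j * f (j - 1) + (B n - B j) * f j)
     + (B (j + 1) - B j) * (B j * g (j - 1) + (B (j + 1) - B j) * f j + (B n - B (j + 1)) * g j)
     + (B D - B (j + 1)) * (B (j + 1) * f j + (B n - B (j + 1)) * f (j + 1))
     - B D * f j"

definition adj_plus ::
    "(nat \<Rightarrow> complex) \<Rightarrow> nat \<Rightarrow> nat \<Rightarrow> (nat \<Rightarrow> complex) \<Rightarrow> (nat \<Rightarrow> complex) \<Rightarrow> nat \<Rightarrow> complex" where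
  "adj_plus B D n f g j =
     B (j + 1) * (B j * g (j - 1) + (B (j + 1) - B j) * f j + (B n - B (j + 1)) * g j)
     + (B D - B (j + 1))
       * (B (j + 1) * g j + (B (j + 2) - B (j + 1)) * f (j + 1) + (B n - B (j + 2)) * g (j + 1))
     - B D * g j"

definition clique_fun ::
    "nat \<Rightarrow> ('f::{field,finite} ^ 'n) set set \<Rightarrow> ('f ^ 'n) set \<Rightarrow> (nat \<Rightarrow> complex) \<Rightarrow> (nat \<Rightarrow> complex)
      \<Rightarrow> ('f ^ 'n) set \<Rightarrow> complex" where
  "clique_fun D C x f g y =
     (let i = clique_index D C y in if grass_dist D x y = i then f i else g i)"

lemma grass_dist_commute:
  "1 \<le> D \<Longrightarrow> y \<in> grass_verts D \<Longrightarrow> z \<in> grass_verts D \<Longrightarrow> grass_dist D y z = grass_dist D z y"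
  by (simp add: grass_dist_eq Int_commute)

text \<open>The flag is \<open>w\<close> inside \<open>x\<close>. A vertex that meets
  \<open>x\<close> in more than \<open>w\<close> has \<open>x\<close> among its nearest members and
  lies in a minus cell; equal dimensions mean a plus cell.\<close>

lemma point_clique_neighbours:
  fixes w x y :: "('f::{field,finite} ^ 'n) set"
  assumes D: "1 \<le> D" "D \<le> CARD('n)" and w: "vec.subspace w" "vec.dim w + 1 = D"
    and x: "x \<in> covers w" and y: "y \<in> grass_verts D"
  defines "B \<equiv> fqnum TYPE('f)" and "n \<equiv> CARD('n) - D + 1" and "j \<equiv> clique_index D (covers w) y"
  shows "(\<Sum>z | grass_adj D y z. clique_fun D (covers w) x f g z)
    = (if grass_dist D x y = j then adj_minus B D n f g j else adj_plus B D n f g j)"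
proof -
  have xD: "x \<in> grass_verts D" using covers_subset_grass_verts[OF w] x by auto
  have sx: "vec.subspace x" "vec.dim x = D" "w \<subseteq> x" using x w by (auto simp: covers_def)
  let ?\<phi> = "\<lambda>a b. if a = b then g (D - 1 - a) else f (D - 1 - a)"
  have fq: "fqnum TYPE('f) m = B m" for m by (simp add: B_def)
  have dims: "vec.dim (z \<inter> w) + 1 \<le> D \<and> vec.dim (z \<inter> w) \<le> vec.dim (z \<inter> x)
      \<and> vec.dim (z \<inter> x) \<le> vec.dim (z \<inter> w) + 1
      \<and> clique_index D (covers w) z = D - 1 - vec.dim (z \<inter> w) \<and> grass_dist D x z = D - vec.dim (z \<inter> x)"
    if z: "z \<in> grass_verts D" for z
  proof -
    have sz: "vec.subspace z" using z by (auto simp: grass_verts_def)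
    have "vec.dim (x \<inter> z) \<le> vec.dim (w \<inter> z) + 1"
      using dim_Int_le_hyperplane[OF w(1) sx(1) sz sx(3)] sx w by simp
    moreover have "vec.dim (z \<inter> w) \<le> vec.dim (z \<inter> x)" using sx by (intro vec.dim_subset) auto
    moreover have "vec.dim (z \<inter> w) + 1 \<le> D" using vec.dim_subset[of "z \<inter> w" w] w by auto
    ultimately show ?thesis
      using point_clique_index(1)[OF w z] grass_dist_eq[OF D(1) xD z] by (simp add: Int_commute)
  qed
  have val: "clique_fun D (covers w) x f g z = ?\<phi> (vec.dim (z \<inter> w)) (vec.dim (z \<inter> x))"
    if "z \<in> grass_verts D" for z
  proof -
    have "grass_dist D x z = clique_index D (covers w) z \<longleftrightarrow> vec.dim (z \<inter> w) \<noteq> vec.dim (z \<inter> x)"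
      using dims[OF that] by auto
    then show ?thesis unfolding clique_fun_def Let_def using dims[OF that] by auto
  qed
  have "(\<Sum>z | grass_adj D y z. clique_fun D (covers w) x f g z)
      = (\<Sum>z | grass_adj D y z. ?\<phi> (vec.dim (z \<inter> w)) (vec.dim (z \<inter> x)))"
    using val by (intro sum.cong) (auto simp: grass_adj_def)
  note eq = this[unfolded sum_neighbours_flag[OF D y w(1) sx(1,3) refl refl, of ?\<phi>], folded n_def, unfolded fq]
  have dw: "vec.dim w = D - 1" using w by simp
  define a where "a = vec.dim (y \<inter> w)"
  have Dj: "D = a + 1 + j" using dims[OF y] by (auto simp: j_def a_def)
  note dy = dims[OF y, folded a_def j_def]
  show ?thesis
  proof (cases "grass_dist D x y = j")
    case True
    have b: "vec.dim (y \<inter> x) = a + 1" using dy True Dj by linarith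
    show ?thesis
      using True unfolding eq b a_def[symmetric] adj_minus_def dw sx(2)
      by (cases a) (simp_all add: Dj algebra_simps)
  next
    case False
    have b: "vec.dim (y \<inter> x) = a" using dy False Dj by linarith
    show ?thesis
      using False unfolding eq b a_def[symmetric] adj_plus_def dw sx(2)
      by (cases a) (simp_all add: Dj algebra_simps)
  qed
qed

lemma qnum_Suc: "q \<noteq> 1 \<Longrightarrow> qnum q (Suc n) = q * qnum q n + 1"
  by (simp add: qnum_def field_simps)

lemma card_field_neq1: "real CARD('f::{field,finite}) \<noteq> 1"
  using card_field_ge2[where 'f='f] by linarith

text \<open>The flag is now \<open>x\<close> inside \<open>w\<close>, and equal dimensions mean a
  minus cell. The coefficients come out as different products of brackets; they match those of a
  point clique by \<open>n = D + 1\<close> and \<open>[m + 1] = q [m] + 1\<close>.\<close>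

lemma plane_clique_neighbours:
  fixes w x y :: "('f::{field,finite} ^ 'n) set"
  assumes D: "1 \<le> D" and N: "CARD('n) = 2 * D" and w: "vec.subspace w" "vec.dim w = D + 1"
    and x: "x \<in> hyperplanes w" and y: "y \<in> grass_verts D"
  defines "B \<equiv> fqnum TYPE('f)" and "n \<equiv> CARD('n) - D + 1" and "j \<equiv> clique_index D (hyperplanes w) y"
  shows "(\<Sum>z | grass_adj D y z. clique_fun D (hyperplanes w) x f g z)
    = (if grass_dist D x y = j then adj_minus B D n f g j else adj_plus B D n f g j)"
proof -
  have xD: "x \<in> grass_verts D" using x w by (auto simp: hyperplanes_def grass_verts_def)
  have sx: "vec.subspace x" "vec.dim x = D" "x \<subseteq> w" using x w by (auto simp: hyperplanes_def)
  have DN: "D \<le> CARD('n)" using N by simp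
  let ?\<phi> = "\<lambda>a b. if a = b then f (D - a) else g (D - b)"
  have fq: "fqnum TYPE('f) m = B m" for m by (simp add: B_def)
  have dims: "vec.dim (z \<inter> w) \<le> D \<and> 1 \<le> vec.dim (z \<inter> w) \<and> vec.dim (z \<inter> x) \<le> vec.dim (z \<inter> w)
      \<and> vec.dim (z \<inter> w) \<le> vec.dim (z \<inter> x) + 1
      \<and> clique_index D (hyperplanes w) z = D - vec.dim (z \<inter> w) \<and> grass_dist D x z = D - vec.dim (z \<inter> x)"
    if z: "z \<in> grass_verts D" for z
  proof -
    have sz: "vec.subspace z" "vec.dim z = D" using z by (auto simp: grass_verts_def)
    have "vec.dim (w \<inter> z) \<le> vec.dim (x \<inter> z) + 1"
      using dim_Int_le_hyperplane[OF sx(1) w(1) sz(1) sx(3)] sx w by simp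
    moreover have "vec.dim (z \<inter> x) \<le> vec.dim (z \<inter> w)" using sx by (intro vec.dim_subset) auto
    moreover have "vec.dim (z \<inter> w) \<le> D" using vec.dim_subset[of "z \<inter> w" z] sz by auto
    \<comment> \<open>The sum sits in a space of dimension \<open>2 D\<close>, so \<open>z\<close>
      cannot avoid the \<open>(D + 1)\<close>-dimensional \<open>w\<close>; this keeps the index
      below \<open>D\<close>.\<close>
    moreover have "vec.dim (subspace_sum z w) \<le> 2 * D"
      using vec.dim_subset[of "subspace_sum z w" UNIV] unfolding vec_dim_card N by simp
    then have "1 \<le> vec.dim (z \<inter> w)"
      using dim_subspace_sum[OF sz(1) w(1)] sz w by simp
    ultimately show ?thesis
      using plane_clique_index(1)[OF D w z] grass_dist_eq[OF D xD z] by (simp add: Int_commute)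
  qed
  have val: "clique_fun D (hyperplanes w) x f g z = ?\<phi> (vec.dim (z \<inter> x)) (vec.dim (z \<inter> w))"
    if "z \<in> grass_verts D" for z
  proof -
    have "grass_dist D x z = clique_index D (hyperplanes w) z \<longleftrightarrow> vec.dim (z \<inter> x) = vec.dim (z \<inter> w)"
      using dims[OF that] by auto
    then show ?thesis unfolding clique_fun_def Let_def using dims[OF that] by auto
  qed
  have "(\<Sum>z | grass_adj D y z. clique_fun D (hyperplanes w) x f g z)
      = (\<Sum>z | grass_adj D y z. ?\<phi> (vec.dim (z \<inter> x)) (vec.dim (z \<inter> w)))"
    using val by (intro sum.cong) (auto simp: grass_adj_def)
  note eq = this[unfolded sum_neighbours_flag[OF D DN y sx(1) w(1) sx(3) refl refl, of ?\<phi>], folded n_def, unfolded fq]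
  have n: "n = D + 1" using N by (simp add: n_def)
  have BS: "B (Suc m) = of_real (real CARD('f)) * B m + 1" for m
    unfolding B_def qnum_Suc[OF card_field_neq1] by simp
  note dy = dims[OF y, folded j_def]
  obtain b where b: "vec.dim (y \<inter> w) = Suc b" using dy by (cases "vec.dim (y \<inter> w)") auto
  have Dj: "D = Suc b + j" using dy b by linarith
  show ?thesis
  proof (cases "grass_dist D x y = j")
    case True
    have a: "vec.dim (y \<inter> x) = Suc b" using dy True Dj b by linarith
    show ?thesis
      using True unfolding eq a b adj_minus_def sx(2) w(2) n
      by (simp add: Dj BS) (simp add: algebra_simps)
  next
    case False
    have a: "vec.dim (y \<inter> x) = b" using dy False Dj b by linarith
    show ?thesis
      using False unfolding eq a b adj_plus_def sx(2) w(2) n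
      by (cases b) (simp_all add: Dj BS algebra_simps)
  qed
qed

lemma clique_neighbours:
  fixes C :: "('f::{field,finite} ^ 'n) set set"
  assumes D: "1 \<le> D" "2 * D \<le> CARD('n)" and C: "delsarte_clique D C" and x: "x \<in> C"
    and y: "y \<in> grass_verts D"
  defines "B \<equiv> fqnum TYPE('f)" and "n \<equiv> CARD('n) - D + 1" and "j \<equiv> clique_index D C y"
  shows "(\<Sum>z | grass_adj D y z. clique_fun D C x f g z)
    = (if grass_dist D x y = j then adj_minus B D n f g j else adj_plus B D n f g j)"
  using D C
proof (cases rule: delsarte_clique_cases)
  case (point w)
  then show ?thesis
    using point_clique_neighbours[OF D(1) _ point(1,2) _ y, of x f g] x D
    unfolding B_def n_def j_def by simp
next
  case (plane w)
  then show ?thesis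
    using plane_clique_neighbours[OF D(1) plane(1,2,3) _ y, of x f g] x
    unfolding B_def n_def j_def by simp
qed

lemma clique_index_dist:
  fixes C :: "('f::{field,finite} ^ 'n) set set"
  assumes D: "1 \<le> D" "2 * D \<le> CARD('n)" and C: "delsarte_clique D C" and y: "y \<in> grass_verts D"
  shows "clique_index D C y < D"
    and "z \<in> C \<Longrightarrow> grass_dist D y z = clique_index D C y \<or> grass_dist D y z = clique_index D C y + 1"
    and "of_nat (card {z \<in> C. grass_dist D y z = clique_index D C y})
      = fqnum TYPE('f) (clique_index D C y + 1)"
proof -
  have sy: "vec.subspace y" "vec.dim y = D" using y by (auto simp: grass_verts_def)
  have "clique_index D C y < D
      \<and> (z \<in> C \<longrightarrow> grass_dist D y z = clique_index D C y \<or> grass_dist D y z = clique_index D C y + 1)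
      \<and> of_nat (card {z \<in> C. grass_dist D y z = clique_index D C y}) = fqnum TYPE('f) (clique_index D C y + 1)"
    using D C
  proof (cases rule: delsarte_clique_cases)
    case (point w)
    have le: "vec.dim (y \<inter> w) + 1 \<le> D" using vec.dim_subset[of "y \<inter> w" w] point by auto
    note i = point_clique_index[OF point(1,2) y, folded point(3)]
    have "clique_index D C y < D" using i(1) le by simp
    moreover have "grass_dist D y z = clique_index D C y \<or> grass_dist D y z = clique_index D C y + 1" if "z \<in> C"
      using point_clique_dist[OF point(1,2) y, of z] that i(1) le point(3) by auto
    ultimately show ?thesis using i(3) by blast
  next
    case (plane w)
    have le: "vec.dim (y \<inter> w) \<le> D" using vec.dim_subset[of "y \<inter> w" y] sy by auto
    have "vec.dim (subspace_sum y w) \<le> 2 * D"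
      using vec.dim_subset[of "subspace_sum y w" UNIV] unfolding vec_dim_card plane(1) by simp
    then have ge: "1 \<le> vec.dim (y \<inter> w)"
      using dim_subspace_sum[OF sy(1) plane(2)] sy plane by simp
    note i = plane_clique_index[OF D(1) plane(2,3) y, folded plane(4)]
    have "clique_index D C y < D" using i(1) le ge D by simp
    moreover have "grass_dist D y z = clique_index D C y \<or> grass_dist D y z = clique_index D C y + 1" if "z \<in> C"
      using plane_clique_dist[OF D(1) plane(2,3) y, of z] that i(1) le plane(4) by (auto split: if_splits)
    ultimately show ?thesis using i(3) by blast
  qed
  then show "clique_index D C y < D"
    and "z \<in> C \<Longrightarrow> grass_dist D y z = clique_index D C y \<or> grass_dist D y z = clique_index D C y + 1"
    and "of_nat (card {z \<in> C. grass_dist D y z = clique_index D C y}) = fqnum TYPE('f) (clique_index D C y + 1)"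
    by blast+
qed

section \<open>The primitive idempotent of the first eigenvalue\<close>

text \<open>For \<open>B m = [m]\<close> and \<open>n = N - D + 1\<close> this is the tridiagonal
  operator of a distance-regular graph: the coefficient of \<open>\<phi> (i - 1)\<close> is
  \<open>c_i = [i]^2\<close>, that of \<open>\<phi> (i + 1)\<close> is
  \<open>b_i = q^(2i+1) [D - i] [N - D - i]\<close>.\<close>

definition adj_radial :: "(nat \<Rightarrow> complex) \<Rightarrow> nat \<Rightarrow> nat \<Rightarrow> (nat \<Rightarrow> complex) \<Rightarrow> nat \<Rightarrow> complex" where
  "adj_radial B D n \<phi> i =
     B i * (B i * \<phi> (i - 1) + (B n - B i) * \<phi> i)
     + (B D - B i) * (B (i + 1) * \<phi> i + (B n - B (i + 1)) * \<phi> (i + 1)) - B D * \<phi> i"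

text \<open>This is the flag count for the degenerate flag whose two members both equal
  \<open>y\<close>.\<close>

lemma sum_neighbours_dist:
  fixes y z :: "('f::{field,finite} ^ 'n) set"
  assumes D: "1 \<le> D" "D \<le> CARD('n)" and y: "y \<in> grass_verts D" and z: "z \<in> grass_verts D"
  shows "(\<Sum>z' | grass_adj D z z'. \<phi> (grass_dist D y z'))
    = adj_radial (fqnum TYPE('f)) D (CARD('n) - D + 1) \<phi> (grass_dist D y z)"
proof -
  define B where "B = fqnum TYPE('f)"
  have fq: "fqnum TYPE('f) m = B m" for m by (simp add: B_def)
  have sy: "vec.subspace y" "vec.dim y = D" using y by (auto simp: grass_verts_def)
  let ?\<phi> = "\<lambda>a b. \<phi> (D - a)"
  have "(\<Sum>z' | grass_adj D z z'. \<phi> (grass_dist D y z'))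
      = (\<Sum>z' | grass_adj D z z'. ?\<phi> (vec.dim (z' \<inter> y)) (vec.dim (z' \<inter> y)))"
    using grass_dist_eq[OF D(1) y] by (intro sum.cong) (auto simp: grass_adj_def Int_commute)
  note eq = this[unfolded sum_neighbours_flag[OF D z sy(1) sy(1) subset_refl refl refl, of ?\<phi>], unfolded fq]
  have le: "vec.dim (z \<inter> y) \<le> D" using vec.dim_subset[of "z \<inter> y" y] sy by auto
  define i where "i = grass_dist D y z"
  have i: "i = D - vec.dim (z \<inter> y)"
    using grass_dist_eq[OF D(1) y z] by (simp add: i_def Int_commute)
  obtain a where a: "vec.dim (z \<inter> y) = a" "D = a + i" using i le by auto
  show ?thesis
    unfolding eq adj_radial_def i_def[symmetric] sy(2) a(1) fq
    by (cases a) (simp_all add: a(2) algebra_simps)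
qed

lemma sum_grass_adj_swap:
  fixes f g :: "('f::{field,finite} ^ 'n) set \<Rightarrow> complex"
  shows "(\<Sum>z\<in>grass_verts D. f z * (\<Sum>z' | grass_adj D z z'. g z'))
    = (\<Sum>z'\<in>grass_verts D. (\<Sum>z | grass_adj D z' z. f z) * g z')"
proof -
  have e: "{z'. grass_adj D z z'} = {z'. z' \<in> grass_verts D \<and> grass_adj D z z'}" for z :: "('f ^ 'n) set"
    by (auto simp: grass_adj_def)
  have "(\<Sum>z\<in>grass_verts D. f z * (\<Sum>z' | grass_adj D z z'. g z'))
      = (\<Sum>z\<in>grass_verts D. \<Sum>z' | z' \<in> grass_verts D \<and> grass_adj D z z'. f z * g z')"
    using e by (simp add: sum_distrib_left)
  also have "\<dots> = (\<Sum>z'\<in>grass_verts D. \<Sum>z | z \<in> grass_verts D \<and> grass_adj D z z'. f z * g z')"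
    by (rule sum.swap_restrict) auto
  also have "\<dots> = (\<Sum>z'\<in>grass_verts D. (\<Sum>z | grass_adj D z' z. f z) * g z')"
    using e by (simp add: sum_distrib_right grass_adj_sym)
  finally show ?thesis .
qed

definition sphere_sum :: "nat \<Rightarrow> (('f::{field,finite} ^ 'n) set \<Rightarrow> complex) \<Rightarrow> ('f ^ 'n) set \<Rightarrow> nat \<Rightarrow> complex" where
  "sphere_sum D w y i = (\<Sum>z | z \<in> grass_verts D \<and> grass_dist D y z = i. w z)"

lemma grass_dist_le: "1 \<le> D \<Longrightarrow> y \<in> grass_verts D \<Longrightarrow> z \<in> grass_verts D \<Longrightarrow> grass_dist D y z \<le> D"
  by (simp add: grass_dist_eq)

lemma sum_radial:
  assumes "1 \<le> D" "y \<in> grass_verts D"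
  shows "(\<Sum>z\<in>grass_verts D. \<phi> (grass_dist D y z) * w z) = (\<Sum>i\<le>D. \<phi> i * sphere_sum D w y i)"
proof -
  have "(\<Sum>i\<le>D. \<phi> i * sphere_sum D w y i)
      = (\<Sum>i\<le>D. \<Sum>z | z \<in> grass_verts D \<and> grass_dist D y z = i. \<phi> (grass_dist D y z) * w z)"
    unfolding sphere_sum_def sum_distrib_left by (intro sum.cong) auto
  also have "\<dots> = (\<Sum>z\<in>grass_verts D. \<phi> (grass_dist D y z) * w z)"
    using grass_dist_le[OF assms] by (intro sum.group) auto
  finally show ?thesis by simp
qed

definition adj_eigenfun :: "nat \<Rightarrow> complex \<Rightarrow> (('f::{field,finite} ^ 'n) set \<Rightarrow> complex) \<Rightarrow> bool" where
  "adj_eigenfun D \<theta> w \<longleftrightarrow> (\<forall>z\<in>grass_verts D. (\<Sum>z' | grass_adj D z z'. w z') = \<theta> * w z)"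

text \<open>The adjacency matrix is symmetric, so it can be moved from the radial test function to
  the eigenfunction. An arbitrary \<open>\<phi>\<close> encodes the whole recurrence at once, with
  the boundary cases hidden in \<open>adj_radial\<close>.\<close>

lemma sphere_sum_orthogonal:
  fixes w :: "('f::{field,finite} ^ 'n) set \<Rightarrow> complex"
  assumes D: "1 \<le> D" "D \<le> CARD('n)" and w: "adj_eigenfun D \<theta> w" and y: "y \<in> grass_verts D"
  shows "(\<Sum>i\<le>D. (adj_radial (fqnum TYPE('f)) D (CARD('n) - D + 1) \<phi> i - \<theta> * \<phi> i) * sphere_sum D w y i) = 0"
proof -
  let ?L = "adj_radial (fqnum TYPE('f)) D (CARD('n) - D + 1) \<phi>"
  have "(\<Sum>i\<le>D. ?L i * sphere_sum D w y i) = (\<Sum>z\<in>grass_verts D. ?L (grass_dist D y z) * w z)"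
    using sum_radial[OF D(1) y] by metis
  also have "\<dots> = (\<Sum>z\<in>grass_verts D. (\<Sum>z' | grass_adj D z z'. \<phi> (grass_dist D y z')) * w z)"
    using sum_neighbours_dist[OF D y] by (intro sum.cong) simp_all
  also have "\<dots> = (\<Sum>z\<in>grass_verts D. \<phi> (grass_dist D y z) * (\<Sum>z' | grass_adj D z z'. w z'))"
    by (rule sum_grass_adj_swap[symmetric])
  also have "\<dots> = \<theta> * (\<Sum>z\<in>grass_verts D. \<phi> (grass_dist D y z) * w z)"
    using w by (simp add: adj_eigenfun_def sum_distrib_left algebra_simps)
  also have "\<dots> = \<theta> * (\<Sum>i\<le>D. \<phi> i * sphere_sum D w y i)"
    using sum_radial[OF D(1) y] by metis
  finally show ?thesis by (simp add: algebra_simps sum_subtractf sum_distrib_left)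
qed

lemma fqnum_neq_0: "0 < m \<Longrightarrow> fqnum TYPE('f::{field,finite}) m \<noteq> 0"
proof -
  assume "0 < m"
  moreover have "1 < real CARD('f)" using card_field_ge2[where 'f='f] by simp
  ultimately have "0 < qnum (real CARD('f)) m" by (intro qnum_pos)
  then show ?thesis by simp
qed

text \<open>Testing against the indicator of \<open>i\<close> is a three-term recurrence whose leading coefficient
  \<open>[i + 1]\<^sup>2\<close> does not vanish.\<close>

lemma radial_recurrence_unique:
  assumes orth: "\<And>\<phi>. (\<Sum>i\<le>D. (adj_radial (fqnum TYPE('f::{field,finite})) D n \<phi> i - \<theta> * \<phi> i) * s i) = 0"
    and s0: "s 0 = 0" and "i \<le> D"
  shows "s i = 0"
  using \<open>i \<le> D\<close>
proof (induction i rule: less_induct)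
  case (less i)
  show ?case
  proof (cases i)
    case 0
    then show ?thesis using s0 by simp
  next
    case (Suc m)
    define B where "B = fqnum TYPE('f)"
    define \<phi> :: "nat \<Rightarrow> complex" where "\<phi> l = (if l = m then 1 else 0)" for l
    have "(adj_radial B D n \<phi> l - \<theta> * \<phi> l) * s l = (if l = i then B i * B i * s i else 0)" if "l \<le> D" for l
    proof -
      consider "l < i" | "l = i" | "l > i" by linarith
      then show ?thesis
      proof cases
        case 1
        then show ?thesis using less that by simp
      next
        case 2
        then show ?thesis using Suc by (simp add: adj_radial_def \<phi>_def)
      next
        case 3
        then have "l \<noteq> m" "l - 1 \<noteq> m" "l + 1 \<noteq> m" using Suc by auto
        then show ?thesis using 3 by (simp add: adj_radial_def \<phi>_def)
      qed
    qed
    then have "(\<Sum>l\<le>D. (adj_radial B D n \<phi> l - \<theta> * \<phi> l) * s l) = (\<Sum>l\<le>D. if l = i then B i * B i * s i else 0)"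
      by (intro sum.cong) auto
    also have "\<dots> = B i * B i * s i" using less.prems by simp
    finally have "B i * B i * s i = 0" using orth[of \<phi>] by (simp add: B_def)
    moreover have "B i \<noteq> 0" using fqnum_neq_0[of i, where 'f='f] Suc by (simp add: B_def)
    ultimately show ?thesis by simp
  qed
qed

lemma sphere_sum_0:
  assumes "1 \<le> D" "y \<in> grass_verts D"
  shows "sphere_sum D w y 0 = w y"
proof -
  have "{z. z \<in> grass_verts D \<and> grass_dist D y z = 0} = {y}"
  proof (intro equalityI subsetI)
    fix z assume "z \<in> {z. z \<in> grass_verts D \<and> grass_dist D y z = 0}"
    then have z: "z \<in> grass_verts D" "vec.dim (y \<inter> z) \<ge> D" using grass_dist_eq[OF assms] by auto
    then have "y \<subseteq> z" "z \<subseteq> y"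
      using dim_Int_less[of y z] dim_Int_less[of z y] assms by (auto simp: grass_verts_def Int_commute)
    then show "z \<in> {y}" by auto
  qed (use assms in \<open>auto simp: grass_dist_eq grass_verts_def\<close>)
  then show ?thesis by (simp add: sphere_sum_def)
qed

text \<open>Any two eigenfunctions for the same eigenvalue have proportional sphere sums.\<close>

lemma radial_kernel_scalar:
  fixes w p :: "('f::{field,finite} ^ 'n) set \<Rightarrow> complex"
  assumes D: "1 \<le> D" "D \<le> CARD('n)" and w: "adj_eigenfun D \<theta> w" and p: "adj_eigenfun D \<theta> p"
    and y: "y \<in> grass_verts D" and y0: "y0 \<in> grass_verts D"
  shows "(\<Sum>z\<in>grass_verts D. \<phi> (grass_dist D y z) * w z) * p y0
    = w y * (\<Sum>z\<in>grass_verts D. \<phi> (grass_dist D y0 z) * p z)"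
proof -
  \<comment> \<open>Cross-multiplication produces a solution of the same recurrence with initial
    value zero, and avoids dividing by \<open>p y0\<close>.\<close>
  define s where "s i = sphere_sum D w y i * p y0 - w y * sphere_sum D p y0 i" for i
  have "s i = 0" if "i \<le> D" for i
  proof (rule radial_recurrence_unique[OF _ _ that, where 'f='f])
    show "s 0 = 0" by (simp add: s_def sphere_sum_0[OF D(1) y] sphere_sum_0[OF D(1) y0])
    show "(\<Sum>i\<le>D. (adj_radial (fqnum TYPE('f)) D (CARD('n) - D + 1) \<psi> i - \<theta> * \<psi> i) * s i) = 0" for \<psi>
    proof -
      let ?c = "\<lambda>i. adj_radial (fqnum TYPE('f)) D (CARD('n) - D + 1) \<psi> i - \<theta> * \<psi> i"
      have "(\<Sum>i\<le>D. ?c i * s i)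
          = (\<Sum>i\<le>D. ?c i * sphere_sum D w y i) * p y0 - w y * (\<Sum>i\<le>D. ?c i * sphere_sum D p y0 i)"
        by (simp add: s_def sum_subtractf sum_distrib_left sum_distrib_right right_diff_distrib mult_ac)
      then show ?thesis
        using sphere_sum_orthogonal[OF D w y] sphere_sum_orthogonal[OF D p y0] by simp
    qed
  qed
  then have "(\<Sum>i\<le>D. \<phi> i * s i) = 0" by simp
  moreover have "(\<Sum>i\<le>D. \<phi> i * s i)
      = (\<Sum>i\<le>D. \<phi> i * sphere_sum D w y i) * p y0 - w y * (\<Sum>i\<le>D. \<phi> i * sphere_sum D p y0 i)"
    by (simp add: s_def sum_subtractf sum_distrib_left sum_distrib_right right_diff_distrib mult_ac)
  ultimately show ?thesis unfolding sum_radial[OF D(1) y] sum_radial[OF D(1) y0] by simp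
qed

section \<open>Moments of the number of common vectors\<close>

definition verts_above :: "nat \<Rightarrow> ('f::{field,finite} ^ 'n) set \<Rightarrow> nat" where
  "verts_above D S = card {y \<in> grass_verts D. S \<subseteq> y}"

lemma real_card_covers:
  fixes h :: "('f::{field,finite} ^ 'n) set"
  assumes "vec.subspace h"
  shows "real (card (covers h)) = qnum (real CARD('f)) (CARD('n) - vec.dim h)"
  by (rule real_eq_of_nat[OF card_covers[OF assms]])

lemma real_card_hyperplanes_above:
  fixes s y :: "('f::{field,finite} ^ 'n) set"
  assumes "vec.subspace s" "vec.subspace y" "s \<subseteq> y"
  shows "real (card {h \<in> hyperplanes y. s \<subseteq> h}) = qnum (real CARD('f)) (vec.dim y - vec.dim s)"
  by (rule real_eq_of_nat[OF card_hyperplanes_above[OF assms]])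

text \<open>Double count the pairs of a \<open>D\<close>-space inside a
  \<open>(D + 1)\<close>-space, both containing \<open>S\<close>. The numbers are Gaussian binomial
  coefficients, but only their ratios are used.\<close>

lemma verts_above_Suc:
  fixes S :: "('f::{field,finite} ^ 'n) set"
  assumes S: "vec.subspace S"
  shows "real (verts_above (Suc D) S) * qnum (real CARD('f)) (Suc D - vec.dim S)
    = real (verts_above D S) * qnum (real CARD('f)) (CARD('n) - D)"
proof -
  let ?V = "\<lambda>D. {y \<in> grass_verts D. S \<subseteq> y}"
  have "real (verts_above (Suc D) S) * qnum (real CARD('f)) (Suc D - vec.dim S)
      = (\<Sum>z\<in>?V (Suc D). real (card {h \<in> hyperplanes z. S \<subseteq> h}))"
    using real_card_hyperplanes_above[OF S] by (simp add: verts_above_def grass_verts_def)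
  also have "\<dots> = (\<Sum>z\<in>?V (Suc D). \<Sum>y | y \<in> ?V D \<and> y \<subseteq> z. 1)"
  proof (rule sum.cong[OF refl])
    fix z assume "z \<in> ?V (Suc D)"
    then have "{h \<in> hyperplanes z. S \<subseteq> h} = {y. y \<in> ?V D \<and> y \<subseteq> z}"
      by (auto simp: hyperplanes_def grass_verts_def)
    then show "real (card {h \<in> hyperplanes z. S \<subseteq> h}) = (\<Sum>y | y \<in> ?V D \<and> y \<subseteq> z. 1)" by simp
  qed
  also have "\<dots> = (\<Sum>y\<in>?V D. \<Sum>z | z \<in> ?V (Suc D) \<and> y \<subseteq> z. 1)"
    by (rule sum.swap_restrict) auto
  also have "\<dots> = (\<Sum>y\<in>?V D. qnum (real CARD('f)) (CARD('n) - D))"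
  proof (rule sum.cong[OF refl])
    fix y assume y: "y \<in> ?V D"
    then have "{z. z \<in> ?V (Suc D) \<and> y \<subseteq> z} = covers y"
      by (auto simp: covers_def grass_verts_def)
    then show "(\<Sum>z | z \<in> ?V (Suc D) \<and> y \<subseteq> z. 1) = qnum (real CARD('f)) (CARD('n) - D)"
      using real_card_covers[of y] y by (simp add: grass_verts_def)
  qed
  finally show ?thesis by (simp add: verts_above_def)
qed

text \<open>Requiring a vertex above \<open>S\<close> to contain the cover \<open>T\<close> keeps
  the fraction \<open>[D - s] / [N - s]\<close>. Both counts satisfy the recurrence in
  \<open>D\<close>, which carries the ratio upwards.\<close>

lemma verts_above_ratio:
  fixes S T :: "('f::{field,finite} ^ 'n) set"
  assumes S: "vec.subspace S" and T: "vec.subspace T" "vec.dim T = vec.dim S + 1"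
    and "vec.dim S \<le> D"
  shows "real (verts_above D T) * qnum (real CARD('f)) (CARD('n) - vec.dim S)
    = real (verts_above D S) * qnum (real CARD('f)) (D - vec.dim S)"
  using \<open>vec.dim S \<le> D\<close>
proof (induction D rule: dec_induct)
  case base
  have "\<not> T \<subseteq> y" if "y \<in> grass_verts (vec.dim S)" for y
    using T vec.dim_subset[of T y] that by (auto simp: grass_verts_def)
  then have "{y \<in> grass_verts (vec.dim S). T \<subseteq> y} = {}" by blast
  then show ?case by (simp add: verts_above_def qnum_def del: Collect_empty_eq)
next
  case (step D)
  have q: "1 < real CARD('f)" using card_field_ge2[where 'f='f] by simp
  let ?B = "qnum (real CARD('f))"
  show ?case
  \<comment> \<open>For \<open>D = dim S\<close> the recurrence for \<open>T\<close> carries the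
    factor \<open>[0] = 0\<close> and says nothing; here the two counts are \<open>1\<close> and
    \<open>[N - s]\<close> directly.\<close>
  proof (cases "D = vec.dim S")
    case True
    have "{y \<in> grass_verts (Suc D). T \<subseteq> y} = {T}"
    proof (intro equalityI subsetI)
      fix y assume "y \<in> {y \<in> grass_verts (Suc D). T \<subseteq> y}"
      then have "T = y" using T True by (intro vec.subspace_dim_equal) (auto simp: grass_verts_def)
      then show "y \<in> {T}" by simp
    qed (use T True in \<open>auto simp: grass_verts_def\<close>)
    then have "verts_above (Suc D) T = 1" by (simp add: verts_above_def)
    moreover have "{y \<in> grass_verts (Suc D). S \<subseteq> y} = covers S"
      using True by (auto simp: grass_verts_def covers_def)
    then have "real (verts_above (Suc D) S) = ?B (CARD('n) - vec.dim S)"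
      using real_card_covers[OF S] by (simp add: verts_above_def)
    moreover have "Suc D - vec.dim S = 1" using True by simp
    moreover have "?B 1 = 1" using q by (simp add: qnum_def)
    ultimately show ?thesis by simp
  next
    case False
    then have lt: "vec.dim S < D" using step by simp
    have e: "Suc D - vec.dim T = D - vec.dim S" using T by simp
    have "?B (D - vec.dim S) > 0" using lt by (intro qnum_pos[OF q]) simp
    moreover have "real (verts_above (Suc D) T) * ?B (CARD('n) - vec.dim S) * ?B (D - vec.dim S)
        = real (verts_above D T) * ?B (CARD('n) - vec.dim S) * ?B (CARD('n) - D)"
      using verts_above_Suc[OF T(1), of D] unfolding e by simp
    then have "real (verts_above (Suc D) T) * ?B (CARD('n) - vec.dim S) * ?B (D - vec.dim S)
        = real (verts_above (Suc D) S) * ?B (Suc D - vec.dim S) * ?B (D - vec.dim S)"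
      using step.IH verts_above_Suc[OF S, of D] by simp
    ultimately show ?thesis by simp
  qed
qed

text \<open>For \<open>S\<close> of dimension \<open>s\<close> inside a vertex \<open>y\<close>,
  this is the factor gained by summing over one more vector of \<open>y\<close>: the
  \<open>q^s\<close> vectors of \<open>S\<close> cost nothing, each other one keeps the fraction
  \<open>[D - s] / [N - s]\<close>. For \<open>s = 0\<close> it is the mean of
  \<open>|y \<inter> z|\<close> over all vertices \<open>z\<close>.\<close>

definition above_ratio :: "real \<Rightarrow> nat \<Rightarrow> nat \<Rightarrow> nat \<Rightarrow> real" where
  "above_ratio q N D s = q ^ s + (q ^ D - q ^ s) * qnum q (D - s) / qnum q (N - s)"

lemma sum_verts_above_insert:
  fixes S y :: "('f::{field,finite} ^ 'n) set"
  assumes S: "vec.subspace S" and y: "y \<in> grass_verts D" "S \<subseteq> y" and lt: "vec.dim S < CARD('n)"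
  shows "(\<Sum>v\<in>y. real (verts_above D (vec.span (insert v S))))
    = above_ratio (real CARD('f)) CARD('n) D (vec.dim S) * real (verts_above D S)"
proof -
  let ?q = "real CARD('f)" and ?s = "vec.dim S"
  have q: "1 < ?q" using card_field_ge2[where 'f='f] by simp
  have sy: "vec.subspace y" "vec.dim y = D" using y by (auto simp: grass_verts_def)
  have le: "?s \<le> D" using vec.dim_subset[OF y(2)] sy by simp
  have pos: "qnum ?q (CARD('n) - ?s) > 0" using lt by (intro qnum_pos[OF q]) simp
  have in_S: "real (verts_above D (vec.span (insert v S))) = real (verts_above D S)" if "v \<in> S" for v
    using that S by (simp add: insert_absorb vec.span_eq_iff[THEN iffD2])
  have out_S: "real (verts_above D (vec.span (insert v S)))
      = real (verts_above D S) * qnum ?q (D - ?s) / qnum ?q (CARD('n) - ?s)" if "v \<notin> S" for v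
    using verts_above_ratio[OF S vec.subspace_span _ le, of "insert v S"] dim_insert_subspace[OF S that] pos
    by (simp add: field_simps)
  have card_out: "real (card (y - S)) = ?q ^ D - ?q ^ ?s"
    using y S sy le by (simp add: card_Diff_subset card_subspace of_nat_diff power_increasing)
  have "(\<Sum>v\<in>y. real (verts_above D (vec.span (insert v S))))
      = (\<Sum>v\<in>y - S. real (verts_above D (vec.span (insert v S))))
        + (\<Sum>v\<in>S. real (verts_above D (vec.span (insert v S))))"
    using y by (intro sum.subset_diff) auto
  also have "(\<Sum>v\<in>S. real (verts_above D (vec.span (insert v S)))) = ?q ^ ?s * real (verts_above D S)"
    using in_S by (simp add: card_subspace[OF S])
  also have "(\<Sum>v\<in>y - S. real (verts_above D (vec.span (insert v S))))
      = (?q ^ D - ?q ^ ?s) * (real (verts_above D S) * qnum ?q (D - ?s) / qnum ?q (CARD('n) - ?s))"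
    using out_S card_out by simp
  finally show ?thesis by (simp add: above_ratio_def algebra_simps)
qed

lemma verts_above_eq_sum:
  "real (verts_above D (vec.span A)) = (\<Sum>z\<in>grass_verts D. if A \<subseteq> z then 1 else 0)"
proof -
  have "vec.span A \<subseteq> z \<longleftrightarrow> A \<subseteq> z" if "z \<in> grass_verts D" for z
    using vec.span_minimal[of A z] vec.span_superset[of A] that by (auto simp: grass_verts_def)
  then have "{z \<in> grass_verts D. vec.span A \<subseteq> z} = {z \<in> grass_verts D. A \<subseteq> z}" by auto
  then show ?thesis unfolding verts_above_def by (simp add: sum_indicator_card)
qed

lemma real_card_Int: "real (card (y \<inter> z)) = (\<Sum>v\<in>y. if v \<in> z then 1 else 0)"
  for y z :: "'v::finite set"
  using sum_indicator_card[of y "\<lambda>v. v \<in> z", where 'a=real] by (simp add: Int_def)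

text \<open>Write \<open>|y \<inter> z|\<close> as a sum of indicators over the vectors of
  \<open>y\<close>. Exchanging sums turns its powers into counts of vertices above the span of one
  vector or of two.\<close>

lemma card_Int_moments:
  fixes y :: "('f::{field,finite} ^ 'n) set"
  assumes D: "1 \<le> D" and N: "1 < CARD('n)" and y: "y \<in> grass_verts D"
  defines "r \<equiv> above_ratio (real CARD('f)) CARD('n) D" and "X \<equiv> grass_verts D :: ('f ^ 'n) set set"
  shows "(\<Sum>z\<in>X. real (card (y \<inter> z))) = real (card X) * r 0"
    and "(\<Sum>z\<in>X. real (card (y \<inter> z)) ^ 2)
      = real (card X) * (r 0 + (real CARD('f) ^ D - 1) * (qnum (real CARD('f)) D / qnum (real CARD('f)) CARD('n)) * r 1)"
proof -
  let ?q = "real CARD('f)"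
  have q: "1 < ?q" using card_field_ge2[where 'f='f] by simp
  have sy: "vec.subspace y" "vec.dim y = D" using y by (auto simp: grass_verts_def)
  have zero: "vec.subspace {0::'f ^ 'n}" "vec.dim {0::'f ^ 'n} = 0" "{0} \<subseteq> y"
    using sy by (auto simp: vec.subspace_single_0 vec.subspace_0)
  have v0: "verts_above D {0::'f ^ 'n} = card X"
    unfolding verts_above_def X_def by (rule arg_cong[where f=card]) (auto simp: grass_verts_def vec.subspace_0)
  have span0: "vec.span (insert v {0}) = vec.span {v}" for v :: "'f ^ 'n"
    by (simp add: insert_commute)
  have first: "(\<Sum>v\<in>y. real (verts_above D (vec.span {v}))) = real (card X) * r 0"
    using sum_verts_above_insert[OF zero(1) y zero(3)] N zero(2) unfolding span0 v0 r_def by simp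
  have "(\<Sum>z\<in>X. real (card (y \<inter> z))) = (\<Sum>v\<in>y. real (verts_above D (vec.span {v})))"
    unfolding real_card_Int verts_above_eq_sum X_def by (subst sum.swap) simp
  then show "(\<Sum>z\<in>X. real (card (y \<inter> z))) = real (card X) * r 0"
    using first by simp
  have "(\<Sum>z\<in>X. real (card (y \<inter> z)) ^ 2)
      = (\<Sum>z\<in>X. \<Sum>v\<in>y. \<Sum>v'\<in>y. if {v', v} \<subseteq> z then 1 else 0)"
    unfolding real_card_Int power2_eq_square sum_product by (intro sum.cong refl) simp
  also have "\<dots> = (\<Sum>v\<in>y. \<Sum>v'\<in>y. \<Sum>z\<in>X. if {v', v} \<subseteq> z then 1 else 0)"
    by (subst sum.swap) (intro sum.cong refl sum.swap)
  also have "\<dots> = (\<Sum>v\<in>y. \<Sum>v'\<in>y. real (verts_above D (vec.span (insert v' (vec.span {v})))))"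
  proof (intro sum.cong refl)
    fix v v' :: "'f ^ 'n"
    have "vec.span (insert v' (vec.span {v})) = vec.span {v', v}"
      by (simp only: vec.span_insert[of v'] vec.span_span)
    then show "(\<Sum>z\<in>X. if {v', v} \<subseteq> z then 1 else 0) = real (verts_above D (vec.span (insert v' (vec.span {v}))))"
      unfolding X_def by (simp only: verts_above_eq_sum)
  qed
  also have "\<dots> = (\<Sum>v\<in>y. r (vec.dim {v}) * real (verts_above D (vec.span {v})))"
  proof (intro sum.cong refl)
    fix v assume v: "v \<in> y"
    have "vec.dim {v} \<le> 1" using vec.dim_le_card'[of "{v}"] by simp
    then show "(\<Sum>v'\<in>y. real (verts_above D (vec.span (insert v' (vec.span {v})))))
        = r (vec.dim {v}) * real (verts_above D (vec.span {v}))"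
      using sum_verts_above_insert[OF vec.subspace_span y, of "{v}"] v sy N
      unfolding r_def by (simp add: vec.span_minimal)
  qed
  \<comment> \<open>The zero vector spans dimension 0 and every other vector dimension 1, so
    \<open>r\<close> takes two values here.\<close>
  also have "\<dots> = real (card X) * r 0
      + (\<Sum>v\<in>y - {0}. r (vec.dim {v}) * real (verts_above D (vec.span {v})))"
    using zero v0 by (simp add: sum.remove[of y 0])
  also have "(\<Sum>v\<in>y - {0}. r (vec.dim {v}) * real (verts_above D (vec.span {v})))
      = (\<Sum>v\<in>y - {0}. r 1 * (real (card X) * qnum ?q D / qnum ?q CARD('n)))"
  proof (rule sum.cong[OF refl])
    fix v assume v: "v \<in> y - {0}"
    have d: "vec.dim (vec.span {v}) = 1"
      using dim_insert_subspace[OF zero(1), of v] v zero(2) unfolding span0 by simp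
    have "qnum ?q CARD('n) > 0" by (intro qnum_pos[OF q]) simp
    then have "real (verts_above D (vec.span {v})) = real (card X) * qnum ?q D / qnum ?q CARD('n)"
      using verts_above_ratio[OF zero(1) vec.subspace_span, of "{v}" D] d zero(2) v0 by (simp add: field_simps)
    then show "r (vec.dim {v}) * real (verts_above D (vec.span {v}))
        = r 1 * (real (card X) * qnum ?q D / qnum ?q CARD('n))"
      using d by simp
  qed
  also have "\<dots> = (?q ^ D - 1) * (r 1 * (real (card X) * qnum ?q D / qnum ?q CARD('n)))"
    using zero sy by (simp add: card_Diff_subset card_subspace of_nat_diff)
  finally show "(\<Sum>z\<in>X. real (card (y \<inter> z)) ^ 2)
      = real (card X) * (r 0 + (?q ^ D - 1) * (qnum ?q D / qnum ?q CARD('n)) * r 1)"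
    by (simp add: algebra_simps)
qed

section \<open>The dual eigenvalues: eigenvector property and normalisation\<close>

definition grass_dual_theta :: "real \<Rightarrow> nat \<Rightarrow> nat \<Rightarrow> nat \<Rightarrow> real" where
  "grass_dual_theta q N D i =
     (q ^ N - q) * (2 - q ^ D - q ^ (N - D)) / ((q - 1) * (q ^ D - 1) * (q ^ (N - D) - 1))
     + (q ^ N - q) * (q ^ N - 1) / ((q - 1) * (q ^ D - 1) * (q ^ (N - D) - 1)) / q ^ i"

text \<open>Here \<open>x\<close>, \<open>d\<close>, \<open>e\<close> stand for \<open>Q^i\<close>,
  \<open>Q^D\<close>, \<open>Q^(N - D)\<close>. For the ansatz \<open>\<alpha> + \<beta> / x\<close>
  the two sides differ by a multiple of
  \<open>\<alpha> * (d * e - 1) - \<beta> * (2 - d - e)\<close> that does not involve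
  \<open>x\<close>, which explains the ratio of the two constants in
  \<open>\<theta>*_i\<close>.\<close>

lemma adj_radial_identity:
  fixes Q x d e \<alpha> \<beta> :: complex
  assumes "Q \<noteq> 1" "Q \<noteq> 0" "x \<noteq> 0" and ab: "\<alpha> * (d * e - 1) = \<beta> * (2 - d - e)"
  shows "(x - 1) / (Q - 1) * ((x - 1) / (Q - 1) * (\<alpha> + \<beta> * Q / x)
        + ((e * Q - 1) / (Q - 1) - (x - 1) / (Q - 1)) * (\<alpha> + \<beta> / x))
      + ((d - 1) / (Q - 1) - (x - 1) / (Q - 1)) * ((Q * x - 1) / (Q - 1) * (\<alpha> + \<beta> / x)
        + ((e * Q - 1) / (Q - 1) - (Q * x - 1) / (Q - 1)) * (\<alpha> + \<beta> / (Q * x)))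
      - (d - 1) / (Q - 1) * (\<alpha> + \<beta> / x)
    = (Q\<^sup>2 * ((d / Q - 1) / (Q - 1)) * ((e / Q - 1) / (Q - 1)) - 1) * (\<alpha> + \<beta> / x)"
    (is "?L = ?R")
proof -
  \<comment> \<open>With \<open>p\<close> for \<open>1 / (Q - 1)\<close>, and \<open>\<beta>\<close>
    replaced by \<open>b * Q * x\<close>, everything becomes a polynomial; factors
    \<open>p * (Q - 1) = 1\<close> then bring every term to degree two in \<open>p\<close>.\<close>
  define p b where "p = inverse (Q - 1)" and "b = \<beta> / (Q * x)"
  have p: "p * (Q - 1) = 1" using assms by (simp add: p_def)
  have b: "\<beta> = b * (Q * x)" using assms by (simp add: b_def)
  have div: "y / (Q - 1) = y * p" for y by (simp add: p_def divide_inverse)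
  have s: "\<beta> * Q / x = b * Q\<^sup>2" "\<beta> / x = b * Q" "\<beta> / (Q * x) = b"
    using assms by (simp_all add: b power2_eq_square)
  have R: "Q\<^sup>2 * ((d / Q - 1) * p) * ((e / Q - 1) * p) = (d - Q) * (e - Q) * p\<^sup>2"
    using assms by (simp add: field_simps power2_eq_square)
  have "?L - ?R = p * (\<alpha> * (d * e - 1) - b * Q * x * (2 - d - e))"
  proof -
    have p2: "p\<^sup>2 * (Q - 1) = p" "p\<^sup>2 * (Q - 1)\<^sup>2 = 1"
      using p by (simp_all only: power2_eq_square mult.assoc mult_1_right) (simp add: mult.left_commute[of p])
    have t: "(d - 1) * p = p\<^sup>2 * ((Q - 1) * (d - 1))"
      "(d - Q) * (e - Q) * p\<^sup>2 - 1 = p\<^sup>2 * ((d - Q) * (e - Q) - (Q - 1)\<^sup>2)"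
    proof -
      have "p\<^sup>2 * ((Q - 1) * (d - 1)) = p\<^sup>2 * (Q - 1) * (d - 1)" by (rule mult.assoc[symmetric])
      then show "(d - 1) * p = p\<^sup>2 * ((Q - 1) * (d - 1))" unfolding p2 by (simp only: mult.commute)
      show "(d - Q) * (e - Q) * p\<^sup>2 - 1 = p\<^sup>2 * ((d - Q) * (e - Q) - (Q - 1)\<^sup>2)"
        unfolding right_diff_distrib[of "p\<^sup>2"] p2 by (simp only: mult.commute)
    qed
    define Y Z where "Y = \<alpha> + b * Q"
      and "Z = (x - 1) * p * ((x - 1) * p * (\<alpha> + b * Q\<^sup>2) + ((e * Q - 1) * p - (x - 1) * p) * (\<alpha> + b * Q))
        + ((d - 1) * p - (x - 1) * p)
          * ((Q * x - 1) * p * (\<alpha> + b * Q) + ((e * Q - 1) * p - (Q * x - 1) * p) * (\<alpha> + b))"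
    have Z: "Z = p\<^sup>2 * ((x - 1) * ((x - 1) * (\<alpha> + b * Q\<^sup>2) + ((e * Q - 1) - (x - 1)) * (\<alpha> + b * Q))
        + (d - x) * ((Q * x - 1) * (\<alpha> + b * Q) + ((e * Q - 1) - (Q * x - 1)) * (\<alpha> + b)))"
      unfolding Z_def by (simp add: algebra_simps power2_eq_square)
    have "?L - ?R = Z - (d - 1) * p * Y - ((d - Q) * (e - Q) * p\<^sup>2 - 1) * Y"
      unfolding div s R Z_def Y_def ..
    also have "\<dots> = p\<^sup>2 * ((x - 1) * ((x - 1) * (\<alpha> + b * Q\<^sup>2) + ((e * Q - 1) - (x - 1)) * (\<alpha> + b * Q))
        + (d - x) * ((Q * x - 1) * (\<alpha> + b * Q) + ((e * Q - 1) - (Q * x - 1)) * (\<alpha> + b))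
        - (Q - 1) * (d - 1) * (\<alpha> + b * Q) - ((d - Q) * (e - Q) - (Q - 1)\<^sup>2) * (\<alpha> + b * Q))"
      unfolding t Z Y_def[symmetric] by (simp add: algebra_simps)
    also have "\<dots> = p\<^sup>2 * ((Q - 1) * (\<alpha> * (d * e - 1) - b * Q * x * (2 - d - e)))"
      by (simp add: algebra_simps power2_eq_square)
    also have "\<dots> = p * (\<alpha> * (d * e - 1) - b * Q * x * (2 - d - e))"
      unfolding mult.assoc[symmetric, of "p\<^sup>2"] p2 ..
    finally show ?thesis .
  qed
  also have "\<dots> = 0" using ab b by (simp add: mult.assoc)
  finally show ?thesis by simp
qed

lemma adj_radial_dual_theta:
  fixes q :: real
  assumes q: "1 < q" and D: "1 \<le> D" "D < N"
  shows "adj_radial (\<lambda>m. complex_of_real (qnum q m)) D (N - D + 1) (\<lambda>i. complex_of_real (grass_dual_theta q N D i)) i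
    = complex_of_real (grass_theta q N D 1) * complex_of_real (grass_dual_theta q N D i)"
proof -
  define Q where "Q = complex_of_real q"
  define F where "F = (Q ^ N - Q) / ((Q - 1) * (Q ^ D - 1) * (Q ^ (N - D) - 1))"
  have Q: "Q \<noteq> 0" "Q \<noteq> 1" using q by (auto simp: Q_def)
  let ?B = "\<lambda>m. complex_of_real (qnum q m)"
  have B: "?B m = (Q ^ m - 1) / (Q - 1)" for m by (simp add: qnum_def Q_def)
  define \<alpha> \<beta> where "\<alpha> = F * (2 - Q ^ D - Q ^ (N - D))" and "\<beta> = F * (Q ^ N - 1)"
  have th: "complex_of_real (grass_dual_theta q N D j) = \<alpha> + \<beta> / Q ^ j" for j
    by (simp add: grass_dual_theta_def F_def \<alpha>_def \<beta>_def Q_def)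
  \<comment> \<open>At \<open>i = 0\<close> the truncated index is wrong, but
    \<open>?B 0 = 0\<close> absorbs it.\<close>
  have pred: "?B i * (\<alpha> + \<beta> / Q ^ (i - 1)) = ?B i * (\<alpha> + \<beta> * Q / Q ^ i)"
    using Q by (cases i) (simp_all add: B)
  have N: "Q ^ N = Q ^ D * Q ^ (N - D)" using D by (simp flip: power_add)
  have ab: "\<alpha> * (Q ^ D * Q ^ (N - D) - 1) = \<beta> * (2 - Q ^ D - Q ^ (N - D))"
    by (simp add: \<alpha>_def \<beta>_def N)
  have D1: "Q ^ (D - 1) = Q ^ D / Q" using D Q by (simp add: power_diff)
  have e1: "Q ^ (N - D - 1) = Q ^ (N - D) / Q" using D Q by (subst power_diff) auto
  have "adj_radial ?B D (N - D + 1) (\<lambda>j. \<alpha> + \<beta> / Q ^ j) i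
    = ?B i * (?B i * (\<alpha> + \<beta> * Q / Q ^ i) + (?B (N - D + 1) - ?B i) * (\<alpha> + \<beta> / Q ^ i))
     + (?B D - ?B i) * (?B (i + 1) * (\<alpha> + \<beta> / Q ^ i) + (?B (N - D + 1) - ?B (i + 1)) * (\<alpha> + \<beta> / Q ^ (i + 1)))
     - ?B D * (\<alpha> + \<beta> / Q ^ i)"
    unfolding adj_radial_def pred ..
  also have "\<dots> = (Q\<^sup>2 * ((Q ^ D / Q - 1) / (Q - 1)) * ((Q ^ (N - D) / Q - 1) / (Q - 1)) - 1) * (\<alpha> + \<beta> / Q ^ i)"
    unfolding B using adj_radial_identity[OF Q(2,1) _ ab, of "Q ^ i"] Q by (simp add: mult.commute)
  also have "Q\<^sup>2 * ((Q ^ D / Q - 1) / (Q - 1)) * ((Q ^ (N - D) / Q - 1) / (Q - 1)) - 1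
      = complex_of_real (grass_theta q N D 1)"
    unfolding grass_theta_def of_real_diff of_real_mult B D1 e1 using Q by (simp add: Q_def power2_eq_square)
  finally show ?thesis by (simp only: th)
qed

text \<open>Here \<open>d\<close> and \<open>e\<close> are \<open>q^D\<close> and
  \<open>q^(N - D)\<close>; \<open>r0\<close> is the mean of \<open>|y \<inter> z|\<close>, and the
  factor of the last square is its mean square. The identity says that \<open>\<theta>*_i\<close>
  has mean square \<open>\<theta>*_0\<close>, which is the diagonal of \<open>E_1 E_1 = E_1\<close>
  up to scaling.\<close>

lemma dual_theta_moment_identity:
  fixes Q d e :: real
  assumes "1 < Q" "Q \<le> d" "Q \<le> e"
  defines "n \<equiv> d * e" and "F \<equiv> (d * e - Q) / ((Q - 1) * (d - 1) * (e - 1))"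
  defines "r0 \<equiv> 1 + (d - 1) * ((d - 1) / (n - 1))" and "r1 \<equiv> Q + (d - Q) * ((d - Q) / (n - Q))"
  shows "(F * (2 - d - e))\<^sup>2 + 2 * (F * (2 - d - e)) * (F * (n - 1) / d) * r0
      + (F * (n - 1) / d)\<^sup>2 * (r0 + (d - 1) * ((d - 1) / (n - 1)) * r1)
    = F * (2 - d - e) + F * (n - 1)"
proof -
  have d: "d > 1" "e > 1" using assms(1-3) by linarith+
  have "d < n" using d by (simp add: n_def)
  then have n: "n > Q" "n > 1" using assms(1-3) by linarith+
  define g where "g = (d - 1) / (n - 1)"
  define h where "h = (d - Q) / (n - Q)"
  have g: "g * (n - 1) = d - 1" and h: "h * (n - Q) = d - Q"
    using n by (simp_all add: g_def h_def)
  have r0: "r0 * (n - 1) = d * (e + d - 2)"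
  proof -
    have "r0 * (n - 1) = (n - 1) + (d - 1) * (g * (n - 1))"
      unfolding r0_def g_def[symmetric] by (simp add: algebra_simps)
    then show ?thesis unfolding g by (simp add: n_def algebra_simps)
  qed
  have r1: "r1 * (n - Q) = d * (Q * e + d - 2 * Q)"
  proof -
    have "r1 * (n - Q) = Q * (n - Q) + (d - Q) * (h * (n - Q))"
      unfolding r1_def h_def[symmetric] by (simp add: algebra_simps)
    then show ?thesis unfolding h by (simp add: n_def algebra_simps)
  qed
  have F: "F * ((Q - 1) * (d - 1) * (e - 1)) = n - Q"
    using assms(1) d n by (simp add: F_def flip: n_def)
  define c where "c = inverse d"
  have c: "c * d = 1" using d by (simp add: c_def)
  have "(n - Q) * ((2 - d - e)\<^sup>2 + 2 * (2 - d - e) * ((n - 1) * c) * r0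
      + ((n - 1) * c)\<^sup>2 * (r0 + (d - 1) * g * r1)) = (Q - 1) * (d - 1)\<^sup>2 * (e - 1)\<^sup>2"
  proof -
    \<comment> \<open>\<open>K\<close> is the cofactor of \<open>d\<close> in the bracket that
      remains after substituting \<open>r0\<close>, \<open>r1\<close> and \<open>g\<close>; the
      extracted \<open>d\<close> uses up the remaining inverse \<open>c\<close>.\<close>
    define K where "K = e * (e + d - 2) - Q + (d - 2) * (Q * e + d - 2 * Q) + 1"
    have "(n - Q) * ((2 - d - e)\<^sup>2 + 2 * (2 - d - e) * ((n - 1) * c) * r0
        + ((n - 1) * c)\<^sup>2 * (r0 + (d - 1) * g * r1))
      = (n - Q) * (2 - d - e)\<^sup>2 + (n - Q) * (2 * (2 - d - e) * c * (r0 * (n - 1)))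
        + (n - 1) * c\<^sup>2 * ((n - Q) * (r0 * (n - 1)) + (d - 1) * (g * (n - 1)) * (r1 * (n - Q)))"
      by (simp add: algebra_simps power2_eq_square)
    also have "\<dots> = (n - Q) * (2 - d - e)\<^sup>2 + (n - Q) * (2 * (2 - d - e) * (c * d) * (e + d - 2))
        + (n - 1) * c * (c * d) * ((n - Q) * (e + d - 2) + (d - 1) * (d - 1) * (Q * e + d - 2 * Q))"
      unfolding r0 r1 g by (simp add: algebra_simps power2_eq_square)
    also have "(n - Q) * (e + d - 2) + (d - 1) * (d - 1) * (Q * e + d - 2 * Q) = d * K"
      unfolding K_def n_def by (simp add: algebra_simps)
    also have "(n - 1) * c * (c * d) * (d * K) = (n - 1) * (c * d) * (c * d) * K"
      by (simp only: mult_ac)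
    finally show ?thesis unfolding c K_def n_def by (simp add: algebra_simps power2_eq_square)
  qed
  then have "F * ((Q - 1) * (d - 1) * (e - 1)) * ((2 - d - e)\<^sup>2 + 2 * (2 - d - e) * ((n - 1) * c) * r0
      + ((n - 1) * c)\<^sup>2 * (r0 + (d - 1) * g * r1)) = ((Q - 1) * (d - 1) * (e - 1)) * ((d - 1) * (e - 1))"
    unfolding F by (simp add: power2_eq_square mult_ac)
  then have "((Q - 1) * (d - 1) * (e - 1)) * (F * ((2 - d - e)\<^sup>2 + 2 * (2 - d - e) * ((n - 1) * c) * r0
      + ((n - 1) * c)\<^sup>2 * (r0 + (d - 1) * g * r1))) = ((Q - 1) * (d - 1) * (e - 1)) * ((d - 1) * (e - 1))"
    by (simp only: mult_ac)
  then have "F * ((2 - d - e)\<^sup>2 + 2 * (2 - d - e) * ((n - 1) * c) * r0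
      + ((n - 1) * c)\<^sup>2 * (r0 + (d - 1) * g * r1)) = (d - 1) * (e - 1)"
    using assms(1) d by (subst (asm) mult_cancel_left) auto
  then have "F * (F * ((2 - d - e)\<^sup>2 + 2 * (2 - d - e) * ((n - 1) * c) * r0
      + ((n - 1) * c)\<^sup>2 * (r0 + (d - 1) * g * r1))) = F * ((d - 1) * (e - 1))" by simp
  moreover have "(F * (2 - d - e))\<^sup>2 + 2 * (F * (2 - d - e)) * (F * (n - 1) / d) * r0
      + (F * (n - 1) / d)\<^sup>2 * (r0 + (d - 1) * g * r1)
    = F * (F * ((2 - d - e)\<^sup>2 + 2 * (2 - d - e) * ((n - 1) * c) * r0
      + ((n - 1) * c)\<^sup>2 * (r0 + (d - 1) * g * r1)))"
    unfolding divide_inverse[of _ d] c_def[symmetric] by (simp add: power2_eq_square algebra_simps)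
  moreover have "F * ((d - 1) * (e - 1)) = F * (2 - d - e) + F * (n - 1)"
    by (simp add: n_def algebra_simps)
  ultimately show ?thesis unfolding g_def[symmetric] by simp
qed

text \<open>The value is \<open>(q^N - q) / (q - 1)\<close>, the rank of \<open>E_1\<close>. Being
  nonzero, it can be cancelled when the kernel is applied to its own column.\<close>

lemma grass_dual_theta_0:
  assumes "1 < q" "D < N" "1 \<le> D" "2 \<le> N"
  shows "grass_dual_theta q N D 0 > 0"
proof -
  have N: "q ^ N = q ^ D * q ^ (N - D)" using assms by (simp flip: power_add)
  have "grass_dual_theta q N D 0
      = (q ^ N - q) * ((q ^ D - 1) * (q ^ (N - D) - 1)) / ((q - 1) * (q ^ D - 1) * (q ^ (N - D) - 1))"
    unfolding grass_dual_theta_def by (simp add: N algebra_simps flip: add_divide_distrib)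
  moreover have "q ^ D > 1" "q ^ (N - D) > 1" "q ^ N > q ^ 1"
    using assms by (auto simp only: intro!: one_less_power power_strict_increasing)
  ultimately show ?thesis using assms(1) by simp
qed

lemma real_card_Int_dist:
  fixes y z :: "('f::{field,finite} ^ 'n) set"
  assumes "1 \<le> D" "y \<in> grass_verts D" "z \<in> grass_verts D"
  shows "real (card (y \<inter> z)) = real CARD('f) ^ D / real CARD('f) ^ grass_dist D y z"
proof -
  have s: "vec.subspace (y \<inter> z)" "vec.dim (y \<inter> z) \<le> D"
    using assms vec.dim_subset[of "y \<inter> z" y] by (auto simp: grass_verts_def vec.subspace_inter)
  have "grass_dist D y z = D - vec.dim (y \<inter> z)" by (rule grass_dist_eq[OF assms])
  then have "D = vec.dim (y \<inter> z) + grass_dist D y z" using s by simp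
  then have "real CARD('f) ^ D = real CARD('f) ^ vec.dim (y \<inter> z) * real CARD('f) ^ grass_dist D y z"
    by (metis power_add)
  then show ?thesis using card_subspace[OF s(1)] by (simp add: field_simps)
qed

lemma sum_dual_theta_square:
  fixes y :: "('f::{field,finite} ^ 'n) set"
  assumes D: "1 \<le> D" "D < CARD('n)" "2 \<le> CARD('n)" and y: "y \<in> grass_verts D"
  defines "\<theta> \<equiv> grass_dual_theta (real CARD('f)) CARD('n) D"
  shows "(\<Sum>z\<in>grass_verts D. \<theta> (grass_dist D y z) ^ 2) = real (card (grass_verts D :: ('f ^ 'n) set set)) * \<theta> 0"
proof -
  define q d e n where "q = real CARD('f)" and "d = q ^ D" and "e = q ^ (CARD('n) - D)" and "n = d * e"
  define F where "F = (n - q) / ((q - 1) * (d - 1) * (e - 1))"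
  define X :: "('f ^ 'n) set set" where "X = grass_verts D"
  have q: "1 < q" using card_field_ge2[where 'f='f] by (simp add: q_def)
  have n: "q ^ CARD('n) = n" using D by (simp add: n_def d_def e_def flip: power_add)
  have de: "q \<le> d" "q \<le> e"
    using power_increasing[of 1 D q] power_increasing[of 1 "CARD('n) - D" q] q D by (simp_all add: d_def e_def)
  have th: "\<theta> i = F * (2 - d - e) + F * (n - 1) / q ^ i" for i
    unfolding \<theta>_def grass_dual_theta_def q_def[symmetric] n d_def[symmetric] e_def[symmetric] F_def by simp
  have "d > 0" using q by (simp add: d_def)
  then have val: "\<theta> (grass_dist D y z) = F * (2 - d - e) + F * (n - 1) / d * real (card (y \<inter> z))" if "z \<in> X" for z
    using real_card_Int_dist[OF D(1) y, of z] that q unfolding th X_def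
    by (simp add: d_def flip: q_def)
  have sq: "(\<alpha> + \<beta> * c)\<^sup>2 = \<alpha>\<^sup>2 + 2 * \<alpha> * \<beta> * c + \<beta>\<^sup>2 * c\<^sup>2" for \<alpha> \<beta> c :: real
    by (simp add: power2_eq_square algebra_simps)
  have "(\<Sum>z\<in>X. \<theta> (grass_dist D y z) ^ 2)
      = (\<Sum>z\<in>X. (F * (2 - d - e))\<^sup>2 + 2 * (F * (2 - d - e)) * (F * (n - 1) / d) * real (card (y \<inter> z))
          + (F * (n - 1) / d)\<^sup>2 * real (card (y \<inter> z)) ^ 2)"
    by (intro sum.cong refl) (simp only: val sq)
  also have "\<dots> = real (card X) * (F * (2 - d - e))\<^sup>2
      + 2 * (F * (2 - d - e)) * (F * (n - 1) / d) * (\<Sum>z\<in>X. real (card (y \<inter> z)))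
      + (F * (n - 1) / d)\<^sup>2 * (\<Sum>z\<in>X. real (card (y \<inter> z)) ^ 2)"
    by (simp add: sum.distrib sum_distrib_left)
  also have "(\<Sum>z\<in>X. real (card (y \<inter> z))) = real (card X) * (1 + (d - 1) * ((d - 1) / (n - 1)))"
  proof -
    have "above_ratio q CARD('n) D 0 = 1 + (d - 1) * ((d - 1) / (n - 1))"
      using q by (simp add: above_ratio_def qnum_def n flip: d_def)
    then show ?thesis
      using card_Int_moments(1)[OF D(1) _ y] D(3) unfolding X_def q_def by simp
  qed
  also have "(\<Sum>z\<in>X. real (card (y \<inter> z)) ^ 2) = real (card X) * (1 + (d - 1) * ((d - 1) / (n - 1))
      + (d - 1) * ((d - 1) / (n - 1)) * (q + (d - q) * ((d - q) / (n - q))))"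
  proof -
    have 0: "above_ratio q CARD('n) D 0 = 1 + (d - 1) * ((d - 1) / (n - 1))"
      using q by (simp add: above_ratio_def qnum_def n flip: d_def)
    have pD: "q * q ^ (D - 1) = d" using D by (simp add: d_def flip: power_Suc)
    have pN: "q * q ^ (CARD('n) - 1) = n" unfolding n[symmetric] by (simp flip: power_Suc)
    have "(d - q) / (n - q) = (q * (q ^ (D - 1) - 1)) / (q * (q ^ (CARD('n) - 1) - 1))"
      by (simp only: right_diff_distrib pD pN mult_1_right)
    also have "\<dots> = qnum q (D - 1) / qnum q (CARD('n) - 1)"
      using q by (simp add: qnum_def)
    finally have 1: "above_ratio q CARD('n) D 1 = q + (d - q) * ((d - q) / (n - q))"
      by (simp add: above_ratio_def flip: d_def)
    have 2: "qnum q D / qnum q CARD('n) = (d - 1) / (n - 1)"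
      using q by (simp add: qnum_def n flip: d_def)
    show ?thesis
      using card_Int_moments(2)[OF D(1) _ y] D(3)
      unfolding X_def q_def[symmetric] 0 1 2 d_def[symmetric] by simp
  qed
  also have "real (card X) * (F * (2 - d - e))\<^sup>2
      + 2 * (F * (2 - d - e)) * (F * (n - 1) / d) * (real (card X) * (1 + (d - 1) * ((d - 1) / (n - 1))))
      + (F * (n - 1) / d)\<^sup>2 * (real (card X) * (1 + (d - 1) * ((d - 1) / (n - 1))
      + (d - 1) * ((d - 1) / (n - 1)) * (q + (d - q) * ((d - q) / (n - q)))))
    = real (card X) * ((F * (2 - d - e))\<^sup>2
      + 2 * (F * (2 - d - e)) * (F * (n - 1) / d) * (1 + (d - 1) * ((d - 1) / (n - 1)))
      + (F * (n - 1) / d)\<^sup>2 * (1 + (d - 1) * ((d - 1) / (n - 1))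
      + (d - 1) * ((d - 1) / (n - 1)) * (q + (d - q) * ((d - q) / (n - q)))))"
    by (simp only: distrib_left mult_ac)
  also have "\<dots> = real (card X) * (F * (2 - d - e) + F * (n - 1))"
    using dual_theta_moment_identity[OF q de] unfolding F_def n_def by simp
  finally show ?thesis unfolding th X_def by simp
qed

section \<open>The kernel as an orthogonal projection\<close>

lemma adj_matrix_mult_nth:
  "(adj_matrix D *v v) $ y = (\<Sum>z | grass_adj D y z. v $ z)"
  by (simp add: adj_matrix_def matrix_vector_mult_def if_distrib[of "\<lambda>c. c * _"] sum.If_cases Int_def cong: if_cong)

lemma mem_grass_eigenspace_iff:
  fixes v :: "complex ^ ('f::{field,finite} ^ 'n) set"
  shows "v \<in> grass_eigenspace D i \<longleftrightarrow> (\<forall>y. y \<notin> grass_verts D \<longrightarrow> v $ y = 0)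
    \<and> adj_eigenfun D (complex_of_real (grass_theta (real CARD('f)) CARD('n) D i)) (($) v)"
proof -
  have "(\<Sum>z | grass_adj D y z. v $ z) = 0" if "y \<notin> grass_verts D" for y
  proof -
    have "{z. grass_adj D y z} = {}" using that by (auto simp: grass_adj_def)
    then show ?thesis by simp
  qed
  then show ?thesis
    unfolding grass_eigenspace_def adj_eigenfun_def mem_Collect_eq vec_eq_iff adj_matrix_mult_nth
    by auto
qed

text \<open>The description determines the matrix: for two candidates the difference of the images
  of \<open>v\<close> lies in \<open>S\<close> and is orthogonal to all of \<open>S\<close>, hence
  to itself.\<close>

lemma orth_proj_eqI:
  fixes S :: "(complex ^ 'v::finite) set"
  assumes diff: "\<And>v w. v \<in> S \<Longrightarrow> w \<in> S \<Longrightarrow> v - w \<in> S"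
    and mem: "\<And>v. P *v v \<in> S"
    and orth: "\<And>v w. w \<in> S \<Longrightarrow> hermitian_inner (v - P *v v) w = 0"
  shows "orth_proj S = P"
  unfolding orth_proj_def
proof (rule the_equality)
  show "\<forall>v. P *v v \<in> S \<and> (\<forall>w\<in>S. hermitian_inner (v - P *v v) w = 0)"
    using mem orth by blast
next
  fix R assume R: "\<forall>v. R *v v \<in> S \<and> (\<forall>w\<in>S. hermitian_inner (v - R *v v) w = 0)"
  have "R *v v = P *v v" for v
  proof -
    define w where "w = R *v v - P *v v"
    have w: "w \<in> S" using R mem diff by (simp add: w_def)
    have "hermitian_inner w w = hermitian_inner (v - P *v v) w - hermitian_inner (v - R *v v) w"
      unfolding hermitian_inner_def w_def by (simp add: algebra_simps flip: sum_subtractf)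
    also have "\<dots> = 0" using R orth w by simp
    finally have "(\<Sum>y\<in>UNIV. complex_of_real ((norm (w $ y))\<^sup>2)) = 0"
      by (simp only: complex_norm_square hermitian_inner_def)
    then have "complex_of_real (\<Sum>y\<in>UNIV. (norm (w $ y))\<^sup>2) = 0" by simp
    then have "(\<Sum>y\<in>UNIV. (norm (w $ y))\<^sup>2) = 0" by (simp only: of_real_eq_0_iff)
    then have "\<forall>y. w $ y = 0" by (subst (asm) sum_nonneg_eq_0_iff) auto
    then show ?thesis by (simp add: w_def vec_eq_iff)
  qed
  then show "R = P" by (simp add: matrix_eq)
qed

lemma adj_eigenfun_dual_theta:
  fixes y :: "('f::{field,finite} ^ 'n) set"
  assumes D: "1 \<le> D" "D < CARD('n)" and y: "y \<in> grass_verts D"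
  shows "adj_eigenfun D (complex_of_real (grass_theta (real CARD('f)) CARD('n) D 1))
    (\<lambda>z. complex_of_real (grass_dual_theta (real CARD('f)) CARD('n) D (grass_dist D y z)))"
proof -
  have "1 < real CARD('f)" using card_field_ge2[where 'f='f] by simp
  note L = adj_radial_dual_theta[OF this D]
  show ?thesis
    unfolding adj_eigenfun_def
    using sum_neighbours_dist[OF D(1) _ y, of _ "\<lambda>i. complex_of_real (grass_dual_theta (real CARD('f)) CARD('n) D i)"] D L
    by simp
qed

text \<open>The kernel acts on the eigenspace as a scalar. Its column at \<open>y\<close> is an
  eigenfunction with value \<open>\<theta>*_0\<close> at \<open>y\<close>, and applying the kernel
  to it gives the sum of squares \<open>|X| \<theta>*_0\<close> there; so the scalar is
  \<open>|X|\<close>.\<close>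

lemma dual_theta_kernel_id:
  fixes y :: "('f::{field,finite} ^ 'n) set"
  assumes D: "1 \<le> D" "D < CARD('n)" "2 \<le> CARD('n)" and y: "y \<in> grass_verts D"
    and w: "adj_eigenfun D (complex_of_real (grass_theta (real CARD('f)) CARD('n) D 1)) w"
  shows "(\<Sum>z\<in>grass_verts D. complex_of_real (grass_dual_theta (real CARD('f)) CARD('n) D (grass_dist D y z)) * w z)
    = of_nat (card (grass_verts D :: ('f ^ 'n) set set)) * w y"
proof -
  let ?\<theta> = "grass_dual_theta (real CARD('f)) CARD('n) D"
  have q: "1 < real CARD('f)" using card_field_ge2[where 'f='f] by simp
  have d0: "grass_dist D y y = 0" using y D by (simp add: grass_dist_eq grass_verts_def)
  have nz: "complex_of_real (?\<theta> 0) \<noteq> 0"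
    using grass_dual_theta_0[OF q D(2,1,3)] by simp
  have sq: "(\<Sum>z\<in>grass_verts D. complex_of_real (?\<theta> (grass_dist D y z)) * complex_of_real (?\<theta> (grass_dist D y z)))
      = of_nat (card (grass_verts D :: ('f ^ 'n) set set)) * complex_of_real (?\<theta> 0)"
    using arg_cong[OF sum_dual_theta_square[OF D y], of complex_of_real] by (simp add: power2_eq_square)
  have "(\<Sum>z\<in>grass_verts D. complex_of_real (?\<theta> (grass_dist D y z)) * w z) * complex_of_real (?\<theta> 0)
      = w y * (of_nat (card (grass_verts D :: ('f ^ 'n) set set)) * complex_of_real (?\<theta> 0))"
    using radial_kernel_scalar[OF D(1) _ w adj_eigenfun_dual_theta[OF D(1,2) y] y y,
        of "\<lambda>i. complex_of_real (?\<theta> i)"] D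
    unfolding sq d0 by simp
  then show ?thesis using nz by simp
qed

text \<open>The candidate \<open>P\<close> has eigenfunctions as columns, so its image lies in the
  eigenspace; it is real and symmetric and fixes the eigenspace, so \<open>v - P *v v\<close> is
  orthogonal to it.\<close>

lemma grass_E_1_nth:
  fixes y z :: "('f::{field,finite} ^ 'n) set"
  assumes D: "1 \<le> D" "D < CARD('n)" "2 \<le> CARD('n)" and y: "y \<in> grass_verts D" and z: "z \<in> grass_verts D"
  shows "of_nat (card (grass_verts D :: ('f ^ 'n) set set)) * grass_E D 1 $ y $ z
    = complex_of_real (grass_dual_theta (real CARD('f)) CARD('n) D (grass_dist D y z))"
proof -
  let ?\<theta> = "\<lambda>i. complex_of_real (grass_dual_theta (real CARD('f)) CARD('n) D i)"
  let ?S = "grass_eigenspace D 1 :: (complex ^ ('f ^ 'n) set) set"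
  define X :: "('f ^ 'n) set set" where "X = grass_verts D"
  define m :: complex where "m = of_nat (card X)"
  have m: "m \<noteq> 0" using y by (auto simp: m_def X_def)
  define P :: "complex ^ ('f ^ 'n) set ^ ('f ^ 'n) set" where
    "P = (\<chi> y z. if y \<in> X \<and> z \<in> X then ?\<theta> (grass_dist D y z) / m else 0)"
  have Pv: "(P *v v) $ y = (if y \<in> X then (\<Sum>z\<in>X. ?\<theta> (grass_dist D y z) * v $ z) / m else 0)" for v y
    unfolding P_def matrix_vector_mult_def
    by (auto simp: sum_divide_distrib if_distrib[of "\<lambda>c. c * _"] sum.If_cases Int_def cong: if_cong)
  have "grass_E D 1 = P"
    unfolding grass_E_def
  proof (rule orth_proj_eqI)
    show "v - w \<in> ?S" if "v \<in> ?S" "w \<in> ?S" for v w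
      using that unfolding mem_grass_eigenspace_iff adj_eigenfun_def
      by (simp add: sum_subtractf right_diff_distrib)
    show "P *v v \<in> ?S" for v
      unfolding mem_grass_eigenspace_iff
    proof
      show "\<forall>y. y \<notin> grass_verts D \<longrightarrow> (P *v v) $ y = 0" by (simp add: Pv X_def)
      let ?t = "complex_of_real (grass_theta (real CARD('f)) CARD('n) D 1)"
      show "adj_eigenfun D ?t (($) (P *v v))"
        unfolding adj_eigenfun_def
      proof
        fix z :: "('f ^ 'n) set" assume z: "z \<in> grass_verts D"
        have "(\<Sum>z' | grass_adj D z z'. (P *v v) $ z')
            = (\<Sum>z' | grass_adj D z z'. \<Sum>u\<in>X. ?\<theta> (grass_dist D u z') * v $ u / m)"
          by (intro sum.cong refl)
             (auto simp: Pv X_def grass_adj_def sum_divide_distrib grass_dist_commute[OF D(1)])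
        also have "\<dots> = (\<Sum>u\<in>X. (\<Sum>z' | grass_adj D z z'. ?\<theta> (grass_dist D u z')) * v $ u / m)"
          by (subst sum.swap) (simp add: sum_distrib_right sum_divide_distrib)
        also have "\<dots> = (\<Sum>u\<in>X. ?t * ?\<theta> (grass_dist D u z) * v $ u / m)"
        proof (rule sum.cong[OF refl])
          fix u assume "u \<in> X"
          then have "(\<Sum>z' | grass_adj D z z'. ?\<theta> (grass_dist D u z')) = ?t * ?\<theta> (grass_dist D u z)"
            using adj_eigenfun_dual_theta[OF D(1,2), of u] z by (simp add: X_def adj_eigenfun_def)
          then show "(\<Sum>z' | grass_adj D z z'. ?\<theta> (grass_dist D u z')) * v $ u / m
              = ?t * ?\<theta> (grass_dist D u z) * v $ u / m" by simp
        qed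
        also have "\<dots> = ?t * (P *v v) $ z"
          using z by (simp add: Pv X_def sum_distrib_left sum_divide_distrib grass_dist_commute[OF D(1)] mult.assoc)
        finally show "(\<Sum>z' | grass_adj D z z'. (P *v v) $ z') = ?t * (P *v v) $ z" .
      qed
    qed
    show "hermitian_inner (v - P *v v) w = 0" if w: "w \<in> ?S" for v w
    proof -
      have ker: "(\<Sum>z\<in>X. ?\<theta> (grass_dist D y z) * w $ z) = m * w $ y" if "y \<in> X" for y
        using dual_theta_kernel_id[OF D, of y "($) w"] that w
        unfolding mem_grass_eigenspace_iff X_def m_def by blast
      have off: "w $ y = 0" if "y \<notin> X" for y
        using w that by (simp add: mem_grass_eigenspace_iff X_def)
      have sumX: "(\<Sum>y\<in>UNIV. f y * cnj (w $ y)) = (\<Sum>y\<in>X. f y * cnj (w $ y))" for f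
        by (rule sum.mono_neutral_right) (auto simp: off)
      have "hermitian_inner (P *v v) w = (\<Sum>y\<in>X. \<Sum>z\<in>X. ?\<theta> (grass_dist D y z) * v $ z / m * cnj (w $ y))"
        unfolding hermitian_inner_def sumX by (simp add: Pv sum_divide_distrib sum_distrib_right)
      also have "\<dots> = (\<Sum>z\<in>X. \<Sum>y\<in>X. ?\<theta> (grass_dist D y z) * v $ z / m * cnj (w $ y))"
        by (rule sum.swap)
      also have "\<dots> = (\<Sum>z\<in>X. v $ z * cnj ((\<Sum>y\<in>X. ?\<theta> (grass_dist D z y) * w $ y) / m))"
        by (intro sum.cong refl)
           (simp add: sum_distrib_left sum_divide_distrib m_def X_def grass_dist_commute[OF D(1)] mult_ac)
      also have "\<dots> = (\<Sum>z\<in>X. v $ z * cnj (w $ z))"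
        using ker m by (intro sum.cong refl) simp
      also have "\<dots> = hermitian_inner v w" unfolding hermitian_inner_def sumX ..
      finally have "hermitian_inner (P *v v) w = hermitian_inner v w" .
      then show ?thesis
        by (simp add: hermitian_inner_def left_diff_distrib sum_subtractf)
    qed
  qed
  then show ?thesis using y z m by (simp add: P_def X_def m_def)
qed

section \<open>The quotient algebra\<close>

lemma hv_free_ring_simps [simp]:
  "carrier hv_free_ring = UNIV" "mult hv_free_ring = (*)" "one hv_free_ring = 1"
  "zero hv_free_ring = 0" "add hv_free_ring = (+)"
  by (simp_all add: hv_free_ring_def)

lemma ring_hv_free_ring: "ring hv_free_ring"
  by (rule ringI)
     (auto intro!: abelian_groupI monoidI exI[of _ "- x" for x] simp: algebra_simps)

lemma ideal_hv_ideal: "ideal (hv_ideal k k' u q) hv_free_ring"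
  unfolding hv_ideal_def by (rule ring.genideal_ideal[OF ring_hv_free_ring]) simp

lemma hv_relators_subset: "hv_relators k k' u q \<subseteq> hv_ideal k k' u q"
  unfolding hv_ideal_def by (rule ring.genideal_self[OF ring_hv_free_ring]) simp

lemma ring_hv_algebra: "ring (hv_algebra k k' u q)"
  unfolding hv_algebra_def by (rule ideal.quotient_is_ring[OF ideal_hv_ideal])

lemma hv_class_hom: "hv_class k k' u q \<in> ring_hom hv_free_ring (hv_algebra k k' u q)"
  unfolding hv_algebra_def using ideal.rcos_ring_hom[OF ideal_hv_ideal]
  by (simp add: hv_class_def[abs_def])

lemma hv_class_carrier [simp]: "hv_class k k' u q p \<in> carrier (hv_algebra k k' u q)"
  using ring_hom_closed[OF hv_class_hom] by simp

lemma hv_class_mult: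
  "hv_class k k' u q (p * r) = hv_class k k' u q p \<otimes>\<^bsub>hv_algebra k k' u q\<^esub> hv_class k k' u q r"
  using ring_hom_mult[OF hv_class_hom] by simp

lemma hv_class_add:
  "hv_class k k' u q (p + r) = hv_class k k' u q p \<oplus>\<^bsub>hv_algebra k k' u q\<^esub> hv_class k k' u q r"
  using ring_hom_add[OF hv_class_hom] by simp

lemma hv_class_one: "hv_class k k' u q 1 = \<one>\<^bsub>hv_algebra k k' u q\<^esub>"
  using ring_hom_one[OF hv_class_hom] by simp

lemma hv_class_eqI:
  assumes "p - r \<in> hv_ideal k k' u q"
  shows "hv_class k k' u q p = hv_class k k' u q r"
proof -
  interpret ideal "hv_ideal k k' u q" hv_free_ring by (rule ideal_hv_ideal)
  have "p = (p - r) + r" by simp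
  then have "p \<in> hv_class k k' u q r"
    using assms unfolding hv_class_def a_r_coset_def r_coset_def
    by (auto simp: bexI[of _ "p - r"])
  then show ?thesis
    unfolding hv_class_def by (intro a_repr_independence'[symmetric]) simp_all
qed

lemma hv_const_gen_commute: "hv_gen g * hv_const c = hv_const c * hv_gen g"
  by (simp add: hv_gen_def hv_const_def mult_single)

lemma hv_const_mult: "hv_const c * hv_const d = hv_const (c * d)"
  by (simp add: hv_const_def mult_single)

lemma hv_const_1: "hv_const 1 = 1"
  by (simp add: hv_const_def)

text \<open>The relation expands to \<open>g * (g + 1/c - c) = 1\<close>, and constants commute with
  generators, so the inverse is two-sided.\<close>

lemma hv_class_quadratic_inverse:
  fixes g :: hv_gen and c :: complex
  assumes "c \<noteq> 0" and "(hv_gen g - hv_const c) * (hv_gen g + hv_const (inverse c)) \<in> hv_ideal k k' u q"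
  defines "h \<equiv> hv_gen g + hv_const (inverse c - c)"
  shows "hv_class k k' u q (hv_gen g * h) = hv_class k k' u q 1"
    and "hv_class k k' u q (h * hv_gen g) = hv_class k k' u q 1"
proof -
  have c: "hv_const (inverse c - c) = hv_const (inverse c) - hv_const c"
    by (simp add: hv_const_def single_diff)
  have 1: "hv_const c * hv_const (inverse c) = 1"
    using assms by (simp add: hv_const_mult hv_const_1)
  have "hv_gen g * h - 1 = (hv_gen g - hv_const c) * (hv_gen g + hv_const (inverse c))"
    unfolding h_def c using 1 by (simp add: algebra_simps hv_const_gen_commute)
  then show "hv_class k k' u q (hv_gen g * h) = hv_class k k' u q 1"
    using assms by (intro hv_class_eqI) simp
  moreover have "h * hv_gen g = hv_gen g * h"
    unfolding h_def by (simp add: algebra_simps hv_const_gen_commute)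
  ultimately show "hv_class k k' u q (h * hv_gen g) = hv_class k k' u q 1" by simp
qed

text \<open>This replaces the abstract inverse by an expression in the generators, whose action is
  known.\<close>

lemma inv_hv_X:
  assumes "k \<noteq> 0" "k' \<noteq> 0"
  shows "inv\<^bsub>hv_algebra k k' u q\<^esub> hv_X k k' u q
    = hv_class k k' u q ((gT + hv_const (inverse k - k)) * (gT' + hv_const (inverse k' - k')))"
    (is "_ = hv_class k k' u q (?S * ?S')")
proof -
  interpret H: ring "hv_algebra k k' u q" by (rule ring_hv_algebra)
  let ?c = "hv_class k k' u q" and ?H = "hv_algebra k k' u q"
  have T: "?c (gT * ?S) = ?c 1" "?c (?S * gT) = ?c 1"
    using hv_class_quadratic_inverse[of k Gen_T] assms hv_relators_subset[of k k' u q]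
    by (auto simp: hv_relators_def)
  have T': "?c (gT' * ?S') = ?c 1" "?c (?S' * gT') = ?c 1"
    using hv_class_quadratic_inverse[of k' Gen_T'] assms hv_relators_subset[of k k' u q]
    by (auto simp: hv_relators_def)
  have "?c ((gT' * gT) * (?S * ?S')) = ?c gT' \<otimes>\<^bsub>?H\<^esub> ?c (gT * ?S) \<otimes>\<^bsub>?H\<^esub> ?c ?S'"
    by (simp add: hv_class_mult H.m_assoc)
  also have "\<dots> = ?c (gT' * ?S')" unfolding T by (simp add: hv_class_mult hv_class_one)
  finally have 1: "?c (gT' * gT) \<otimes>\<^bsub>?H\<^esub> ?c (?S * ?S') = \<one>\<^bsub>?H\<^esub>"
    using T' by (simp add: hv_class_mult hv_class_one)
  have "?c ((?S * ?S') * (gT' * gT)) = ?c ?S \<otimes>\<^bsub>?H\<^esub> ?c (?S' * gT') \<otimes>\<^bsub>?H\<^esub> ?c gT"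
    by (simp add: hv_class_mult H.m_assoc)
  also have "\<dots> = ?c (?S * gT)" unfolding T' by (simp add: hv_class_mult hv_class_one)
  finally have 2: "?c (?S * ?S') \<otimes>\<^bsub>?H\<^esub> ?c (gT' * gT) = \<one>\<^bsub>?H\<^esub>"
    using T by (simp add: hv_class_mult hv_class_one)
  show ?thesis
    unfolding hv_X_def using H.inv_char[OF _ _ 1 2] by simp
qed

section \<open>Coordinates on the clique module\<close>

text \<open>Coordinates are sequences on all naturals, of which only the entries below
  \<open>D\<close> count; this allows uniform formulas with shifted indices.\<close>

definition clique_vec ::
    "(nat \<Rightarrow> complex ^ 'v::finite) \<Rightarrow> (nat \<Rightarrow> complex ^ 'v) \<Rightarrow> nat \<Rightarrow> (nat \<Rightarrow> complex) \<Rightarrow> (nat \<Rightarrow> complex)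
      \<Rightarrow> complex ^ 'v" where
  "clique_vec em ep D f g = (\<Sum>i<D. f i *s em i + g i *s ep i)"

lemma clique_vec_cong:
  "(\<And>i. i < D \<Longrightarrow> f i = f' i) \<Longrightarrow> (\<And>i. i < D \<Longrightarrow> g i = g' i)
    \<Longrightarrow> clique_vec em ep D f g = clique_vec em ep D f' g'"
  by (simp add: clique_vec_def)

lemma clique_vec_add:
  "clique_vec em ep D f g + clique_vec em ep D f' g' = clique_vec em ep D (\<lambda>i. f i + f' i) (\<lambda>i. g i + g' i)"
  by (simp add: clique_vec_def vec.scale_left_distrib algebra_simps flip: sum.distrib)

lemma clique_vec_scale:
  "c *s clique_vec em ep D f g = clique_vec em ep D (\<lambda>i. c * f i) (\<lambda>i. c * g i)"
  by (simp add: clique_vec_def vec.scale_sum_right vec.scale_right_distrib)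

lemma clique_vec_in_subspace:
  assumes "vec.subspace W" "\<And>i. i < D \<Longrightarrow> em i \<in> W" "\<And>i. i < D \<Longrightarrow> ep i \<in> W"
  shows "clique_vec em ep D f g \<in> W"
  unfolding clique_vec_def using assms
  by (intro vec.subspace_sum vec.subspace_add vec.subspace_scale) auto

lemma span_eq_clique_vec:
  assumes "w \<in> vec.span (\<Union>i<D. {em i, ep i})"
  obtains f g where "w = clique_vec em ep D f g"
proof -
  let ?R = "{w. \<exists>f g. w = clique_vec em ep D f g}"
  have "vec.subspace ?R"
  proof (rule vec.subspaceI)
    show "0 \<in> ?R" by (auto simp: clique_vec_def intro!: exI[of _ "\<lambda>_. 0"])
  qed (use clique_vec_add clique_vec_scale in blast)+
  moreover have "(\<Union>i<D. {em i, ep i}) \<subseteq> ?R"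
  proof -
    have "em i = clique_vec em ep D (\<lambda>j. if j = i then 1 else 0) (\<lambda>_. 0)"
      "ep i = clique_vec em ep D (\<lambda>_. 0) (\<lambda>j. if j = i then 1 else 0)" if "i < D" for i
      using that by (simp_all add: clique_vec_def if_distrib[of "\<lambda>c. c *s _"] cong: if_cong)
    then show ?thesis by blast
  qed
  ultimately have "vec.span (\<Union>i<D. {em i, ep i}) \<subseteq> ?R" by (intro vec.span_minimal)
  then show ?thesis using assms that by auto
qed

lemma linear_on_clique_vec:
  fixes F :: "complex ^ 'v::finite \<Rightarrow> complex ^ 'v"
  assumes W: "vec.subspace W" "\<And>i. i < D \<Longrightarrow> em i \<in> W" "\<And>i. i < D \<Longrightarrow> ep i \<in> W"
    and add: "\<And>v w. v \<in> W \<Longrightarrow> w \<in> W \<Longrightarrow> F (v + w) = F v + F w"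
    and scale: "\<And>c v. v \<in> W \<Longrightarrow> F (c *s v) = c *s F v"
  shows "F (clique_vec em ep D f g) = (\<Sum>i<D. f i *s F (em i) + g i *s F (ep i))"
proof -
  have "F (clique_vec em ep m f g) = (\<Sum>i<m. f i *s F (em i) + g i *s F (ep i))" if "m \<le> D" for m
    using that
  proof (induction m)
    case 0
    have "F (0 *s 0) = 0 *s F 0" using W(1) by (intro scale vec.subspace_0)
    then show ?case by (simp add: clique_vec_def)
  next
    case (Suc m)
    have m: "em m \<in> W" "ep m \<in> W" "clique_vec em ep m f g \<in> W"
      using W Suc.prems by (auto intro: clique_vec_in_subspace)
    have "clique_vec em ep (Suc m) f g = clique_vec em ep m f g + (f m *s em m + g m *s ep m)"
      by (simp add: clique_vec_def)
    then show ?case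
      using m Suc W(1) by (simp add: add scale vec.subspace_add vec.subspace_scale)
  qed
  then show ?thesis by simp
qed

lemma acts_as_block_clique_vec:
  assumes F: "F (clique_vec em ep D f g) = (\<Sum>i<D. f i *s F (em i) + g i *s F (ep i))"
    and block: "\<forall>i<D. acts_as_block F (em i) (ep i) (M i)"
  shows "F (clique_vec em ep D f g) = clique_vec em ep D
    (\<lambda>i. M i $ 1 $ 1 * f i + M i $ 1 $ 2 * g i) (\<lambda>i. M i $ 2 $ 1 * f i + M i $ 2 $ 2 * g i)"
  unfolding F unfolding clique_vec_def using block
  by (intro sum.cong refl) (simp add: acts_as_block_def vec.scale_right_distrib vec.scale_left_distrib mult.commute)

text \<open>The blocks of size one at both ends are the relevant corners of \<open>M 0\<close> and \<open>M D\<close>, whose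
  off-diagonal entries vanish; thus the junk indices \<open>0 - 1\<close> and \<open>D\<close> do no harm.\<close>

lemma acts_as_shifted_block_clique_vec:
  assumes F: "F (clique_vec em ep D f g) = (\<Sum>i<D. f i *s F (em i) + g i *s F (ep i))"
    and D: "1 \<le> D"
    and block: "\<forall>i\<in>{1..D - 1}. acts_as_block F (ep (i - 1)) (em i) (M i)"
    and first: "F (em 0) = M 0 $ 2 $ 2 *s em 0" "M 0 $ 2 $ 1 = 0"
    and last: "F (ep (D - 1)) = M D $ 1 $ 1 *s ep (D - 1)" "M D $ 1 $ 2 = 0"
  shows "F (clique_vec em ep D f g) = clique_vec em ep D
    (\<lambda>i. M i $ 2 $ 1 * g (i - 1) + M i $ 2 $ 2 * f i)
    (\<lambda>i. M (i + 1) $ 1 $ 1 * g i + M (i + 1) $ 1 $ 2 * f (i + 1))"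
proof -
  obtain m where m: "D = Suc m" using D by (cases D) auto
  have b: "F (ep i) = M (Suc i) $ 1 $ 1 *s ep i + M (Suc i) $ 2 $ 1 *s em (Suc i)"
    "F (em (Suc i)) = M (Suc i) $ 1 $ 2 *s ep i + M (Suc i) $ 2 $ 2 *s em (Suc i)" if "i < m" for i
    using bspec[OF block, of "Suc i"] that m by (auto simp: acts_as_block_def)
  have "F (clique_vec em ep D f g)
      = (\<Sum>i<Suc m. f i *s F (em i)) + (\<Sum>i<Suc m. g i *s F (ep i))"
    unfolding sum.distrib[symmetric] m[symmetric] by (rule F)
  \<comment> \<open>The basis is paired anew: \<open>em 0\<close> and \<open>ep m\<close> stand
    alone, and \<open>ep i\<close> joins \<open>em (Suc i)\<close>.\<close>
  also have "\<dots> = f 0 *s F (em 0) + (\<Sum>i<m. f (Suc i) *s F (em (Suc i)))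
      + ((\<Sum>i<m. g i *s F (ep i)) + g m *s F (ep m))"
    by (simp only: sum.lessThan_Suc_shift[of "\<lambda>i. f i *s F (em i)"] sum.lessThan_Suc)
  also have "(\<Sum>i<m. f (Suc i) *s F (em (Suc i)))
      = (\<Sum>i<m. (f (Suc i) * M (Suc i) $ 1 $ 2) *s ep i + (f (Suc i) * M (Suc i) $ 2 $ 2) *s em (Suc i))"
    by (intro sum.cong refl) (simp add: b vec.scale_right_distrib)
  also have "(\<Sum>i<m. g i *s F (ep i))
      = (\<Sum>i<m. (g i * M (Suc i) $ 1 $ 1) *s ep i + (g i * M (Suc i) $ 2 $ 1) *s em (Suc i))"
    by (intro sum.cong refl) (simp add: b vec.scale_right_distrib)
  finally have L: "F (clique_vec em ep D f g) = (f 0 * M 0 $ 2 $ 2) *s em 0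
      + (\<Sum>i<m. (f (Suc i) * M (Suc i) $ 1 $ 2) *s ep i + (f (Suc i) * M (Suc i) $ 2 $ 2) *s em (Suc i))
      + ((\<Sum>i<m. (g i * M (Suc i) $ 1 $ 1) *s ep i + (g i * M (Suc i) $ 2 $ 1) *s em (Suc i))
        + (g m * M D $ 1 $ 1) *s ep m)"
    using first last by (simp add: m)
  define f' where "f' i = M i $ 2 $ 1 * g (i - 1) + M i $ 2 $ 2 * f i" for i
  define g' where "g' i = M (i + 1) $ 1 $ 1 * g i + M (i + 1) $ 1 $ 2 * f (i + 1)" for i
  have "clique_vec em ep D f' g' = (\<Sum>i<Suc m. f' i *s em i) + (\<Sum>i<Suc m. g' i *s ep i)"
    unfolding clique_vec_def m by (rule sum.distrib)
  also have "\<dots> = f' 0 *s em 0 + (\<Sum>i<m. f' (Suc i) *s em (Suc i)) + ((\<Sum>i<m. g' i *s ep i) + g' m *s ep m)"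
    by (simp only: sum.lessThan_Suc_shift[of "\<lambda>i. f' i *s em i"] sum.lessThan_Suc)
  also have "f' 0 = f 0 * M 0 $ 2 $ 2" using first by (simp add: f'_def)
  also have "g' m = g m * M D $ 1 $ 1" using last by (simp add: g'_def m)
  finally have R: "clique_vec em ep D f' g' = (f 0 * M 0 $ 2 $ 2) *s em 0 + (\<Sum>i<m. f' (Suc i) *s em (Suc i))
      + ((\<Sum>i<m. g' i *s ep i) + (g m * M D $ 1 $ 1) *s ep m)" .
  have "F (clique_vec em ep D f g) = clique_vec em ep D f' g'"
    unfolding L R
    by (simp add: f'_def g'_def sum.distrib vec.scale_left_distrib mult.commute algebra_simps)
  then show ?thesis unfolding f'_def[abs_def] g'_def[abs_def] .
qed

lemma mat22_nth [simp]:
  "mat22 a b c d $ 1 $ 1 = a" "mat22 a b c d $ 1 $ 2 = b"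
  "mat22 a b c d $ 2 $ 1 = c" "mat22 a b c d $ 2 $ 2 = d"
  by (simp_all add: mat22_def)

abbreviation clique_coord ::
    "nat \<Rightarrow> ('f::{field,finite} ^ 'n) set set \<Rightarrow> ('f ^ 'n) set \<Rightarrow> (nat \<Rightarrow> complex) \<Rightarrow> (nat \<Rightarrow> complex)
      \<Rightarrow> complex ^ ('f ^ 'n) set" where
  "clique_coord D C x \<equiv>
     clique_vec (\<lambda>i. char_vec (clique_minus D C x i)) (\<lambda>i. char_vec (clique_plus D C x i)) D"

context
  fixes D :: nat and C :: "('f::{field,finite} ^ 'n) set set" and x :: "('f ^ 'n) set"
  assumes D: "1 \<le> D" "2 * D \<le> CARD('n)" and C: "delsarte_clique D C" and x: "x \<in> C"
begin

lemma clique_point_vert: "x \<in> grass_verts D"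
  using C x by (auto simp: delsarte_clique_def)

text \<open>Every vertex lies in exactly one cell, with index below \<open>D\<close>, so a single
  summand survives and matrix identities can be checked at each vertex.\<close>

lemma clique_coord_nth:
  "clique_coord D C x f g $ y = (if y \<in> grass_verts D then clique_fun D C x f g y else 0)"
proof (cases "y \<in> grass_verts D")
  case True
  let ?i = "clique_index D C y"
  have i: "?i < D" "grass_dist D x y = ?i \<or> grass_dist D x y = ?i + 1"
    using clique_index_dist(1)[OF D C True] clique_index_dist(2)[OF D C True x] grass_dist_commute[OF D(1) True clique_point_vert] by auto
  have m: "y \<in> clique_minus D C x j \<longleftrightarrow> j = ?i \<and> grass_dist D x y = ?i"
    "y \<in> clique_plus D C x j \<longleftrightarrow> j = ?i \<and> grass_dist D x y = ?i + 1" for j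
    using True by (auto simp: clique_minus_def clique_plus_def clique_part_def clique_index_def)
  have "clique_coord D C x f g $ y
      = (\<Sum>j<D. if j = ?i then clique_fun D C x f g y else 0)"
    unfolding clique_vec_def sum_component
  proof (rule sum.cong[OF refl])
    fix j
    show "(f j *s char_vec (clique_minus D C x j) + g j *s char_vec (clique_plus D C x j)) $ y
        = (if j = ?i then clique_fun D C x f g y else 0)"
      using i(2) by (auto simp: char_vec_def m clique_fun_def)
  qed
  then show ?thesis using i True by simp
next
  case False
  then show ?thesis
    by (simp add: clique_vec_def char_vec_def clique_minus_def clique_plus_def clique_part_def)
qed

lemma adj_matrix_clique_coord:
  defines "B \<equiv> fqnum TYPE('f)" and "n \<equiv> CARD('n) - D + 1"
  shows "adj_matrix D *v clique_coord D C x f g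
    = clique_coord D C x (adj_minus B D n f g) (adj_plus B D n f g)"
proof (rule vec_eq_iff[THEN iffD2], rule allI)
  fix y
  have "(adj_matrix D *v clique_coord D C x f g) $ y = (\<Sum>z | grass_adj D y z. clique_fun D C x f g z)"
    unfolding adj_matrix_mult_nth clique_coord_nth by (intro sum.cong) (auto simp: grass_adj_def)
  also have "\<dots> = clique_coord D C x (adj_minus B D n f g) (adj_plus B D n f g) $ y"
  proof (cases "y \<in> grass_verts D")
    case True
    then show ?thesis
      using clique_neighbours[OF D C x True, of f g]
      unfolding clique_coord_nth by (simp add: clique_fun_def Let_def B_def n_def)
  next
    case False
    then have "{z. grass_adj D y z} = {}" by (auto simp: grass_adj_def)
    then show ?thesis using False by (simp add: clique_coord_nth)
  qed
  finally show "(adj_matrix D *v clique_coord D C x f g) $ y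
      = clique_coord D C x (adj_minus B D n f g) (adj_plus B D n f g) $ y" .
qed

lemma dual_adj_matrix_mult_nth:
  fixes c :: "('f ^ 'n) set"
  shows "(dual_adj_matrix D c *v v) $ y = of_nat (card (grass_verts D :: ('f ^ 'n) set set)) * grass_E D 1 $ c $ y * v $ y"
  by (simp add: dual_adj_matrix_def matrix_vector_mult_def if_distrib[of "\<lambda>c. c * _"] cong: if_cong)

lemma dual_adj_matrix_clique_coord:
  defines "\<theta> \<equiv> \<lambda>i. complex_of_real (grass_dual_theta (real CARD('f)) CARD('n) D i)"
  shows "dual_adj_matrix D x *v clique_coord D C x f g
    = clique_coord D C x (\<lambda>i. \<theta> i * f i) (\<lambda>i. \<theta> (i + 1) * g i)"
proof (rule vec_eq_iff[THEN iffD2], rule allI)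
  fix y
  have D': "D < CARD('n)" "2 \<le> CARD('n)" using D by auto
  have "\<theta> (grass_dist D x y) * clique_fun D C x f g y
      = clique_fun D C x (\<lambda>i. \<theta> i * f i) (\<lambda>i. \<theta> (i + 1) * g i) y" if "y \<in> grass_verts D"
    using clique_index_dist(2)[OF D C that x] grass_dist_commute[OF D(1) that clique_point_vert]
    by (auto simp: clique_fun_def Let_def)
  then show "(dual_adj_matrix D x *v clique_coord D C x f g) $ y
      = clique_coord D C x (\<lambda>i. \<theta> i * f i) (\<lambda>i. \<theta> (i + 1) * g i) $ y"
    unfolding dual_adj_matrix_mult_nth clique_coord_nth
    using grass_E_1_nth[OF D(1) D' clique_point_vert, of y] by (simp add: \<theta>_def)
qed

text \<open>A vertex of index \<open>i\<close> has \<open>[i + 1]\<close> clique members at distance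
  \<open>i\<close> and the remaining \<open>[n] - [i + 1]\<close> at distance \<open>i + 1\<close>.
  The average does not see \<open>x\<close>, so both cells of index \<open>i\<close> get the same
  scalar \<open>\<mu> i\<close>.\<close>

lemma dual_adj_matrix_clique_clique_coord:
  defines "\<theta> \<equiv> \<lambda>i. complex_of_real (grass_dual_theta (real CARD('f)) CARD('n) D i)"
    and "B \<equiv> fqnum TYPE('f)" and "n \<equiv> CARD('n) - D + 1"
  defines "\<mu> \<equiv> \<lambda>i. (B (i + 1) * \<theta> i + (B n - B (i + 1)) * \<theta> (i + 1)) / B n"
  shows "dual_adj_matrix_clique D C *v clique_coord D C x f g
    = clique_coord D C x (\<lambda>i. \<mu> i * f i) (\<lambda>i. \<mu> i * g i)"
proof (rule vec_eq_iff[THEN iffD2], rule allI)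
  fix y
  have D': "D < CARD('n)" "2 \<le> CARD('n)" using D by auto
  let ?v = "clique_coord D C x f g"
  have cC: "of_nat (card C) = B n" unfolding B_def n_def
    using C by (intro of_nat_eq_of_real) (simp add: delsarte_clique_def)
  have CX: "c \<in> grass_verts D" if "c \<in> C" for c using C that by (auto simp: delsarte_clique_def)
  have "(dual_adj_matrix_clique D C *v ?v) $ y
      = (1 / real (card C)) *\<^sub>R (\<Sum>c\<in>C. (dual_adj_matrix D c *v ?v) $ y)"
    unfolding dual_adj_matrix_clique_def
    by (simp add: scaleR_matrix_vector_assoc[symmetric] matrix_vector_mult_def sum_component sum_distrib_right)
       (subst sum.swap, simp add: scaleR_sum_right)
  also have "\<dots> = (\<Sum>c\<in>C. (dual_adj_matrix D c *v ?v) $ y) / B n"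
    unfolding cC[symmetric] by (simp add: scaleR_conv_of_real)
  finally have eq: "(dual_adj_matrix_clique D C *v ?v) $ y = (\<Sum>c\<in>C. (dual_adj_matrix D c *v ?v) $ y) / B n" .
  show "(dual_adj_matrix_clique D C *v ?v) $ y
      = clique_coord D C x (\<lambda>i. \<mu> i * f i) (\<lambda>i. \<mu> i * g i) $ y"
  proof (cases "y \<in> grass_verts D")
    case True
    let ?i = "clique_index D C y"
    have "(\<Sum>c\<in>C. (dual_adj_matrix D c *v ?v) $ y)
        = (\<Sum>c\<in>C. \<theta> (grass_dist D c y) * ?v $ y)"
    proof (rule sum.cong[OF refl])
      fix c assume c: "c \<in> C"
      show "(dual_adj_matrix D c *v ?v) $ y = \<theta> (grass_dist D c y) * ?v $ y"
        unfolding dual_adj_matrix_mult_nth \<theta>_def grass_E_1_nth[OF D(1) D' CX[OF c] True] ..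
    qed
    also have "\<dots> = (\<Sum>c\<in>C. if grass_dist D y c = ?i then \<theta> ?i * ?v $ y else \<theta> (?i + 1) * ?v $ y)"
    proof (rule sum.cong[OF refl])
      fix c assume c: "c \<in> C"
      show "\<theta> (grass_dist D c y) * ?v $ y
          = (if grass_dist D y c = ?i then \<theta> ?i * ?v $ y else \<theta> (?i + 1) * ?v $ y)"
        using clique_index_dist(2)[OF D C True c] grass_dist_commute[OF D(1) True CX[OF c]] by auto
    qed
    also have "\<dots> = (\<Sum>c\<in>C. \<theta> (?i + 1) * ?v $ y + (if grass_dist D y c = ?i then 1 else 0) * ((\<theta> ?i - \<theta> (?i + 1)) * ?v $ y))"
      by (intro sum.cong refl) (simp add: algebra_simps)
    also have "\<dots> = of_nat (card C) * (\<theta> (?i + 1) * ?v $ y)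
        + of_nat (card {c \<in> C. grass_dist D y c = ?i}) * ((\<theta> ?i - \<theta> (?i + 1)) * ?v $ y)"
      unfolding sum.distrib sum_distrib_right[symmetric] by (simp add: sum_indicator_card)
    also have "of_nat (card {c \<in> C. grass_dist D y c = ?i}) = B (?i + 1)"
      unfolding B_def by (rule clique_index_dist(3)[OF D C True])
    finally have "(dual_adj_matrix_clique D C *v ?v) $ y = \<mu> ?i * ?v $ y"
      unfolding eq cC by (simp add: \<mu>_def algebra_simps)
    then show ?thesis using True unfolding clique_coord_nth by (simp add: clique_fun_def Let_def)
  next
    case False
    then show ?thesis unfolding eq dual_adj_matrix_mult_nth by (simp add: clique_coord_nth)
  qed
qed

end

section \<open>The generators on coordinates, and the identity for the adjacency matrix\<close>

definition t_minus :: "complex \<Rightarrow> complex \<Rightarrow> complex \<Rightarrow> (nat \<Rightarrow> complex) \<Rightarrow> (nat \<Rightarrow> complex) \<Rightarrow> nat \<Rightarrow> complex" where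
  "t_minus k Q E f g i = k * ((1 - Q ^ (i + 1) + E) * f i + (Q ^ (i + 1) - E) * g i)"

definition t_plus :: "complex \<Rightarrow> complex \<Rightarrow> (nat \<Rightarrow> complex) \<Rightarrow> (nat \<Rightarrow> complex) \<Rightarrow> nat \<Rightarrow> complex" where
  "t_plus k Q f g i = k * ((1 - Q ^ (i + 1)) * f i + Q ^ (i + 1) * g i)"

text \<open>At \<open>i = 0\<close> the coefficient \<open>1 - Q ^ i\<close> of the ill-indexed term
  vanishes. In the plus row, \<open>d\<close> stands for \<open>Q^D\<close>, so the coefficient of
  \<open>f (i + 1)\<close> vanishes at \<open>i = D - 1\<close>. The corner blocks of size one are
  thereby included.\<close>

definition t'_minus :: "complex \<Rightarrow> complex \<Rightarrow> (nat \<Rightarrow> complex) \<Rightarrow> (nat \<Rightarrow> complex) \<Rightarrow> nat \<Rightarrow> complex" where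
  "t'_minus k' Q f g i = k' * ((1 - Q ^ i) * g (i - 1) + Q ^ i * f i)"

definition t'_plus :: "complex \<Rightarrow> complex \<Rightarrow> complex \<Rightarrow> (nat \<Rightarrow> complex) \<Rightarrow> (nat \<Rightarrow> complex) \<Rightarrow> nat \<Rightarrow> complex" where
  "t'_plus k' Q d f g i = k' * ((1 - Q ^ (i + 1) + d) * g i + (Q ^ (i + 1) - d) * f (i + 1))"

text \<open>With \<open>k\<^sup>2 E = -1\<close> and \<open>k'\<^sup>2 d = -1\<close> the inverses \<open>T - k + 1/k\<close> and \<open>T' - k' + 1/k'\<close> have
  entries in \<open>k\<close> and \<open>k'\<close> times polynomials, so both sides become polynomials over \<open>(Q - 1)\<^sup>2\<close>.\<close>

lemma
  fixes f g :: "nat \<Rightarrow> complex" and k k' Q E d p :: complex and B :: "nat \<Rightarrow> complex"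
  assumes k: "k * k * E = - 1" and k': "k' * k' * d = - 1" and p: "p * (Q - 1) = 1"
    and B: "\<And>m. B m = (Q ^ m - 1) * p" and n: "Q ^ n = E" and D: "Q ^ D = d"
  defines "tf \<equiv> t_minus k Q E f g" and "tg \<equiv> t_plus k Q f g"
    and "sf \<equiv> \<lambda>i. t'_minus k' Q f g i + (inverse k' - k') * f i"
    and "sg \<equiv> \<lambda>i. t'_plus k' Q d f g i + (inverse k' - k') * g i"
  shows adj_minus_decomp:
      "k * k' * (E * d * p\<^sup>2) * (t'_minus k' Q tf tg i + (t_minus k Q E sf sg i + (inverse k - k) * sf i))
        + (Q - E - d * Q - 1) * p\<^sup>2 * f i = adj_minus B D n f g i" (is ?minus)
    and adj_plus_decomp:
      "k * k' * (E * d * p\<^sup>2) * (t'_plus k' Q d tf tg i + (t_plus k Q sf sg i + (inverse k - k) * sg i))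
        + (Q - E - d * Q - 1) * p\<^sup>2 * g i = adj_plus B D n f g i" (is ?plus)
proof -
  define x where "x = Q ^ i"
  have x: "Q ^ i = x" "Q ^ (i + 1) = Q * x" "Q ^ (i + 2) = Q * (Q * x)" "Q ^ (i + 1 + 1) = Q * (Q * x)"
    by (simp_all add: x_def)
  have nz: "k \<noteq> 0" "k' \<noteq> 0" using k k' by auto
  have inv: "inverse k = - (k * E)" "inverse k' = - (k' * d)"
    using k k' nz by (auto simp: field_simps)
  \<comment> \<open>All terms of \<open>X\<close> and of its inverse carry \<open>k * k'\<close>.
    The prefactor supplies another one, and \<open>(k * k * E) * (k' * k' * d) = 1\<close> removes
    the parameters.\<close>
  have kk: "k * k' * (E * d * p\<^sup>2) * (k * k' * z) = p\<^sup>2 * z" for z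
  proof -
    have "k * k' * (E * d * p\<^sup>2) * (k * k' * z) = (k * k * E) * (k' * k' * d) * (p\<^sup>2 * z)"
      by (simp only: mult_ac)
    then show ?thesis unfolding k k' by simp
  qed
  have BD: "B D = (d - 1) * p" and Bn: "B n = (E - 1) * p" by (simp_all add: B n D)
  have Bi: "B i = (x - 1) * p" "B (i + 1) = (Q * x - 1) * p" "B (i + 2) = (Q * (Q * x) - 1) * p"
    by (simp_all only: B x)
  \<comment> \<open>The returns carry a single bracket; a factor \<open>p * (Q - 1) = 1\<close> puts
    them over the same \<open>p\<^sup>2\<close> as the products of two brackets.\<close>
  have BD': "B D * z = p\<^sup>2 * ((Q - 1) * (d - 1) * z)" for z
  proof -
    have "B D * z = (p * (Q - 1)) * (p * ((d - 1) * z))" unfolding p BD by (simp add: mult_ac)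
    then show ?thesis by (simp only: power2_eq_square mult_ac)
  qed
  \<comment> \<open>For \<open>i = 0\<close> the power in \<open>tg (i - 1)\<close> is not
    \<open>x\<close>, but then \<open>1 - x = 0\<close>.\<close>
  have tg_pred: "(1 - x) * tg (i - 1) = (1 - x) * (k * ((1 - x) * f (i - 1) + x * g (i - 1)))"
    by (cases i) (simp_all add: tg_def t_plus_def x_def)
  have sf: "sf i = k' * ((1 - x) * g (i - 1) + x * f i - (d + 1) * f i)"
    unfolding sf_def t'_minus_def inv x by (simp add: algebra_simps)
  have sg: "sg i = k' * ((Q * x - d) * f (i + 1) - Q * x * g i)"
    unfolding sg_def t'_plus_def inv x by (simp add: algebra_simps)
  have 1: "t'_minus k' Q tf tg i = k * k' * ((1 - x) * ((1 - x) * f (i - 1) + x * g (i - 1))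
      + x * ((1 - Q * x + E) * f i + (Q * x - E) * g i))"
    unfolding t'_minus_def x tg_pred unfolding tf_def t_minus_def x by (simp add: algebra_simps)
  have 2: "t_minus k Q E sf sg i + (inverse k - k) * sf i
      = k * k' * ((Q * x - E) * ((Q * x - d) * f (i + 1) - Q * x * g i)
        - Q * x * ((1 - x) * g (i - 1) + x * f i - (d + 1) * f i))"
    unfolding t_minus_def sf sg inv x by (simp add: algebra_simps)
  have m: "adj_minus B D n f g i = p\<^sup>2 * ((x - 1) * ((x - 1) * f (i - 1) + (E - x) * f i)
      + (Q * x - x) * ((x - 1) * g (i - 1) + (Q * x - x) * f i + (E - Q * x) * g i)
      + (d - Q * x) * ((Q * x - 1) * f i + (E - Q * x) * f (i + 1)) - (Q - 1) * (d - 1) * f i)"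
    unfolding adj_minus_def BD' unfolding BD Bn Bi
    by (simp add: algebra_simps power2_eq_square)
  show ?minus
    unfolding 1 2 m distrib_left[of "k * k' * (E * d * p\<^sup>2)"] kk
    by (simp add: algebra_simps power2_eq_square)
  have 3: "t'_plus k' Q d tf tg i = k * k' * ((1 - Q * x + d) * ((1 - Q * x) * f i + Q * x * g i)
      + (Q * x - d) * ((1 - Q * (Q * x) + E) * f (i + 1) + (Q * (Q * x) - E) * g (i + 1)))"
    unfolding t'_plus_def tf_def tg_def t_minus_def t_plus_def x by (simp add: algebra_simps)
  have 4: "t_plus k Q sf sg i + (inverse k - k) * sg i
      = k * k' * ((1 - Q * x) * ((1 - x) * g (i - 1) + x * f i - (d + 1) * f i)
        + (Q * x - E - 1) * ((Q * x - d) * f (i + 1) - Q * x * g i))"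
    unfolding t_plus_def sf sg inv x by (simp add: algebra_simps)
  have r: "adj_plus B D n f g i = p\<^sup>2 * ((Q * x - 1) * ((x - 1) * g (i - 1) + (Q * x - x) * f i + (E - Q * x) * g i)
      + (d - Q * x) * ((Q * x - 1) * g i + (Q * (Q * x) - Q * x) * f (i + 1) + (E - Q * (Q * x)) * g (i + 1))
      - (Q - 1) * (d - 1) * g i)"
    unfolding adj_plus_def BD' unfolding BD Bn Bi
    by (simp add: algebra_simps power2_eq_square)
  show ?plus
    unfolding 3 4 r distrib_left[of "k * k' * (E * d * p\<^sup>2)"] kk
    by (simp add: algebra_simps power2_eq_square)
qed

lemma power_times_powi_shift:
  fixes Q :: complex
  assumes "Q \<noteq> 0" "D \<le> N"
  shows "Q ^ (N - D + 1) * Q powi (int D - int N + int i) = Q ^ (i + 1)"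
proof -
  have "Q ^ (N - D + 1) * Q powi (int D - int N + int i) = Q powi (int (N - D + 1) + (int D - int N + int i))"
    using assms(1) power_int_add[of Q "int (N - D + 1)" "int D - int N + int i"]
    by (simp only: power_int_of_nat) simp
  also have "int (N - D + 1) + (int D - int N + int i) = int (i + 1)" using assms by simp
  finally show ?thesis by (simp only: power_int_of_nat)
qed

text \<open>The exponents involve halves of \<open>D\<close> and \<open>N\<close>;
  \<open>powr\<close> lets them be added. The first two products make \<open>inverse k\<close> and
  \<open>inverse k'\<close> polynomial multiples of \<open>k\<close> and \<open>k'\<close>; the last
  two are, up to sign, the scalars that enter the plus row of the two dual elements.\<close>

lemma powr_parameters:
  fixes q :: real and N D :: nat
  assumes q: "1 < q" and D: "D \<le> N"
    and k: "k = \<i> * complex_of_real (q powr ((real D - real N - 1) / 2))"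
    and k': "k' = \<i> * complex_of_real (q powr (- real D / 2))"
    and u: "u = complex_of_real (q powr (real D - real N / 2))"
  defines "Q \<equiv> complex_of_real q"
  shows "k * k * Q ^ (N - D + 1) = - 1" and "k' * k' * Q ^ D = - 1"
    and "k * k' = complex_of_real (- (q powr ((- real N - 1) / 2)))"
    and "Q * k * k' * inverse u * of_real (q powr (-1/2)) * Q ^ D = - 1"
    and "Q * k * k' * inverse u * of_real (q powr (1/2)) * Q ^ D = - Q"
proof -
  have pow: "Q ^ m = complex_of_real (q powr real m)" for m
    using q by (simp add: Q_def powr_realpow)
  have Q1: "Q = complex_of_real (q powr 1)" using q by (simp add: Q_def)
  have uinv: "inverse u = complex_of_real (q powr - (real D - real N / 2))"
    unfolding u powr_minus by (simp only: of_real_inverse)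
  have ii: "\<i> * y * (\<i> * z) = - (y * z)" for y z
  proof -
    have "\<i> * y * (\<i> * z) = (\<i> * \<i>) * (y * z)" by (simp only: mult_ac)
    then show ?thesis by simp
  qed
  have sq: "\<i> * complex_of_real (q powr s) * (\<i> * complex_of_real (q powr s)) * Q ^ m = - 1"
    if "2 * s + real m = 0" for s m
  proof -
    have "\<i> * complex_of_real (q powr s) * (\<i> * complex_of_real (q powr s)) * Q ^ m
        = - complex_of_real (q powr s * q powr s * q powr real m)"
      unfolding pow ii by simp
    also have "q powr s * q powr s * q powr real m = q powr (2 * s + real m)"
      unfolding powr_add[symmetric] by simp
    finally show ?thesis unfolding that using q by simp
  qed
  show "k * k * Q ^ (N - D + 1) = - 1"
    unfolding k using D by (intro sq) (simp add: of_nat_diff field_simps)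
  show "k' * k' * Q ^ D = - 1"
    unfolding k' by (intro sq) simp
  have "k * k' = - complex_of_real (q powr ((real D - real N - 1) / 2) * q powr (- real D / 2))"
    unfolding k k' ii by simp
  also have "q powr ((real D - real N - 1) / 2) * q powr (- real D / 2) = q powr ((- real N - 1) / 2)"
    unfolding powr_add[symmetric] by (rule arg_cong[where f="\<lambda>s. q powr s"]) (simp add: field_simps)
  finally show kk: "k * k' = complex_of_real (- (q powr ((- real N - 1) / 2)))" by simp
  have gen: "Q * k * k' * inverse u * of_real (q powr s) * Q ^ D = - complex_of_real (q powr (s + 1 / 2))" for s
  proof -
    have "Q * k * k' * inverse u * of_real (q powr s) * Q ^ D
        = - complex_of_real (q powr 1 * q powr ((- real N - 1) / 2) * q powr - (real D - real N / 2) * q powr s * q powr real D)"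
      unfolding mult.assoc[of Q k k'] kk uinv pow unfolding Q1 by simp
    also have "q powr 1 * q powr ((- real N - 1) / 2) * q powr - (real D - real N / 2) * q powr s * q powr real D
        = q powr (s + 1 / 2)"
      unfolding powr_add[symmetric] by (rule arg_cong[where f="\<lambda>s. q powr s"]) (simp add: field_simps)
    finally show ?thesis .
  qed
  show "Q * k * k' * inverse u * of_real (q powr (-1/2)) * Q ^ D = - 1"
    unfolding gen using q by simp
  show "Q * k * k' * inverse u * of_real (q powr (1/2)) * Q ^ D = - Q"
    unfolding gen using q by (simp add: Q_def)
qed

lemma hv_moduleD:
  assumes "hv_module k k' u q W \<rho>" and v: "v \<in> W"
  shows "vec.subspace W"
    and "\<rho> (hv_class k k' u q p) v \<in> W"
    and "w \<in> W \<Longrightarrow> \<rho> (hv_class k k' u q p) (v + w) = \<rho> (hv_class k k' u q p) v + \<rho> (hv_class k k' u q p) w"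
    and "\<rho> (hv_class k k' u q p) (c *s v) = c *s \<rho> (hv_class k k' u q p) v"
    and "\<rho> (hv_class k k' u q (p + r)) v = \<rho> (hv_class k k' u q p) v + \<rho> (hv_class k k' u q r) v"
    and "\<rho> (hv_class k k' u q (p * r)) v = \<rho> (hv_class k k' u q p) (\<rho> (hv_class k k' u q r) v)"
    and "\<rho> (hv_class k k' u q (hv_const c)) v = c *s v"
  using assms unfolding hv_module_def Let_def hv_class_add hv_class_mult by auto

theorem theorem7p8:
  fixes N D :: nat
    and q :: real
    and C :: "('f::{field,finite} ^ 'n) set set"
    and x :: "('f ^ 'n) set"
    and k k' u :: complex
    and W :: "(complex ^ ('f ^ 'n) set) set"
    and \<rho> :: "hv_free set \<Rightarrow> complex ^ ('f ^ 'n) set \<Rightarrow> complex ^ ('f ^ 'n) set"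
    and \<tau> a b a_star b_star a_tilde b_tilde :: real
  assumes "q = real CARD('f)" and "N = CARD('n)"
    and "3 \<le> D" and "2 * D \<le> N"
    and "delsarte_clique D C" and "x \<in> C"
    and "k = \<i> * complex_of_real (q powr ((real D - real N - 1) / 2))"
    and "k' = \<i> * complex_of_real (q powr (- real D / 2))"
    and "u = complex_of_real (q powr (real D - real N / 2))"
    and "W = vec.span (\<Union>i<D. {char_vec (clique_minus D C x i), char_vec (clique_plus D C x i)})"
    and "hv_module k k' u q W \<rho>"
    and "standard_action k k' u q N D
           (\<lambda>i. char_vec (clique_minus D C x i)) (\<lambda>i. char_vec (clique_plus D C x i)) \<rho>"
    and "\<tau> = - (q powr ((- real N - 1) / 2))"
    and "a = (q - q ^ (N - D + 1) - q ^ (D + 1) - 1) / (q - 1) ^ 2"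
    and "b = q ^ (N + 1) / (q - 1) ^ 2"
    and "a_star = (q ^ N - q) * (2 - q ^ D - q ^ (N - D))
                / ((q - 1) * (q ^ D - 1) * (q ^ (N - D) - 1))"
    and "b_star = (q ^ N - q) * (q ^ N - 1)
                / ((q - 1) * (q ^ D - 1) * (q ^ (N - D) - 1))"
    and "a_tilde = a_star + (q - 1) / (q ^ (N - D + 1) - 1) * b_star"
    and "b_tilde = (q ^ (N - D) - 1) / (q ^ (N - D + 1) - 1) * b_star"
  shows "\<forall>w\<in>W.
           adj_matrix D *v w
             = complex_of_real (\<tau> * b) *s \<rho> (hv_A k k' u q) w + complex_of_real a *s w
         \<and> dual_adj_matrix D x *v w
             = complex_of_real b_star *s \<rho> (hv_A_star k k' u q) w + complex_of_real a_star *s w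
         \<and> dual_adj_matrix_clique D C *v w
             = complex_of_real b_tilde *s \<rho> (hv_A_star_tilde k k' u q) w + complex_of_real a_tilde *s w"
proof -
  define Q E d p where "Q = complex_of_real q" and "E = Q ^ (N - D + 1)" and "d = Q ^ D"
    and "p = inverse (Q - 1)"
  let ?n = "N - D + 1"
  let ?B = "fqnum TYPE('f)"
  let ?cc = "clique_coord D C x"
  let ?c = "hv_class k k' u q"
  have q: "1 < q" using card_field_ge2[where 'f='f] assms(1) by simp
  have Q: "Q \<noteq> 0" "Q \<noteq> 1" using q by (auto simp: Q_def)
  have D: "1 \<le> D" "2 * D \<le> CARD('n)" "D \<le> N" "D < N" using assms(2-4) by auto
  note clique = D(1,2) assms(5,6)
  note param = powr_parameters[OF q D(3) assms(7-9), folded Q_def, folded E_def d_def]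
  have nz: "k \<noteq> 0" "k' \<noteq> 0" using param(1,2) by auto
  have p: "p * (Q - 1) = 1" using Q by (simp add: p_def)
  have B: "?B m = (Q ^ m - 1) * p" for m
    by (simp add: qnum_def Q_def p_def assms(1) divide_inverse)
  have W: "vec.subspace W" using assms(10) by simp
  have gens: "char_vec (clique_minus D C x i) \<in> W" "char_vec (clique_plus D C x i) \<in> W" if "i < D" for i
    unfolding assms(10) using that by (auto intro!: vec.span_base)
  have cc_W: "?cc f g \<in> W" for f g by (intro clique_vec_in_subspace W gens)
  note act = hv_moduleD[OF assms(11)]
  have lin: "\<rho> (?c r) (?cc f g) = (\<Sum>i<D. f i *s \<rho> (?c r) (char_vec (clique_minus D C x i))
      + g i *s \<rho> (?c r) (char_vec (clique_plus D C x i)))" for r f g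
    by (rule linear_on_clique_vec[OF W gens act(3) act(4)])
  note std = assms(12)[unfolded standard_action_def Let_def, folded Q_def]
  have T: "\<rho> (?c gT) (?cc f g) = ?cc (t_minus k Q E f g) (t_plus k Q f g)" for f g
  proof -
    have "Q ^ (N - D + 1) * (Q powi (int D - int N + int i) - 1) = Q ^ (i + 1) - E" for i
      by (simp only: right_diff_distrib power_times_powi_shift[OF Q(1) D(3)] E_def mult_1_right)
    then show ?thesis
      unfolding acts_as_block_clique_vec[OF lin std[THEN conjunct1]]
      by (intro clique_vec_cong)
         (simp_all only: block_t_def mat22_nth E_def[symmetric] t_minus_def t_plus_def, simp_all add: algebra_simps)
  qed
  have U': "\<rho> (?c gU') (?cc f g) = ?cc (\<lambda>i. - f i) (\<lambda>i. (1 / Q ^ (i + 1) - 1) * f i)" for f g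
  proof -
    have "Q powi (- int i - 1) = 1 / Q ^ (i + 1)" for i
    proof -
      have "Q powi (- int i - 1) = Q powi (- int (i + 1))" by (rule arg_cong[where f="power_int Q"]) simp
      then show ?thesis by (simp only: power_int_minus power_int_of_nat inverse_eq_divide)
    qed
    then show ?thesis
      unfolding acts_as_block_clique_vec[OF lin std[THEN conjunct2, THEN conjunct1]]
      by (intro clique_vec_cong) (simp_all add: block_u'_def)
  qed
  have T': "\<rho> (?c gT') (?cc f g) = ?cc (t'_minus k' Q f g) (t'_plus k' Q d f g)" for f g
  proof -
    have "\<rho> (?c gT') (?cc f g) = ?cc
        (\<lambda>i. block_t' k' Q D i $ 2 $ 1 * g (i - 1) + block_t' k' Q D i $ 2 $ 2 * f i)
        (\<lambda>i. block_t' k' Q D (i + 1) $ 1 $ 1 * g i + block_t' k' Q D (i + 1) $ 1 $ 2 * f (i + 1))"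
      by (rule acts_as_shifted_block_clique_vec[OF lin D(1)]) (use std in \<open>auto simp: block_t'_def\<close>)
    also have "\<dots> = ?cc (t'_minus k' Q f g) (t'_plus k' Q d f g)"
      by (intro clique_vec_cong)
         (simp_all add: block_t'_def t'_minus_def t'_plus_def d_def algebra_simps)
    finally show ?thesis .
  qed
  have U: "\<rho> (?c gU) (?cc f g) = ?cc (\<lambda>i. 0) (\<lambda>i. inverse u * ((1 - Q ^ (D - (i + 1))) * f (i + 1) - g i))" for f g
  proof -
    have "\<rho> (?c gU) (?cc f g) = ?cc
        (\<lambda>i. block_u u Q D i $ 2 $ 1 * g (i - 1) + block_u u Q D i $ 2 $ 2 * f i)
        (\<lambda>i. block_u u Q D (i + 1) $ 1 $ 1 * g i + block_u u Q D (i + 1) $ 1 $ 2 * f (i + 1))"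
      by (rule acts_as_shifted_block_clique_vec[OF lin D(1)]) (use std in \<open>auto simp: block_u_def\<close>)
    also have "\<dots> = ?cc (\<lambda>i. 0) (\<lambda>i. inverse u * ((1 - Q ^ (D - (i + 1))) * f (i + 1) - g i))"
      by (intro clique_vec_cong) (simp_all add: block_u_def algebra_simps)
    finally show ?thesis .
  qed
  have kk: "complex_of_real \<tau> = k * k'" using param(3) by (simp add: assms(13))
  have b: "complex_of_real b = E * d * p\<^sup>2"
  proof -
    have "N - D + 1 + D = N + 1" using D by simp
    then have "E * d = Q ^ (N + 1)" unfolding E_def d_def power_add[symmetric] by simp
    then show ?thesis by (simp add: assms(15) Q_def p_def field_simps)
  qed
  have a: "complex_of_real a = (Q - E - d * Q - 1) * p\<^sup>2"
    by (simp add: assms(14) Q_def E_def d_def p_def field_simps)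
  define a1 b1 a2 b2 where "a1 = complex_of_real a_star" and "b1 = complex_of_real b_star"
    and "a2 = complex_of_real a_tilde" and "b2 = complex_of_real b_tilde"
  have th: "complex_of_real (grass_dual_theta q N D i) = a1 + b1 / Q ^ i" for i
    by (simp add: grass_dual_theta_def a1_def b1_def assms(16,17) Q_def)
  \<comment> \<open>In \<open>U T'\<close> the contributions of \<open>f (i + 1)\<close> cancel
    because \<open>Q ^ (D - (i + 1)) * Q ^ (i + 1) = d\<close>. Together with the vanishing minus
    row of \<open>U\<close> this makes \<open>U T'\<close> diagonal.\<close>
  have UT: "c * (inverse u * ((1 - Q ^ (D - (i + 1))) * t'_minus k' Q f g (i + 1) - t'_plus k' Q d f g i))
      = - (c * k' * inverse u * d) / Q ^ (i + 1) * g i" if "i < D" for c f g i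
  proof -
    define y z where "y = Q ^ (D - (i + 1))" and "z = Q ^ (i + 1)"
    have "D - (i + 1) + (i + 1) = D" using that by simp
    then have "y * z = d" unfolding y_def z_def d_def power_add[symmetric] by (simp only:)
    moreover have "z \<noteq> 0" using Q by (simp add: z_def)
    ultimately have "(1 - y) * (k' * ((1 - z) * g i + z * f (i + 1))) - k' * ((1 - z + d) * g i + (z - d) * f (i + 1))
        = - (k' * d) / z * g i"
      by (auto simp: field_simps)
    then have "(1 - y) * t'_minus k' Q f g (i + 1) - t'_plus k' Q d f g i = - (k' * d) / z * g i"
      by (simp add: t'_minus_def t'_plus_def z_def)
    then show ?thesis unfolding y_def[symmetric] z_def[symmetric] by (simp add: mult_ac)
  qed
  \<comment> \<open>\<open>T U'\<close> is diagonal as well and lives on the minus row: the entry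
    \<open>1 / Q ^ (i + 1) - 1\<close> of \<open>U'\<close> is the one for which the plus row of
    \<open>T\<close> cancels.\<close>
  have TU: "Q * k * t_minus k Q E (\<lambda>i. - f i) (\<lambda>i. (1 / Q ^ (i + 1) - 1) * f i) i = 1 / Q ^ i * f i" for f i
  proof -
    define z where "z = Q ^ (i + 1)"
    have z: "z \<noteq> 0" using Q by (simp add: z_def)
    have "t_minus k Q E (\<lambda>i. - f i) (\<lambda>i. (1 / Q ^ (i + 1) - 1) * f i) i = - (k * E) / z * f i"
      unfolding t_minus_def z_def[symmetric] using z by (simp add: field_simps)
    then have "Q * k * t_minus k Q E (\<lambda>i. - f i) (\<lambda>i. (1 / Q ^ (i + 1) - 1) * f i) i = - (k * k * E) * Q / z * f i"
      by simp
    then show ?thesis unfolding param(1) using Q by (simp add: z_def)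
  qed
  have TU': "t_plus k Q (\<lambda>i. - f i) (\<lambda>i. (1 / Q ^ (i + 1) - 1) * f i) i = 0" for f i
    using Q by (simp add: t_plus_def field_simps)
  show ?thesis
  proof
    fix w assume "w \<in> W"
    then obtain f g where w: "w = ?cc f g" unfolding assms(10) by (rule span_eq_clique_vec)
    \<comment> \<open>Both dual elements are handled at once. The minus row always gets
      \<open>q^(-i)\<close>; on the plus row \<open>c = q^(-1/2)\<close> gives
      \<open>q^(-i-1)\<close>, matching the distance from \<open>x\<close>, while
      \<open>c = q^(1/2)\<close> gives \<open>q^(-i)\<close>, matching the distance from the
      clique.\<close>
    have star: "\<rho> (?c (hv_const (of_real q * k) * (hv_const c * gU * gT' + gT * gU'))) w
        = ?cc (\<lambda>i. 1 / Q ^ i * f i) (\<lambda>i. - (Q * k * k' * inverse u * c * d) / Q ^ (i + 1) * g i)" for c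
    proof -
      have "\<rho> (?c (hv_const (of_real q * k) * (hv_const c * gU * gT' + gT * gU'))) w
          = (Q * k) *s (c *s \<rho> (?c gU) (\<rho> (?c gT') w) + \<rho> (?c gT) (\<rho> (?c gU') w))"
        unfolding w Q_def[symmetric] by (simp add: act(2,5,6,7) cc_W W vec.subspace_add vec.subspace_scale)
      also have "\<dots> = ?cc (\<lambda>i. Q * k * (c * 0 + t_minus k Q E (\<lambda>i. - f i) (\<lambda>i. (1 / Q ^ (i + 1) - 1) * f i) i))
          (\<lambda>i. Q * k * (c * (inverse u * ((1 - Q ^ (D - (i + 1))) * t'_minus k' Q f g (i + 1) - t'_plus k' Q d f g i))
            + t_plus k Q (\<lambda>i. - f i) (\<lambda>i. (1 / Q ^ (i + 1) - 1) * f i) i))"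
        unfolding w T T' U U' clique_vec_scale clique_vec_add ..
      also have "\<dots> = ?cc (\<lambda>i. 1 / Q ^ i * f i) (\<lambda>i. - (Q * k * k' * inverse u * c * d) / Q ^ (i + 1) * g i)"
        unfolding TU' using TU UT by (intro clique_vec_cong) (simp_all add: mult_ac)
      finally show ?thesis .
    qed
    have "hv_A k k' u q = ?c (gT' * gT + (gT + hv_const (inverse k - k)) * (gT' + hv_const (inverse k' - k')))"
      unfolding hv_A_def inv_hv_X[OF nz] unfolding hv_X_def hv_class_add ..
    moreover have "\<rho> (?c (gT' * gT + (gT + hv_const c1) * (gT' + hv_const c2))) w = \<rho> (?c gT') (\<rho> (?c gT) w)
        + (\<rho> (?c gT) (\<rho> (?c gT') w + c2 *s w) + c1 *s (\<rho> (?c gT') w + c2 *s w))" for c1 c2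
      unfolding w using W by (simp add: act(2,5,6,7) cc_W vec.subspace_add vec.subspace_scale)
    ultimately have hA: "\<rho> (hv_A k k' u q) w = \<rho> (?c gT') (\<rho> (?c gT) w)
        + (\<rho> (?c gT) (\<rho> (?c gT') w + (inverse k' - k') *s w)
          + (inverse k - k) *s (\<rho> (?c gT') w + (inverse k' - k') *s w))"
      by (simp only:)
    have "complex_of_real (\<tau> * b) *s \<rho> (hv_A k k' u q) w + complex_of_real a *s w
        = ?cc (adj_minus ?B D ?n f g) (adj_plus ?B D ?n f g)"
      unfolding hA unfolding w T T' clique_vec_scale clique_vec_add of_real_mult kk b a
      by (intro clique_vec_cong)
         (rule adj_minus_decomp[OF param(1,2) p B E_def[symmetric] d_def[symmetric]],
          rule adj_plus_decomp[OF param(1,2) p B E_def[symmetric] d_def[symmetric]])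
    then have A: "adj_matrix D *v w = complex_of_real (\<tau> * b) *s \<rho> (hv_A k k' u q) w + complex_of_real a *s w"
      unfolding w adj_matrix_clique_coord[OF clique] assms(2) by simp
    have "b1 *s \<rho> (hv_A_star k k' u q) w + a1 *s w
        = ?cc (\<lambda>i. (a1 + b1 / Q ^ i) * f i) (\<lambda>i. (a1 + b1 / Q ^ (i + 1)) * g i)"
      unfolding hv_A_star_def star param(4) unfolding w clique_vec_scale clique_vec_add
      by (intro clique_vec_cong) (simp_all add: algebra_simps)
    then have A_star: "dual_adj_matrix D x *v w = b1 *s \<rho> (hv_A_star k k' u q) w + a1 *s w"
      unfolding w dual_adj_matrix_clique_coord[OF clique] assms(1,2)[symmetric] th by simp
    \<comment> \<open>The weights are affine in \<open>q^i\<close>, but the two dual eigenvalues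
      differ by a multiple of \<open>q^(-i-1)\<close>, so the average is again affine in
      \<open>q^(-i)\<close>; its coefficients are the origin of \<open>a_tilde\<close> and
      \<open>b_tilde\<close>.\<close>
    have mu: "(?B (i + 1) * (a1 + b1 / Q ^ i) + (?B ?n - ?B (i + 1)) * (a1 + b1 / Q ^ (i + 1))) / ?B ?n
        = a2 + b2 / Q ^ i" for i
    proof -
      have "q ^ (N - D + 1) \<noteq> 1" using one_less_power[OF q, of "N - D + 1"] by simp
      then have E: "E - 1 \<noteq> 0" unfolding E_def Q_def by (metis eq_iff_diff_eq_0 of_real_eq_1_iff of_real_power)
      have e: "Q ^ (N - D) = E / Q" using Q by (simp add: E_def)
      have ab: "a2 = a1 + (Q - 1) / (E - 1) * b1" "b2 = (E / Q - 1) / (E - 1) * b1"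
        unfolding e[symmetric] by (simp_all add: a2_def b2_def a1_def b1_def assms(18,19) E_def Q_def)
      have p0: "p \<noteq> 0" using p by auto
      have gen: "((Q * z - 1) * p * (a1 + b1 / z) + ((E - 1) * p - (Q * z - 1) * p) * (a1 + b1 / (Q * z))) / ((E - 1) * p)
          = a2 + b2 / z" if z: "z \<noteq> 0" for z
      proof -
        have "((Q * z - 1) * p * (a1 + b1 / z) + ((E - 1) * p - (Q * z - 1) * p) * (a1 + b1 / (Q * z)))
            = ((E - 1) * p) * a1 + p * b1 * ((Q - 1) + (E / Q - 1) / z)"
          using Q(1) z by (simp add: field_simps)
        then have "((Q * z - 1) * p * (a1 + b1 / z) + ((E - 1) * p - (Q * z - 1) * p) * (a1 + b1 / (Q * z))) / ((E - 1) * p)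
            = a1 + b1 * ((Q - 1) + (E / Q - 1) / z) / (E - 1)"
          using E p0 by (simp only: add_divide_distrib) simp
        also have "\<dots> = a2 + b2 / z" unfolding ab by (simp add: distrib_left add_divide_distrib mult.commute)
        finally show ?thesis .
      qed
      have "Q ^ (i + 1) = Q * Q ^ i" by simp
      then show ?thesis
        unfolding B E_def[symmetric] using gen[of "Q ^ i"] Q(1) by simp
    qed
    have "b2 *s \<rho> (hv_A_star_tilde k k' u q) w + a2 *s w
        = ?cc (\<lambda>i. (a2 + b2 / Q ^ i) * f i) (\<lambda>i. (a2 + b2 / Q ^ i) * g i)"
      unfolding hv_A_star_tilde_def star param(5) unfolding w clique_vec_scale clique_vec_add
      using Q by (intro clique_vec_cong) (simp_all add: algebra_simps)
    then have "dual_adj_matrix_clique D C *v w = b2 *s \<rho> (hv_A_star_tilde k k' u q) w + a2 *s w"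
      unfolding w dual_adj_matrix_clique_clique_coord[OF clique] assms(1,2)[symmetric] th
      unfolding mu[folded assms(1)] by simp
    then show "adj_matrix D *v w = complex_of_real (\<tau> * b) *s \<rho> (hv_A k k' u q) w + complex_of_real a *s w
        \<and> dual_adj_matrix D x *v w
            = complex_of_real b_star *s \<rho> (hv_A_star k k' u q) w + complex_of_real a_star *s w
        \<and> dual_adj_matrix_clique D C *v w
            = complex_of_real b_tilde *s \<rho> (hv_A_star_tilde k k' u q) w + complex_of_real a_tilde *s w"
      using A A_star unfolding a1_def b1_def a2_def b2_def by blast
  qed
qed

end
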